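(* Fix an integer $r\ge2$. For all constants $0<c_1\le1$ and $c_2\ge1$ there is a positive constant $C_r^*(c_1,c_2)$ depending on $r$, $c_1$ and $c_2$ alone such that the following holds for every $n\ge2r$. Suppose $\theta^*\in\mathbb{R}^n$, $D^{(r)}\theta^*\ne0$ and $\theta^*$ satisfies the length condition $$\min_{0\le i\le k:\,s_i\ne s_{i+1}}n_i\ge\frac{c_1n}{k+1}\quad\text{and}\quad\max_{0\le i\le k:\,s_i\ne s_{i+1}}n_i\le\frac{c_2n}{k+1},$$ where $k,s_i,n_i$ are determined by the $r$th order knots of $\theta^*$ as in the context. Then $\lambda^*$ (defined in the context) satisfies $$\lambda^*\le C_r^*(c_1,c_2)\sqrt{n\log\left(\frac{en}{k+1}\right)}.$$
   Context: For $\theta\in\mathbb{R}^n$, $D^{(0)}\theta := \theta$, $D^{(1)}\theta := (\theta_2-\theta_1,\dots,\theta_n-\theta_{n-1})$, $D^{(r)}\theta := D^{(1)}(D^{(r-1)}\theta)\in\mathbb{R}^{n-r}$. $\|\cdot\|$ is the Euclidean norm, $\|\cdot\|_1$ the $\ell^1$ norm, $\|\cdot\|_0$ the number of non-zero entries. Knots and signs: an index $2\le j\le n-r+1$ is an $r$th order knot of $\theta$ if $(D^{(r-1)}\theta)_{j-1}\ne (D^{(r-1)}\theta)_j$; its sign is $+1$ if $(D^{(r-1)}\theta)_{j-1} < (D^{(r-1)}\theta)_j$ and $-1$ otherwise. Let $2\le j_1<\dots<j_k\le n-r+1$ be all the $r$th order knots of $\theta^*$ (so $k=\|D^{(r)}\theta^*\|_0\ge1$)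 with signs $s_1,\dots,s_k$, and $s_0=s_{k+1}=0$. Let $n_0 := j_1+r-2$, $n_i := j_{i+1}-j_i$ for $1\le i\le k-1$, $n_k := n-r+2-j_k$. With $f(\theta) := \|D^{(r)}\theta\|_1$, subdifferential $\partial f(\theta^* )$ and $\operatorname{aff}$ denoting the affine hull, let $v_0 := \operatorname{argmin}_{v\in\operatorname{aff}(\partial f(\theta^* ))}\|v\|$ (non-zero), $\lambda_{\theta^*}(z) := \operatorname{argmin}_{\lambda\ge0}\inf_{v\in\partial f(\theta^* )}\|z-\lambda v\|$ for $z\in\mathbb{R}^n$ (uniquely defined), and $\lambda^* := n^{1-r}\big(\mathbb{E}\lambda_{\theta^*}(Z)+\frac2{\|v_0\|}\big)$ where $Z\sim N_n(0,I_n)$. The paper assumes $n\ge2r$ throughout. *)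

theory Defs
  imports "HOL-Probability.Probability" "HOL-Library.Function_Algebras"
begin

text \<open>
  The dimension \<open>n\<close> is quantified inside the theorem, below a constant that must not depend on it,
  so it cannot be a type. A vector of \<open>\<real>\<^sup>n\<close> is a function on \<open>nat\<close> with entries at the indices
  \<open>1, \<dots>, n\<close> and value \<open>0\<close> elsewhere. The pointwise real vector space structure makes the library's
  \<open>affine hull\<close> available; \<open>Rn n\<close> is a subspace, so hulls of its subsets stay inside it.
\<close>

instantiation "fun" :: (type, real_vector) real_vector
begin

definition scaleR_fun :: "real \<Rightarrow> ('a \<Rightarrow> 'b) \<Rightarrow> 'a \<Rightarrow> 'b" where
  "scaleR_fun a f = (\<lambda>x. a *\<^sub>R f x)"

instance
  by intro_classes (auto simp: fun_eq_iff scaleR_fun_def scaleR_add_left scaleR_add_right)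

end

definition Rn :: "nat \<Rightarrow> (nat \<Rightarrow> real) set" where
  "Rn n = {x. \<forall>i. i \<notin> {1..n} \<longrightarrow> x i = 0}"

definition enorm :: "nat \<Rightarrow> (nat \<Rightarrow> real) \<Rightarrow> real" where
  "enorm n x = L2_set x {1..n}"

definition diff1 :: "nat \<Rightarrow> (nat \<Rightarrow> real) \<Rightarrow> nat \<Rightarrow> real" where
  "diff1 n \<theta> = (\<lambda>i. if i \<in> {1..<n} then \<theta> (i + 1) - \<theta> i else 0)"

text \<open>\<open>Diff n r\<close> is the operator \<open>D\<^sup>(\<^sup>r\<^sup>)\<close> from \<open>Rn n\<close> to \<open>Rn (n - r)\<close>.\<close>

primrec Diff :: "nat \<Rightarrow> nat \<Rightarrow> (nat \<Rightarrow> real) \<Rightarrow> nat \<Rightarrow> real" where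
  "Diff n 0 \<theta> = \<theta>"
| "Diff n (Suc r) \<theta> = diff1 (n - r) (Diff n r \<theta>)"

definition knots :: "nat \<Rightarrow> nat \<Rightarrow> (nat \<Rightarrow> real) \<Rightarrow> nat set" where
  "knots n r \<theta> = {j \<in> {2..n - r + 1}. Diff n (r - 1) \<theta> (j - 1) \<noteq> Diff n (r - 1) \<theta> j}"

definition num_knots :: "nat \<Rightarrow> nat \<Rightarrow> (nat \<Rightarrow> real) \<Rightarrow> nat" where
  "num_knots n r \<theta> = card (knots n r \<theta>)"

text \<open>The knots \<open>j\<^sub>1 < \<dots> < j\<^sub>k\<close> in increasing order, for \<open>1 \<le> i \<le> k\<close>.\<close>

definition knot :: "nat \<Rightarrow> nat \<Rightarrow> (nat \<Rightarrow> real) \<Rightarrow> nat \<Rightarrow> nat" where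
  "knot n r \<theta> i = sorted_list_of_set (knots n r \<theta>) ! (i - 1)"

definition knot_sign :: "nat \<Rightarrow> nat \<Rightarrow> (nat \<Rightarrow> real) \<Rightarrow> nat \<Rightarrow> int" where
  "knot_sign n r \<theta> i =
     (if i \<in> {1..num_knots n r \<theta>} then
        (let j = knot n r \<theta> i in
         if Diff n (r - 1) \<theta> (j - 1) < Diff n (r - 1) \<theta> j then 1 else - 1)
      else 0)"

text \<open>No subtraction truncates when \<open>k \<ge> 1\<close> and \<open>r \<le> n\<close>, as \<open>2 \<le> j\<^sub>1\<close> and \<open>j\<^sub>k \<le> n - r + 1\<close>.\<close>

definition piece_length :: "nat \<Rightarrow> nat \<Rightarrow> (nat \<Rightarrow> real) \<Rightarrow> nat \<Rightarrow> nat" where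
  "piece_length n r \<theta> i =
     (if i = 0 then knot n r \<theta> 1 + r - 2
      else if i = num_knots n r \<theta> then n - r + 2 - knot n r \<theta> i
      else knot n r \<theta> (i + 1) - knot n r \<theta> i)"

definition sign_change_pieces :: "nat \<Rightarrow> nat \<Rightarrow> (nat \<Rightarrow> real) \<Rightarrow> nat set" where
  "sign_change_pieces n r \<theta> =
     {i \<in> {0..num_knots n r \<theta>}. knot_sign n r \<theta> i \<noteq> knot_sign n r \<theta> (i + 1)}"

definition length_condition ::
    "nat \<Rightarrow> nat \<Rightarrow> real \<Rightarrow> real \<Rightarrow> (nat \<Rightarrow> real) \<Rightarrow> bool" where
  "length_condition n r c1 c2 \<theta> \<longleftrightarrow>
     real (Min (piece_length n r \<theta> ` sign_change_pieces n r \<theta>))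
       \<ge> c1 * real n / (real (num_knots n r \<theta>) + 1) \<and>
     real (Max (piece_length n r \<theta> ` sign_change_pieces n r \<theta>))
       \<le> c2 * real n / (real (num_knots n r \<theta>) + 1)"

definition tv :: "nat \<Rightarrow> nat \<Rightarrow> (nat \<Rightarrow> real) \<Rightarrow> real" where
  "tv n r \<theta> = (\<Sum>i = 1..n - r. \<bar>Diff n r \<theta> i\<bar>)"

definition subdifferential ::
    "nat \<Rightarrow> ((nat \<Rightarrow> real) \<Rightarrow> real) \<Rightarrow> (nat \<Rightarrow> real) \<Rightarrow> (nat \<Rightarrow> real) set" where
  "subdifferential n f \<theta> =
     {v \<in> Rn n. \<forall>x \<in> Rn n. f x \<ge> f \<theta> + (\<Sum>i = 1..n. v i * (x i - \<theta> i))}"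

definition v_zero :: "nat \<Rightarrow> nat \<Rightarrow> (nat \<Rightarrow> real) \<Rightarrow> nat \<Rightarrow> real" where
  "v_zero n r \<theta> = arg_min_on (enorm n) (affine hull (subdifferential n (tv n r) \<theta>))"

definition lambda_at :: "nat \<Rightarrow> nat \<Rightarrow> (nat \<Rightarrow> real) \<Rightarrow> (nat \<Rightarrow> real) \<Rightarrow> real" where
  "lambda_at n r \<theta> z =
     arg_min_on (\<lambda>l. INF v \<in> subdifferential n (tv n r) \<theta>. enorm n (z - l *\<^sub>R v)) {0..}"

text \<open>
  The law of \<open>Z \<sim> N\<^sub>n(0, I\<^sub>n)\<close>. Points of the product space are \<open>undefined\<close> instead of \<open>0\<close> outside
  \<open>{1..n}\<close>; this is harmless, since \<open>lambda_at n r \<theta> z\<close> depends on \<open>z\<close> only through the entries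
  \<open>z 1, \<dots>, z n\<close>.
\<close>

definition std_gaussian :: "nat \<Rightarrow> (nat \<Rightarrow> real) measure" where
  "std_gaussian n = PiM {1..n} (\<lambda>_. density lborel (\<lambda>x. ennreal (std_normal_density x)))"

definition lambda_star :: "nat \<Rightarrow> nat \<Rightarrow> (nat \<Rightarrow> real) \<Rightarrow> real" where
  "lambda_star n r \<theta> =
     real n powi (1 - int r) *
       ((\<integral>z. lambda_at n r \<theta> z \<partial>std_gaussian n) + 2 / enorm n (v_zero n r \<theta>))"

end

theory Submission
  imports Defs
begin

text \<open>
  Let \<open>S\<close> be the subdifferential of the total variation \<open>f\<close> at \<open>\<theta>\<close>. Take a vector \<open>\<psi>\<close> whose
  difference of order \<open>r\<close> is concentrated at the first knot and equals the sign of that knot. Along \<open>\<psi>\<close>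
  the function \<open>f\<close> is affine near \<open>\<theta>\<close>, so \<open>\<langle>v, \<psi>\<rangle> = 1\<close> for all \<open>v \<in> S\<close> and hence on the affine hull of
  \<open>S\<close>. Therefore \<open>1 / \<parallel>v\<^sub>0\<parallel> \<le> \<parallel>\<psi>\<parallel>\<close>. A truncated power function supported on the first piece serves as
  \<open>\<psi>\<close>; as this piece has length at most \<open>L = c\<^sub>2 n / (k + 1)\<close>, the norm of \<open>\<psi>\<close> is at most \<open>L\<close> to the
  power \<open>r - 1 / 2\<close>.

  Let \<open>\<lambda> v\<close> be the point of the cone over \<open>S\<close> that is closest to \<open>z\<close>, and \<open>x = z - \<lambda> v\<close> the residual.
  Then \<open>\<lambda> = \<langle>z, \<psi>\<rangle> - \<langle>x, \<psi>\<rangle> \<le> \<langle>z, \<psi>\<rangle> + \<parallel>x\<parallel> \<parallel>\<psi>\<parallel>\<close>, so everything depends on \<open>\<parallel>x\<parallel>\<close>. The residual satisfies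
  \<open>\<parallel>x\<parallel>\<^sup>2 = \<langle>z, x\<rangle>\<close>, and the directional derivative \<open>f' (\<theta>; x)\<close> is at most zero.

  Put \<open>g = D\<^sup>(\<^sup>r\<^sup>-\<^sup>1\<^sup>) x\<close>. The derivative \<open>f' (\<theta>; x)\<close> is a sum over the segments between consecutive knots; the
  term of segment \<open>i\<close> is the variation of \<open>g\<close> on it plus \<open>s\<^sub>i g(left) - s\<^sub>i\<^sub>+\<^sub>1 g(right)\<close>. Such a term is
  at least \<open>(s\<^sub>i - s\<^sub>i\<^sub>+\<^sub>1) g(p)\<close> for every point \<open>p\<close> of the segment. It can be negative only where the
  sign changes, and there only by an amount of order \<open>\<parallel>x\<parallel>\<close> over the length to the power \<open>r - 1 / 2\<close>,
  because \<open>g\<close> cannot be large on a whole window without \<open>x\<close> being large (\<open>exists_small_difference\<close>).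
  This is where the lower length condition enters. Since the terms sum to at most zero, all of them
  are also bounded above (\<open>seg_term_upper\<close>). In turn the variation of \<open>g\<close> between two points of a
  segment is bounded by the term and the values of \<open>g\<close> at these points (\<open>seg_variation\<close>), and the
  points can be chosen so that the values are small.

  For the correlation \<open>\<langle>z, x\<rangle>\<close> the index range is cut into dyadic blocks whose size is comparable to the
  distance from the knots and at most \<open>n / (k + 1)\<close>. On a block of length \<open>w\<close> the norm of \<open>x\<close> and the
  variation of \<open>g\<close> control the correlation with \<open>z\<close>, up to a random factor whose second moment is
  bounded (\<open>block_correlation\<close>, \<open>energy_expectation\<close>). The Cauchy--Schwarz inequality over the blocks
  gives \<open>\<parallel>x\<parallel> \<le> C (k + 1) sqrt E\<close>, where the expectation of \<open>E\<close> is at most four times the number of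
  blocks (\<open>correlation_bound\<close>). There are \<open>O((k + 1) log (e n / (k + 1)))\<close> blocks: a logarithmic number
  at each knot, and \<open>O(k + 1)\<close> of full size. The resulting factor \<open>k + 1\<close> to the power \<open>3 / 2\<close> is
  absorbed by \<open>\<parallel>\<psi>\<parallel>\<close>, because \<open>3 / 2 \<le> r - 1 / 2\<close>.
\<close>

section \<open>Iterated differences on a window\<close>

text \<open>
  The difference operator without boundary. Since it acts on the same type at every order, its
  powers commute with shifts and with each other.
\<close>

definition fd :: "(nat \<Rightarrow> real) \<Rightarrow> nat \<Rightarrow> real" where
  "fd x i = x (Suc i) - x i"

lemma Diff_eq_fd: "i \<in> {1..n - r} \<Longrightarrow> Diff n r x i = (fd ^^ r) x i"
proof (induction r arbitrary: i)
  case (Suc r)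
  have "i \<in> {1..<n - r}" "i \<in> {1..n - r}" "Suc i \<in> {1..n - r}"
    using Suc.prems by auto
  then show ?case
    using Suc.IH by (simp add: diff1_def fd_def)
qed simp

definition gap_diff :: "nat \<Rightarrow> (nat \<Rightarrow> real) \<Rightarrow> nat \<Rightarrow> real" where
  "gap_diff h x i = x (i + h) - x i"

lemma sum_shift_Ioc:
  fixes f :: "nat \<Rightarrow> real"
  shows "(\<Sum>i\<in>{a<..b}. f (i + h)) = (\<Sum>i\<in>{a + h<..b + h}. f i)"
  by (rule sum.reindex_bij_witness[where i = "\<lambda>i. i - h" and j = "\<lambda>i. i + h"]) auto

text \<open>
  Each difference with gap \<open>h\<close> at most doubles the absolute sum, at the price of looking \<open>h\<close>
  indices further ahead.
\<close>

lemma sum_gap_diff_funpow_le: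
  "(\<Sum>i\<in>{a<..a + N}. \<bar>(gap_diff h ^^ q) x i\<bar>) \<le> 2 ^ q * (\<Sum>i\<in>{a<..a + N + q * h}. \<bar>x i\<bar>)"
proof (induction q arbitrary: x)
  case (Suc q)
  have "(\<Sum>i\<in>{a<..a + N}. \<bar>(gap_diff h ^^ Suc q) x i\<bar>)
      \<le> 2 ^ q * (\<Sum>i\<in>{a<..a + N + q * h}. \<bar>gap_diff h x i\<bar>)"
    using Suc.IH[of "gap_diff h x"] by (simp add: funpow_swap1)
  also have "(\<Sum>i\<in>{a<..a + N + q * h}. \<bar>gap_diff h x i\<bar>)
      \<le> (\<Sum>i\<in>{a<..a + N + q * h}. \<bar>x (i + h)\<bar>) + (\<Sum>i\<in>{a<..a + N + q * h}. \<bar>x i\<bar>)"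
    unfolding sum.distrib[symmetric] gap_diff_def by (rule sum_mono) linarith
  also have "(\<Sum>i\<in>{a<..a + N + q * h}. \<bar>x (i + h)\<bar>) \<le> (\<Sum>i\<in>{a<..a + N + Suc q * h}. \<bar>x i\<bar>)"
    unfolding sum_shift_Ioc[where f = "\<lambda>i. \<bar>x i\<bar>"] by (rule sum_mono2) auto
  also have "(\<Sum>i\<in>{a<..a + N + q * h}. \<bar>x i\<bar>) \<le> (\<Sum>i\<in>{a<..a + N + Suc q * h}. \<bar>x i\<bar>)"
    by (rule sum_mono2) auto
  finally show ?case by (simp add: algebra_simps)
qed simp

lemma fd_funpow_gap_diff: "(fd ^^ q) (gap_diff h x) i = (fd ^^ q) x (i + h) - (fd ^^ q) x i"
  by (induction q arbitrary: i) (auto simp: gap_diff_def fd_def)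

lemma sum_fd: "a \<le> b \<Longrightarrow> (\<Sum>t\<in>{a..<b}. fd y t) = y b - y a"
  unfolding fd_def by (rule sum_Suc_diff')

text \<open>
  A difference with gap \<open>h\<close> is the sum of \<open>h\<close> consecutive ordinary differences. Thus the
  \<open>q\<close>-fold difference with gap \<open>h\<close> is a sum of \<open>h ^ q\<close> ordinary \<open>q\<close>-fold differences, and a lower
  bound for the latter is amplified by this factor.
\<close>

lemma gap_diff_funpow_ge:
  assumes "\<And>i. i \<in> {a<..a + N} \<Longrightarrow> m \<le> (fd ^^ q) x i"
    and "a < i" "i + q * h \<le> a + N + q" "1 \<le> h"
  shows "real h ^ q * m \<le> (gap_diff h ^^ q) x i"
  using assms
proof (induction q arbitrary: x N m)
  case (Suc q)
  have "q \<le> q * h" using \<open>1 \<le> h\<close> by simp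
  moreover have "i + (h + q * h) \<le> a + N + Suc q" using Suc.prems(3) by simp
  ultimately have "h \<le> N" using Suc.prems(2) by linarith
  have "real h ^ q * (real h * m) \<le> (gap_diff h ^^ q) (gap_diff h x) i"
  proof (rule Suc.IH[where N = "N + 1 - h"])
    fix j assume j: "j \<in> {a<..a + (N + 1 - h)}"
    have "real h * m = (\<Sum>t\<in>{j..<j + h}. m)" by simp
    also have "\<dots> \<le> (\<Sum>t\<in>{j..<j + h}. fd ((fd ^^ q) x) t)"
      by (rule sum_mono) (use Suc.prems(1) j \<open>h \<le> N\<close> in auto)
    also have "\<dots> = (fd ^^ q) (gap_diff h x) j"
      by (simp add: sum_fd fd_funpow_gap_diff)
    finally show "real h * m \<le> (fd ^^ q) (gap_diff h x) j" .
  next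
    show "i + q * h \<le> a + (N + 1 - h) + q" using Suc.prems(3) \<open>h \<le> N\<close> by auto
  qed (use Suc.prems in auto)
  then show ?case by (simp add: funpow_swap1 mult_ac)
qed auto

definition window_const :: "nat \<Rightarrow> real" where
  "window_const q = 2 ^ q * (2 * real (q + 1)) ^ (q + 1)"

lemma window_const_pos: "0 < window_const q"
  unfolding window_const_def by (intro mult_pos_pos zero_less_power) auto

text \<open>
  If all \<open>q\<close>-fold differences on a window of length \<open>l\<close> were at least \<open>m\<close>, then the differences
  with gap \<open>h \<approx> l / (q + 1)\<close> would be at least \<open>h ^ q * m\<close> at \<open>h\<close> places, while their absolute sum
  is at most \<open>2 ^ q\<close> times that of the vector. So \<open>m\<close> is at most of order \<open>l ^ (- q - 1)\<close> times the
  absolute sum. Through this inequality all control of derivatives by norms passes.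
\<close>

lemma exists_small_difference:
  assumes "q < l"
  shows "\<exists>i\<in>{a<..a + l - q}. real l ^ (q + 1) * (fd ^^ q) x i
            \<le> window_const q * (\<Sum>t\<in>{a<..a + l}. \<bar>x t\<bar>)"
proof -
  define h where "h = l div (q + 1)"
  define A where "A = (\<Sum>t\<in>{a<..a + l}. \<bar>x t\<bar>)"
  have "A \<ge> 0" unfolding A_def by (simp add: sum_nonneg)
  have h1: "1 \<le> h" unfolding h_def using assms div_greater_zero_iff[of l "q + 1"] by linarith
  have hl: "(q + 1) * h \<le> l" unfolding h_def by (rule times_div_less_eq_dividend)
  have "l < (q + 1) * (h + 1)" unfolding h_def
    using dividend_less_div_times[of "q + 1" l] by (simp add: algebra_simps)
  also have "(q + 1) * (h + 1) \<le> 2 * (q + 1) * h"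
    using mult_le_mono2[OF h1, of "q + 1"] by (simp add: algebra_simps)
  finally have lh: "real l \<le> 2 * real (q + 1) * real h"
    by (metis less_imp_le of_nat_le_iff of_nat_mult of_nat_numeral)
  let ?I = "{a<..a + l - q}"
  have "finite ?I" "?I \<noteq> {}" using assms by auto
  from ex_is_arg_min_if_finite[OF this, of "(fd ^^ q) x"] obtain i
    where i: "i \<in> ?I" and imin: "\<And>j. j \<in> ?I \<Longrightarrow> (fd ^^ q) x i \<le> (fd ^^ q) x j"
    unfolding is_arg_min_linorder by metis
  define m where "m = (fd ^^ q) x i"
  have "real h * (real h ^ q * m) = (\<Sum>j\<in>{a<..a + h}. real h ^ q * m)" by simp
  also have "\<dots> \<le> (\<Sum>j\<in>{a<..a + h}. \<bar>(gap_diff h ^^ q) x j\<bar>)"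
  proof (rule sum_mono)
    fix j assume j: "j \<in> {a<..a + h}"
    have "real h ^ q * m \<le> (gap_diff h ^^ q) x j"
      by (rule gap_diff_funpow_ge[where N = "l - q" and a = a])
        (use j h1 hl assms imin in \<open>auto simp: m_def\<close>)
    then show "real h ^ q * m \<le> \<bar>(gap_diff h ^^ q) x j\<bar>" by linarith
  qed
  also have "\<dots> \<le> 2 ^ q * (\<Sum>t\<in>{a<..a + h + q * h}. \<bar>x t\<bar>)"
    by (rule sum_gap_diff_funpow_le)
  also have "\<dots> \<le> 2 ^ q * A"
    unfolding A_def by (intro mult_left_mono sum_mono2) (use hl in auto)
  finally have *: "real h ^ (q + 1) * m \<le> 2 ^ q * A" by (simp add: mult_ac)
  have "real l ^ (q + 1) * m \<le> window_const q * A"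
  proof (cases "m \<le> 0")
    case True
    then have "real l ^ (q + 1) * m \<le> 0" by (intro mult_nonneg_nonpos) auto
    also have "0 \<le> window_const q * A" using window_const_pos[of q] \<open>A \<ge> 0\<close> by simp
    finally show ?thesis .
  next
    case False
    have "real l ^ (q + 1) * m \<le> (2 * real (q + 1) * real h) ^ (q + 1) * m"
      by (intro mult_right_mono power_mono lh) (use False in auto)
    also have "\<dots> = (2 * real (q + 1)) ^ (q + 1) * (real h ^ (q + 1) * m)"
      by (simp add: power_mult_distrib)
    also have "\<dots> \<le> (2 * real (q + 1)) ^ (q + 1) * (2 ^ q * A)"
      by (intro mult_left_mono *) auto
    finally show ?thesis by (simp add: window_const_def mult_ac)
  qed
  then show ?thesis using i unfolding m_def A_def by blast
qed

lemma fd_funpow_uminus: "(fd ^^ q) (\<lambda>i. - x i) i = - (fd ^^ q) x i"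
  by (induction q arbitrary: i) (auto simp: fd_def)

section \<open>Correlation of a vector with noise on one block\<close>

definition l1 :: "(nat \<Rightarrow> real) \<Rightarrow> nat \<Rightarrow> nat \<Rightarrow> real" where
  "l1 x a w = (\<Sum>t\<in>{a<..a + w}. \<bar>x t\<bar>)"

definition var_on :: "nat \<Rightarrow> (nat \<Rightarrow> real) \<Rightarrow> nat \<Rightarrow> nat \<Rightarrow> real" where
  "var_on r x a w = (\<Sum>i\<in>{a<..a + w - r}. \<bar>(fd ^^ r) x i\<bar>)"

lemma l1_nonneg: "0 \<le> l1 x a w" unfolding l1_def by (simp add: sum_nonneg)
lemma var_on_nonneg: "0 \<le> var_on r x a w" unfolding var_on_def by (simp add: sum_nonneg)

lemma l1_uminus: "l1 (\<lambda>i. - x i) a w = l1 x a w"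
  by (simp add: l1_def)

lemma abs_diff_le_sum_fd:
  assumes "i \<le> j"
  shows "\<bar>y j - y i\<bar> \<le> (\<Sum>t\<in>{i..<j}. \<bar>fd y t\<bar>)"
  using sum_fd[OF assms, of y] sum_abs[of "fd y" "{i..<j}"] by simp

lemma abs_fd_funpow_le_var_on:
  assumes "i \<in> {a<..a + w - p}" "j \<in> {a<..a + w - p}"
  shows "\<bar>(fd ^^ p) x j - (fd ^^ p) x i\<bar> \<le> var_on (Suc p) x a w"
proof -
  have *: "\<bar>(fd ^^ p) x j - (fd ^^ p) x i\<bar> \<le> var_on (Suc p) x a w"
    if "i \<le> j" "i \<in> {a<..a + w - p}" "j \<in> {a<..a + w - p}" for i j
  proof -
    have "\<bar>(fd ^^ p) x j - (fd ^^ p) x i\<bar> \<le> (\<Sum>t\<in>{i..<j}. \<bar>fd ((fd ^^ p) x) t\<bar>)"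
      by (rule abs_diff_le_sum_fd) fact
    also have "\<dots> \<le> (\<Sum>t\<in>{a<..a + w - Suc p}. \<bar>fd ((fd ^^ p) x) t\<bar>)"
      by (rule sum_mono2) (use that in auto)
    finally show ?thesis by (simp add: var_on_def)
  qed
  show ?thesis
    using *[of i j] *[of j i] assms by (cases "i \<le> j") (auto simp: abs_minus_commute)
qed

text \<open>
  Some difference on the block is small by the window inequality, and the variation bounds how far the others are
  from it.
\<close>

lemma pointwise_difference_bound:
  assumes "p < w" "i \<in> {a<..a + w - p}"
  shows "real w ^ Suc p * \<bar>(fd ^^ p) x i\<bar>
    \<le> window_const p * l1 x a w + real w ^ Suc p * var_on (Suc p) x a w"
proof -
  have *: "real w ^ Suc p * (fd ^^ p) y i
      \<le> window_const p * l1 y a w + real w ^ Suc p * V"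
    if V: "\<And>j. j \<in> {a<..a + w - p} \<Longrightarrow> (fd ^^ p) y i - (fd ^^ p) y j \<le> V" for y V
  proof -
    obtain j where j: "j \<in> {a<..a + w - p}"
      and "real w ^ (p + 1) * (fd ^^ p) y j \<le> window_const p * l1 y a w"
      using exists_small_difference[OF assms(1)] unfolding l1_def by blast
    moreover have "real w ^ Suc p * ((fd ^^ p) y i - (fd ^^ p) y j) \<le> real w ^ Suc p * V"
      by (intro mult_left_mono V j) auto
    ultimately show ?thesis by (simp add: algebra_simps)
  qed
  have "real w ^ Suc p * (fd ^^ p) x i
      \<le> window_const p * l1 x a w + real w ^ Suc p * var_on (Suc p) x a w"
    by (rule *) (use abs_fd_funpow_le_var_on[OF _ assms(2)] abs_fd_funpow_le_var_on in \<open>smt (verit) assms(2)\<close>)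
  moreover have "real w ^ Suc p * (fd ^^ p) (\<lambda>i. - x i) i
      \<le> window_const p * l1 (\<lambda>i. - x i) a w + real w ^ Suc p * var_on (Suc p) x a w"
    by (rule *) (use abs_fd_funpow_le_var_on[OF assms(2)] in \<open>auto simp: fd_funpow_uminus abs_le_iff\<close>)
  ultimately show ?thesis
    by (cases "(fd ^^ p) x i \<ge> 0") (auto simp: fd_funpow_uminus l1_uminus)
qed

lemma var_on_step:
  "real w ^ p * var_on p x a w
    \<le> window_const p * l1 x a w + real w ^ Suc p * var_on (Suc p) x a w"
proof (cases "p < w")
  case True
  define R where "R = window_const p * l1 x a w + real w ^ Suc p * var_on (Suc p) x a w"
  have "R \<ge> 0" unfolding R_def using window_const_pos[of p]
    by (intro add_nonneg_nonneg mult_nonneg_nonneg) (auto simp: l1_nonneg var_on_nonneg)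
  have "real w * (real w ^ p * var_on p x a w) = (\<Sum>i\<in>{a<..a + w - p}. real w ^ Suc p * \<bar>(fd ^^ p) x i\<bar>)"
    by (simp add: var_on_def sum_distrib_left mult_ac)
  also have "\<dots> \<le> (\<Sum>i\<in>{a<..a + w - p}. R)"
    unfolding R_def by (rule sum_mono) (rule pointwise_difference_bound[OF True])
  also have "\<dots> = real (w - p) * R" using True by simp
  also have "\<dots> \<le> real w * R" using \<open>R \<ge> 0\<close> by (intro mult_right_mono) auto
  finally show ?thesis using True unfolding R_def by simp
next
  case False
  then have "var_on p x a w = 0" by (simp add: var_on_def)
  then show ?thesis using window_const_pos[of p] l1_nonneg[of x a w] var_on_nonneg[of "Suc p" x a w]
    by simp
qed

definition interp_const :: "nat \<Rightarrow> real" where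
  "interp_const r = (\<Prod>q<r. 1 + window_const q)"

lemma interp_const_ge_1: "1 \<le> interp_const r"
  unfolding interp_const_def using window_const_pos by (intro prod_ge_1) (simp add: less_imp_le)

lemma interpolation_step:
  "l1 x a w + real w ^ p * var_on p x a w
    \<le> (1 + window_const p) * (l1 x a w + real w ^ Suc p * var_on (Suc p) x a w)"
proof -
  have "0 \<le> window_const p * (real w ^ Suc p * var_on (Suc p) x a w)"
    using window_const_pos[of p] var_on_nonneg[of "Suc p" x a w] by simp
  then show ?thesis using var_on_step[of w p x a] by (simp add: algebra_simps)
qed

text \<open>
  A discrete interpolation inequality: up to constants, \<open>w ^ p\<close> times the variation of order
  \<open>p\<close> increases with \<open>p\<close> once the absolute sum is added to it.
\<close>

lemma interpolation:
  assumes "p \<le> r"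
  shows "l1 x a w + real w ^ p * var_on p x a w
    \<le> (\<Prod>q\<in>{p..<r}. 1 + window_const q) * (l1 x a w + real w ^ r * var_on r x a w)"
  using assms
proof (induction r rule: dec_induct)
  case (step r)
  let ?P = "\<Prod>q\<in>{p..<r}. 1 + window_const q"
  have "?P \<ge> 0" using window_const_pos by (intro prod_nonneg) (simp add: less_imp_le add_nonneg_nonneg)
  note step.IH
  also have "?P * (l1 x a w + real w ^ r * var_on r x a w)
     \<le> ?P * ((1 + window_const r) * (l1 x a w + real w ^ Suc r * var_on (Suc r) x a w))"
    by (intro mult_left_mono interpolation_step \<open>?P \<ge> 0\<close>)
  finally show ?case using step.hyps by (simp add: mult_ac)
qed simp

lemma fd_funpow_le_interp:
  assumes "p < r" "p < w" "i \<in> {a<..a + w - p}"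
  shows "real w ^ Suc p * \<bar>(fd ^^ p) x i\<bar>
    \<le> interp_const r * (l1 x a w + real w ^ r * var_on r x a w)"
proof -
  define N where "N = l1 x a w + real w ^ r * var_on r x a w"
  have "N \<ge> 0" by (simp add: N_def l1_nonneg var_on_nonneg)
  have "real w ^ Suc p * \<bar>(fd ^^ p) x i\<bar>
      \<le> window_const p * l1 x a w + real w ^ Suc p * var_on (Suc p) x a w"
    by (rule pointwise_difference_bound) fact+
  also have "\<dots> \<le> (1 + window_const p) * (l1 x a w + real w ^ Suc p * var_on (Suc p) x a w)"
    using window_const_pos[of p] var_on_nonneg[of "Suc p" x a w] l1_nonneg[of x a w]
    by (simp add: algebra_simps)
  also have "\<dots> \<le> (1 + window_const p) * ((\<Prod>q\<in>{Suc p..<r}. 1 + window_const q) * N)"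
    unfolding N_def using window_const_pos[of p] assms(1)
    by (intro mult_left_mono interpolation) auto
  also have "\<dots> = (\<Prod>q\<in>{p..<r}. 1 + window_const q) * N"
    using assms(1) by (simp add: prod.atLeast_Suc_lessThan)
  also have "\<dots> \<le> interp_const r * N"
    unfolding interp_const_def using window_const_pos \<open>N \<ge> 0\<close>
    by (intro mult_right_mono prod_mono2) (auto simp: less_imp_le add_nonneg_nonneg)
  finally show ?thesis unfolding N_def .
qed

definition psum :: "(nat \<Rightarrow> real) \<Rightarrow> nat \<Rightarrow> nat \<Rightarrow> real" where
  "psum z a t = (\<Sum>u\<in>{a<..a + t}. z u)"

text \<open>
  The factor by which partial sums of the noise enter after one summation by parts on a block of
  length \<open>w\<close>, scaled so that for standard noise it has the size \<open>w\<close> to the power \<open>- 1 / 2\<close>.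
\<close>

definition roughness :: "(nat \<Rightarrow> real) \<Rightarrow> nat \<Rightarrow> nat \<Rightarrow> real" where
  "roughness z a w = \<bar>psum z a w\<bar> / w + (\<Sum>t\<in>{1..w}. \<bar>psum z a t\<bar>) / w\<^sup>2"

text \<open>
  A quadratic form in the noise that dominates \<open>w * (roughness z a w)\<^sup>2\<close>; being quadratic, its
  expectation needs only second moments.
\<close>

definition energy :: "(nat \<Rightarrow> real) \<Rightarrow> nat \<Rightarrow> nat \<Rightarrow> real" where
  "energy z a w = 2 * ((psum z a w)\<^sup>2 / w + (\<Sum>t\<in>{1..w}. (psum z a t)\<^sup>2) / w\<^sup>2)"

lemma energy_nonneg: "0 \<le> energy z a w"
  unfolding energy_def by (simp add: sum_nonneg)

lemma psum_Suc: "psum z a (Suc t) = psum z a t + z (a + Suc t)"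
proof -
  have "{a<..a + Suc t} = insert (a + Suc t) {a<..a + t}" by auto
  then show ?thesis by (simp add: psum_def)
qed

lemma abel_summation:
  assumes "1 \<le> w"
  shows "(\<Sum>t\<in>{a<..a + w}. z t * x t)
    = psum z a w * x (a + w) - (\<Sum>t\<in>{1..<w}. psum z a t * fd x (a + t))"
  using assms
proof (induction w rule: dec_induct)
  case base
  have "{a<..a + 1} = {a + 1}" by auto
  then show ?case by (simp add: psum_def)
next
  case (step w)
  have "{a<..a + Suc w} = insert (a + Suc w) {a<..a + w}" by auto
  then have "(\<Sum>t\<in>{a<..a + Suc w}. z t * x t) = z (a + Suc w) * x (a + Suc w) + (\<Sum>t\<in>{a<..a + w}. z t * x t)"
    by simp
  also have "\<dots> = z (a + Suc w) * x (a + Suc w) + (psum z a w * x (a + w) - (\<Sum>t\<in>{1..<w}. psum z a t * fd x (a + t)))"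
    using step.IH by simp
  also have "\<dots> = psum z a (Suc w) * x (a + Suc w) - (\<Sum>t\<in>{1..<Suc w}. psum z a t * fd x (a + t))"
    using step.hyps by (simp add: psum_Suc fd_def algebra_simps)
  finally show ?case .
qed

lemma roughness_nonneg: "0 \<le> roughness z a w"
  unfolding roughness_def by (simp add: sum_nonneg)

text \<open>
  One summation by parts puts the absolute values of the partial sums of \<open>z\<close> against the uniform
  bound on first differences of \<open>x\<close> that interpolation provides. Here \<open>r \<ge> 2\<close> enters: first
  differences are bounded uniformly over the block, so the partial sums enter through their mean
  absolute value and not through their maximum.
\<close>

lemma block_correlation:
  assumes "2 \<le> r" "1 \<le> w"
  shows "\<bar>\<Sum>t\<in>{a<..a + w}. z t * x t\<bar>
    \<le> interp_const r * roughness z a w * (l1 x a w + real w ^ r * var_on r x a w)"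
proof -
  define R where "R = interp_const r * (l1 x a w + real w ^ r * var_on r x a w)"
  have w: "real w > 0" using assms by simp
  have "R \<ge> 0" unfolding R_def using interp_const_ge_1[of r]
    by (intro mult_nonneg_nonneg add_nonneg_nonneg) (auto simp: l1_nonneg var_on_nonneg)
  have x0: "\<bar>x (a + w)\<bar> \<le> R / w"
    using fd_funpow_le_interp[of 0 r w "a + w" a x] assms w
    unfolding R_def by (simp add: field_simps)
  have x1: "\<bar>fd x (a + t)\<bar> \<le> R / w\<^sup>2" if "t \<in> {1..<w}" for t
  proof -
    have "real w ^ Suc 1 * \<bar>(fd ^^ 1) x (a + t)\<bar> \<le> R"
      unfolding R_def by (rule fd_funpow_le_interp) (use that assms in auto)
    then show ?thesis using w by (simp add: field_simps power2_eq_square)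
  qed
  have "\<bar>\<Sum>t\<in>{a<..a + w}. z t * x t\<bar>
      \<le> \<bar>psum z a w * x (a + w)\<bar> + (\<Sum>t\<in>{1..<w}. \<bar>psum z a t * fd x (a + t)\<bar>)"
    unfolding abel_summation[OF assms(2)]
    using sum_abs[of "\<lambda>t. psum z a t * fd x (a + t)" "{1..<w}"] by linarith
  also have "\<dots> \<le> \<bar>psum z a w\<bar> * (R / w) + (\<Sum>t\<in>{1..<w}. \<bar>psum z a t\<bar> * (R / w\<^sup>2))"
    unfolding abs_mult by (intro add_mono mult_left_mono sum_mono x0 x1) auto
  also have "(\<Sum>t\<in>{1..<w}. \<bar>psum z a t\<bar> * (R / w\<^sup>2)) \<le> (\<Sum>t\<in>{1..w}. \<bar>psum z a t\<bar> * (R / w\<^sup>2))"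
    by (rule sum_mono2) (use \<open>R \<ge> 0\<close> in auto)
  also have "\<bar>psum z a w\<bar> * (R / w) + (\<Sum>t\<in>{1..w}. \<bar>psum z a t\<bar> * (R / w\<^sup>2)) = roughness z a w * R"
    unfolding sum_distrib_right[symmetric] roughness_def by (simp add: algebra_simps)
  finally show ?thesis by (simp add: R_def mult_ac)
qed

lemma roughness_square_le_energy:
  assumes "1 \<le> w"
  shows "real w * (roughness z a w)\<^sup>2 \<le> energy z a w"
proof -
  define A where "A = \<bar>psum z a w\<bar> / w"
  define T where "T = (\<Sum>t\<in>{1..w}. \<bar>psum z a t\<bar>)"
  have w: "real w > 0" using assms by simp
  have "T\<^sup>2 \<le> (\<Sum>t\<in>{1..w}. \<bar>psum z a t\<bar>\<^sup>2) * (\<Sum>t\<in>{1..w}. 1\<^sup>2)"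
    unfolding T_def using Cauchy_Schwarz_ineq_sum[of "\<lambda>t. \<bar>psum z a t\<bar>" "\<lambda>_. 1" "{1..w}"] by simp
  then have T: "T\<^sup>2 \<le> real w * (\<Sum>t\<in>{1..w}. (psum z a t)\<^sup>2)" by (simp add: mult.commute)
  have "(A + T / w\<^sup>2)\<^sup>2 \<le> 2 * (A\<^sup>2 + (T / w\<^sup>2)\<^sup>2)"
    using sum_squares_bound[of A "T / w\<^sup>2"] by (simp add: power2_sum)
  then have "real w * (A + T / w\<^sup>2)\<^sup>2 \<le> real w * (2 * (A\<^sup>2 + (T / w\<^sup>2)\<^sup>2))"
    by (rule mult_left_mono) auto
  also have "\<dots> = 2 * ((psum z a w)\<^sup>2 / w + T\<^sup>2 / w ^ 3)"
    using w by (simp add: A_def power_divide field_simps power2_eq_square power3_eq_cube)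
  also have "T\<^sup>2 / w ^ 3 \<le> real w * (\<Sum>t\<in>{1..w}. (psum z a t)\<^sup>2) / w ^ 3"
    by (intro divide_right_mono T) auto
  also have "\<dots> = (\<Sum>t\<in>{1..w}. (psum z a t)\<^sup>2) / w\<^sup>2"
    using w by (simp add: field_simps power2_eq_square power3_eq_cube)
  finally show ?thesis by (simp add: roughness_def energy_def A_def T_def)
qed

section \<open>Dyadic blocks that shrink towards a set of separators\<close>

text \<open>
  The dyadic interval of length \<open>2 ^ m\<close> that contains the index \<open>t \<ge> 1\<close> consists of the indices
  \<open>a + 1, \<dots>, a + 2 ^ m\<close> with \<open>a = dyadic_start m t\<close>.
\<close>

definition dyadic_start :: "nat \<Rightarrow> nat \<Rightarrow> nat" where
  "dyadic_start m t = (t - 1) div 2 ^ m * 2 ^ m"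

text \<open>
  No separator lies within distance \<open>3 * w\<close> of the block \<open>a + 1, \<dots>, a + w\<close>, where a separator
  \<open>s\<close> is regarded as a cut between \<open>s\<close> and \<open>s + 1\<close>. The neighbouring blocks of the same length are
  then free of separators as well, and the surplus keeps the overlap of the enlarged blocks bounded.
\<close>

definition isolated :: "nat set \<Rightarrow> nat \<Rightarrow> nat \<Rightarrow> bool" where
  "isolated S a w \<longleftrightarrow> (\<forall>s\<in>S. s + 3 * w \<le> a \<or> a + 4 * w \<le> s)"

text \<open>
  Maximal isolated dyadic intervals form a Whitney decomposition: the size of a block is
  comparable to its distance from the separators, but at most \<open>2 ^ M\<close>. Level \<open>0\<close> is always
  admitted, so that indices next to a separator get a block of length one.
\<close>

definition whitney_level :: "nat set \<Rightarrow> nat \<Rightarrow> nat \<Rightarrow> nat" where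
  "whitney_level S M t = Max {m \<in> {..M}. m = 0 \<or> isolated S (dyadic_start m t) (2 ^ m)}"

definition whitney_block :: "nat set \<Rightarrow> nat \<Rightarrow> nat \<Rightarrow> nat \<times> nat" where
  "whitney_block S M t = (let m = whitney_level S M t in (dyadic_start m t, 2 ^ m))"

definition whitney :: "nat set \<Rightarrow> nat \<Rightarrow> nat \<Rightarrow> (nat \<times> nat) set" where
  "whitney S M n = whitney_block S M ` {1..n}"

lemma dyadic_start_bounds:
  assumes "1 \<le> t"
  shows "dyadic_start m t < t" "t \<le> dyadic_start m t + 2 ^ m"
proof -
  have "dyadic_start m t + (t - 1) mod 2 ^ m = t - 1"
    unfolding dyadic_start_def by (rule div_mult_mod_eq)
  moreover have "(t - 1) mod 2 ^ m < 2 ^ m" by simp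
  ultimately show "dyadic_start m t < t" "t \<le> dyadic_start m t + 2 ^ m" using assms by linarith+
qed

lemma dyadic_start_eq:
  assumes "dyadic_start m t < u" "u \<le> dyadic_start m t + 2 ^ m" "m \<le> m'"
  shows "dyadic_start m' u = dyadic_start m' t"
proof -
  have *: "(u - 1) div 2 ^ m = (t - 1) div 2 ^ m"
  proof (rule div_nat_eqI)
    show "2 ^ m * ((t - 1) div 2 ^ m) \<le> u - 1"
      using assms(1) by (simp add: dyadic_start_def mult.commute)
    show "u - 1 < 2 ^ m * Suc ((t - 1) div 2 ^ m)"
      using assms(1,2) by (simp add: dyadic_start_def mult.commute)
  qed
  have "(2::nat) ^ m' = 2 ^ m * 2 ^ (m' - m)" using assms(3) by (simp flip: power_add)
  then show ?thesis unfolding dyadic_start_def using * by (simp add: div_mult2_eq)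
qed

lemma whitney_level_props:
  fixes S :: "nat set" and M t :: nat
  defines "m \<equiv> whitney_level S M t"
  shows "m \<le> M" "m = 0 \<or> isolated S (dyadic_start m t) (2 ^ m)"
    "m < M \<Longrightarrow> \<not> isolated S (dyadic_start (Suc m) t) (2 ^ Suc m)"
proof -
  let ?A = "{m \<in> {..M}. m = 0 \<or> isolated S (dyadic_start m t) (2 ^ m)}"
  have fin: "finite ?A" and ne: "?A \<noteq> {}" by auto
  have "m \<in> ?A" unfolding m_def whitney_level_def by (rule Max_in[OF fin ne])
  then show "m \<le> M" "m = 0 \<or> isolated S (dyadic_start m t) (2 ^ m)" by auto
  show "\<not> isolated S (dyadic_start (Suc m) t) (2 ^ Suc m)" if "m < M"
  proof
    assume "isolated S (dyadic_start (Suc m) t) (2 ^ Suc m)"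
    with that have "Suc m \<in> ?A" by auto
    then have "Suc m \<le> m" unfolding m_def whitney_level_def by (rule Max_ge[OF fin])
    then show False by simp
  qed
qed

text \<open>
  Dyadic intervals of level at least \<open>m\<close> that meet are nested, so a whole block sees the same
  isolated intervals above it.
\<close>

lemma whitney_level_eq:
  fixes S :: "nat set" and M t :: nat
  defines "m \<equiv> whitney_level S M t"
  assumes "dyadic_start m t < u" "u \<le> dyadic_start m t + 2 ^ m"
  shows "whitney_level S M u = m"
  unfolding whitney_level_def
proof (rule Max_eqI)
  note eq = dyadic_start_eq[OF assms(2,3)]
  show "m \<in> {m \<in> {..M}. m = 0 \<or> isolated S (dyadic_start m u) (2 ^ m)}"
    using whitney_level_props(1,2)[of S M t] eq[of m] by (simp add: m_def)
  fix m' assume m': "m' \<in> {m \<in> {..M}. m = 0 \<or> isolated S (dyadic_start m u) (2 ^ m)}"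
  show "m' \<le> m"
  proof (rule ccontr)
    assume "\<not> m' \<le> m"
    with m' eq[of m'] have "m' \<in> {m \<in> {..M}. m = 0 \<or> isolated S (dyadic_start m t) (2 ^ m)}" by auto
    then have "m' \<le> m" unfolding m_def whitney_level_def by (intro Max_ge) auto
    with \<open>\<not> m' \<le> m\<close> show False by simp
  qed
qed simp

lemma whitney_cases:
  assumes "(a, w) \<in> whitney S M n"
  obtains t m where "t \<in> {1..n}" "m = whitney_level S M t" "a = dyadic_start m t" "w = 2 ^ m"
    "whitney_block S M t = (a, w)" "m \<le> M" "m = 0 \<or> isolated S a w"
    "m < M \<Longrightarrow> \<not> isolated S (dyadic_start (Suc m) t) (2 ^ Suc m)"
proof -
  from assms obtain t where t: "t \<in> {1..n}" "whitney_block S M t = (a, w)"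
    unfolding whitney_def by auto
  show ?thesis
    by (rule that[of t "whitney_level S M t"])
      (use t whitney_level_props[where S = S and M = M and t = t] in \<open>auto simp: whitney_block_def Let_def\<close>)
qed

lemma finite_whitney: "finite (whitney S M n)"
  by (simp add: whitney_def)

lemma whitney_size: "(a, w) \<in> whitney S M n \<Longrightarrow> 1 \<le> w \<and> w \<le> 2 ^ M"
  by (elim whitney_cases) (simp add: power_increasing)

lemma whitney_isolated: "(a, w) \<in> whitney S M n \<Longrightarrow> w = 1 \<or> isolated S a w"
  by (elim whitney_cases) auto

lemma whitney_fibre:
  assumes "(a, w) \<in> whitney S M n" "0 \<in> S" "n \<in> S"
  shows "{t \<in> {1..n}. whitney_block S M t = (a, w)} = {a<..a + w}"
proof -
  obtain t m where t: "t \<in> {1..n}" "m = whitney_level S M t" "a = dyadic_start m t" "w = 2 ^ m"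
    "whitney_block S M t = (a, w)" "m = 0 \<or> isolated S a w"
    using assms(1) by (elim whitney_cases) blast
  have at: "a < t" "t \<le> a + w" using dyadic_start_bounds[of t m] t by auto
  show ?thesis
  proof (intro set_eqI iffI)
    fix u assume "u \<in> {t \<in> {1..n}. whitney_block S M t = (a, w)}"
    then have "1 \<le> u" "dyadic_start (whitney_level S M u) u = a" "2 ^ whitney_level S M u = w"
      by (auto simp: whitney_block_def Let_def)
    then show "u \<in> {a<..a + w}" using dyadic_start_bounds[of u "whitney_level S M u"] by auto
  next
    fix u assume u: "u \<in> {a<..a + w}"
    have lev: "whitney_level S M u = m"
      using whitney_level_eq[of S M t u] u t by auto
    have "dyadic_start m u = a" using dyadic_start_eq[of m t u m] u t by auto
    with lev have "whitney_block S M u = (a, w)" using t by (simp add: whitney_block_def Let_def)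
    moreover have "u \<le> n"
    proof (cases "m = 0")
      case True
      then show ?thesis using u at t by auto
    next
      case False
      then have "n + 3 * w \<le> a \<or> a + 4 * w \<le> n" using t assms(3) by (auto simp: isolated_def)
      then show ?thesis using at t(1) u by auto
    qed
    ultimately show "u \<in> {t \<in> {1..n}. whitney_block S M t = (a, w)}" using u by auto
  qed
qed

lemma sum_whitney:
  fixes f :: "nat \<Rightarrow> real"
  assumes "0 \<in> S" "n \<in> S"
  shows "(\<Sum>t\<in>{1..n}. f t) = (\<Sum>(a, w)\<in>whitney S M n. \<Sum>t\<in>{a<..a + w}. f t)"
proof -
  have "(\<Sum>t\<in>{1..n}. f t)
      = (\<Sum>B\<in>whitney S M n. \<Sum>t\<in>{t \<in> {1..n}. whitney_block S M t = B}. f t)"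
    unfolding whitney_def by (rule sum.image_gen) simp
  also have "\<dots> = (\<Sum>(a, w)\<in>whitney S M n. \<Sum>t\<in>{a<..a + w}. f t)"
  proof (rule sum.cong[OF refl])
    fix B assume B: "B \<in> whitney S M n"
    obtain a w where [simp]: "B = (a, w)" by (cases B)
    show "sum f {t \<in> {1..n}. whitney_block S M t = B} = (case B of (a, w) \<Rightarrow> sum f {a<..a + w})"
      using whitney_fibre[OF _ assms, of a w M] B by simp
  qed
  finally show ?thesis .
qed

lemma dyadic_start_Suc:
  "dyadic_start (Suc m) t \<le> dyadic_start m t"
  "dyadic_start m t \<le> dyadic_start (Suc m) t + 2 ^ m"
proof -
  define j where "j = (t - 1) div 2 ^ m"
  have *: "dyadic_start (Suc m) t = (j div 2) * 2 * 2 ^ m" "dyadic_start m t = j * 2 ^ m"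
    unfolding dyadic_start_def j_def by (auto simp: div_mult2_eq mult.commute[of 2])
  have "j div 2 * 2 \<le> j" "j \<le> j div 2 * 2 + 1" by auto
  then have "j div 2 * 2 * 2 ^ m \<le> j * 2 ^ m" "j * 2 ^ m \<le> (j div 2 * 2 + 1) * 2 ^ m"
    by (intro mult_right_mono; simp)+
  then show "dyadic_start (Suc m) t \<le> dyadic_start m t"
    "dyadic_start m t \<le> dyadic_start (Suc m) t + 2 ^ m"
    using * by (auto simp: algebra_simps)
qed

text \<open>
  A block below the top level is not larger because its dyadic parent is not isolated.
\<close>

lemma whitney_near_separator:
  assumes "m < M" "\<not> isolated S (dyadic_start (Suc m) t) (2 ^ Suc m)"
  obtains s where "s \<in> S" "dyadic_start m t < s + 7 * 2 ^ m" "s < dyadic_start m t + 8 * 2 ^ m"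
proof -
  from assms obtain s where s: "s \<in> S" "dyadic_start (Suc m) t < s + 3 * 2 ^ Suc m"
    "s < dyadic_start (Suc m) t + 4 * 2 ^ Suc m" unfolding isolated_def by (auto simp: not_le)
  show ?thesis by (rule that[of s]) (use s dyadic_start_Suc[of m t] in auto)
qed

text \<open>
  Below the top level every block is within a bounded number of its own lengths from some
  separator, which leaves at most 15 positions for each separator and each level.
\<close>

lemma card_whitney_le:
  assumes "finite S"
  shows "card (whitney S M n) \<le> 15 * card S * M + n div 2 ^ M + 1"
proof -
  let ?B = "\<lambda>m j. (j * 2 ^ m :: nat, 2 ^ m :: nat)"
  define U where "U = (\<Union>m\<in>{..<M}. \<Union>s\<in>S. ?B m ` {s div 2 ^ m - 7..s div 2 ^ m + 7})"
  define T where "T = ?B M ` {0..n div 2 ^ M}"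
  have "whitney S M n \<subseteq> U \<union> T"
  proof
    fix B assume "B \<in> whitney S M n"
    moreover obtain a w where B: "B = (a, w)" by (cases B)
    ultimately have "(a, w) \<in> whitney S M n" by simp
    then obtain t m where t: "t \<in> {1..n}" "a = dyadic_start m t" "w = 2 ^ m" "m \<le> M"
      "m < M \<Longrightarrow> \<not> isolated S (dyadic_start (Suc m) t) (2 ^ Suc m)"
      by (elim whitney_cases) auto
    define j where "j = (t - 1) div 2 ^ m"
    have Bj: "B = ?B m j" unfolding B t j_def dyadic_start_def ..
    show "B \<in> U \<union> T"
    proof (cases "m < M")
      case True
      obtain s where s: "s \<in> S" "j * 2 ^ m < s + 7 * 2 ^ m" "s < j * 2 ^ m + 8 * 2 ^ m"
        using whitney_near_separator[OF True t(5)[OF True]] unfolding j_def dyadic_start_def by auto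
      have "j \<le> (s + 7 * 2 ^ m) div 2 ^ m"
        using s(2) by (simp add: less_eq_div_iff_mult_less_eq del: div_mult_self1 div_mult_self2 div_mult_self3 div_mult_self4)
      then have "j \<le> s div 2 ^ m + 7" by simp
      moreover have "s div 2 ^ m < j + 8"
        by (rule less_mult_imp_div_less) (use s(3) in \<open>simp add: algebra_simps\<close>)
      ultimately have "j \<in> {s div 2 ^ m - 7..s div 2 ^ m + 7}" by auto
      then have "B \<in> U" unfolding U_def Bj using True s(1) by blast
      then show ?thesis ..
    next
      case False
      then have "m = M" using t(4) by simp
      moreover have "j \<le> n div 2 ^ m" unfolding j_def using t(1) by (intro div_le_mono) auto
      ultimately have "B \<in> T" unfolding T_def Bj by auto
      then show ?thesis ..
    qed
  qed
  moreover have "finite U" "finite T" unfolding U_def T_def using assms by auto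
  ultimately have "card (whitney S M n) \<le> card U + card T"
    by (meson card_Un_le card_mono finite_UnI order_trans)
  moreover have "card T \<le> n div 2 ^ M + 1"
    unfolding T_def using card_image_le[of "{0..n div 2 ^ M}" "?B M"] by simp
  moreover have "card U \<le> (\<Sum>m\<in>{..<M}. \<Sum>s\<in>S. 15)"
    unfolding U_def
  proof (rule order_trans[OF card_UN_le sum_mono], simp)
    fix m assume "m \<in> {..<M}"
    show "card (\<Union>s\<in>S. ?B m ` {s div 2 ^ m - 7..s div 2 ^ m + 7}) \<le> (\<Sum>s\<in>S. 15)"
    proof (rule order_trans[OF card_UN_le[OF assms] sum_mono])
      fix s show "card (?B m ` {s div 2 ^ m - 7..s div 2 ^ m + 7}) \<le> 15"
        by (rule order_trans[OF card_image_le]) auto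
    qed
  qed
  ultimately show ?thesis by (simp add: mult_ac)
qed

text \<open>
  A block between the extreme levels whose enlargement contains \<open>t\<close> has length comparable to the
  distance of \<open>t\<close> from the separators. This leaves three levels, to which levels \<open>0\<close> and \<open>M\<close> are
  added, and three neighbouring positions on each level.
\<close>

lemma whitney_overlap:
  assumes "1 \<le> t"
  shows "card {(a, w) \<in> whitney S M n. a < t + w \<and> t \<le> a + 2 * w} \<le> 15"
proof -
  let ?B = "\<lambda>m j. (j * 2 ^ m :: nat, 2 ^ m :: nat)"
  define A where "A = {m. 0 < m \<and> m < M \<and>
     (\<exists>a. isolated S a (2 ^ m) \<and> a < t + 2 ^ m \<and> t \<le> a + 2 * 2 ^ m \<and>
       (\<exists>s\<in>S. a < s + 7 * 2 ^ m \<and> s < a + 8 * 2 ^ m))}"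
  have close: "m' \<le> m + 2" if m: "m \<in> A" "m' \<in> A" for m m'
  proof -
    from m(1) obtain a s where a: "a < t + 2 ^ m" "t \<le> a + 2 * 2 ^ m" "s \<in> S"
      "a < s + 7 * 2 ^ m" "s < a + 8 * 2 ^ m" unfolding A_def by blast
    from m(2) obtain a' where a': "isolated S a' (2 ^ m')" "a' < t + 2 ^ m'" "t \<le> a' + 2 * 2 ^ m'"
      unfolding A_def by blast
    from a'(1) a(3) have "s + 3 * 2 ^ m' \<le> a' \<or> a' + 4 * 2 ^ m' \<le> s" unfolding isolated_def by blast
    then have "2 * 2 ^ m' < (9 * 2 ^ m :: nat)" using a a' by linarith
    also have "\<dots> < 2 * 2 ^ (m + 3)" by (simp add: power_add)
    finally have "(2::nat) ^ m' < 2 ^ (m + 3)" by simp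
    then have "m' < m + 3" by (simp add: power_less_imp_less_exp)
    then show ?thesis by simp
  qed
  obtain m0 where m0: "A \<subseteq> {m0..m0 + 2}"
  proof (cases "A = {}")
    case False
    then have "(LEAST m. m \<in> A) \<in> A" by (meson LeastI_ex all_not_in_conv)
    then have "A \<subseteq> {(LEAST m. m \<in> A)..(LEAST m. m \<in> A) + 2}"
      using close by (auto intro: Least_le)
    then show ?thesis by (rule that)
  qed (use that in auto)
  define L where "L = {0, M} \<union> {m0..m0 + 2}"
  have "card L \<le> card {0, M} + card {m0..m0 + 2}" unfolding L_def by (rule card_Un_le)
  also have "\<dots> \<le> 5" using card_insert_le_m1[of 2 "{M}" 0] by simp
  finally have cL: "card L \<le> 5" .
  have "{(a, w) \<in> whitney S M n. a < t + w \<and> t \<le> a + 2 * w}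
     \<subseteq> (\<Union>m\<in>L. ?B m ` {(t - 1) div 2 ^ m - 1..(t - 1) div 2 ^ m + 1})"
  proof safe
    fix a w assume aw: "(a, w) \<in> whitney S M n" "a < t + w" "t \<le> a + 2 * w"
    obtain u m where u: "u \<in> {1..n}" "a = dyadic_start m u" "w = 2 ^ m" "m \<le> M" "m = 0 \<or> isolated S a w"
      "m < M \<Longrightarrow> \<not> isolated S (dyadic_start (Suc m) u) (2 ^ Suc m)"
      using aw(1) by (elim whitney_cases) auto
    define j where "j = (u - 1) div 2 ^ m"
    have aj: "a = j * 2 ^ m" unfolding u j_def dyadic_start_def ..
    have "m \<in> L"
    proof (cases "m = 0 \<or> m = M")
      case False
      then have "m < M" using u(4) by simp
      obtain s where "s \<in> S" "a < s + 7 * 2 ^ m" "s < a + 8 * 2 ^ m"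
        using whitney_near_separator[OF \<open>m < M\<close> u(6)[OF \<open>m < M\<close>]] u(2) by auto
      moreover have "isolated S a (2 ^ m)" "a < t + 2 ^ m" "t \<le> a + 2 * 2 ^ m" "0 < m"
        using False u(3,5) aw(2,3) by auto
      ultimately have "m \<in> A" unfolding A_def using \<open>m < M\<close> by blast
      then show ?thesis unfolding L_def using m0 by auto
    qed (auto simp: L_def)
    moreover have "(t - 1) div 2 ^ m < j + 2"
      by (rule less_mult_imp_div_less) (use aw(3) assms aj u(3) in \<open>simp add: algebra_simps\<close>)
    moreover have "j \<le> (t - 1 + 2 ^ m) div 2 ^ m"
      using aw(2) assms aj u(3)
      by (simp add: less_eq_div_iff_mult_less_eq del: div_mult_self1 div_mult_self2 div_mult_self3 div_mult_self4)
    then have "j \<le> (t - 1) div 2 ^ m + 1" by simp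
    ultimately have "m \<in> L" "j \<in> {(t - 1) div 2 ^ m - 1..(t - 1) div 2 ^ m + 1}" by auto
    then show "(a, w) \<in> (\<Union>m\<in>L. ?B m ` {(t - 1) div 2 ^ m - 1..(t - 1) div 2 ^ m + 1})"
      unfolding aj u(3) by blast
  qed
  then have "card {(a, w) \<in> whitney S M n. a < t + w \<and> t \<le> a + 2 * w}
     \<le> card (\<Union>m\<in>L. ?B m ` {(t - 1) div 2 ^ m - 1..(t - 1) div 2 ^ m + 1})"
    by (rule card_mono[rotated]) (auto simp: L_def)
  also have "\<dots> \<le> (\<Sum>m\<in>L. card (?B m ` {(t - 1) div 2 ^ m - 1..(t - 1) div 2 ^ m + 1}))"
    by (rule card_UN_le) (simp add: L_def)
  also have "\<dots> \<le> (\<Sum>m\<in>L. 3)"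
    by (rule sum_mono, rule order_trans[OF card_image_le]) auto
  also have "\<dots> \<le> 15" using cL by simp
  finally show ?thesis .
qed

section \<open>Directional derivative of the total variation, segment by segment\<close>

lemma fd_funpow_cmult: "(fd ^^ q) (\<lambda>i. c * x i) i = c * (fd ^^ q) x i"
  by (induction q arbitrary: i) (auto simp: fd_def algebra_simps)

lemma exists_small_signed_difference:
  assumes "q < l" "\<bar>c\<bar> \<le> 1"
  shows "\<exists>i\<in>{a<..a + l - q}. real l ^ (q + 1) * (c * (fd ^^ q) x i) \<le> window_const q * l1 x a l"
proof -
  obtain i where "i \<in> {a<..a + l - q}"
    and "real l ^ (q + 1) * (c * (fd ^^ q) x i) \<le> window_const q * (\<Sum>t\<in>{a<..a + l}. \<bar>c * x t\<bar>)"
    using exists_small_difference[OF assms(1), of a "\<lambda>i. c * x i"] unfolding fd_funpow_cmult by blast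
  moreover have "(\<Sum>t\<in>{a<..a + l}. \<bar>c * x t\<bar>) \<le> l1 x a l"
    unfolding l1_def abs_mult by (intro sum_mono mult_left_le_one_le) (use assms in auto)
  then have "window_const q * (\<Sum>t\<in>{a<..a + l}. \<bar>c * x t\<bar>) \<le> window_const q * l1 x a l"
    using window_const_pos[of q] by (intro mult_left_mono) auto
  ultimately show ?thesis by force
qed

definition l2 :: "(nat \<Rightarrow> real) \<Rightarrow> nat set \<Rightarrow> real" where
  "l2 x A = sqrt (\<Sum>t\<in>A. (x t)\<^sup>2)"

lemma l2_nonneg: "0 \<le> l2 x A" by (simp add: l2_def sum_nonneg)
lemma l2_square: "(l2 x A)\<^sup>2 = (\<Sum>t\<in>A. (x t)\<^sup>2)" by (simp add: l2_def sum_nonneg)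

lemma l1_le_l2:
  assumes "finite A" "{a<..a + w} \<subseteq> A"
  shows "l1 x a w \<le> sqrt w * l2 x A"
proof -
  have "(l1 x a w)\<^sup>2 \<le> (\<Sum>t\<in>{a<..a + w}. \<bar>x t\<bar>\<^sup>2) * (\<Sum>t\<in>{a<..a + w}. 1\<^sup>2)"
    unfolding l1_def using Cauchy_Schwarz_ineq_sum[of "\<lambda>t. \<bar>x t\<bar>" "\<lambda>_. 1" "{a<..a + w}"] by simp
  also have "\<dots> \<le> (\<Sum>t\<in>A. (x t)\<^sup>2) * w"
    by (intro mult_mono) (use sum_mono2[OF assms, of "\<lambda>t. (x t)\<^sup>2"] in \<open>auto simp: sum_nonneg\<close>)
  finally show ?thesis unfolding l2_def real_sqrt_mult[symmetric]
    by (intro real_le_rsqrt) (simp add: mult.commute)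
qed

text \<open>
  The power of \<open>y\<close> with exponent \<open>r - 1 / 2\<close>.
\<close>

definition half_pow :: "nat \<Rightarrow> real \<Rightarrow> real" where
  "half_pow r y = sqrt y * y ^ (r - 1)"

lemma half_pow_mono: "0 \<le> y \<Longrightarrow> y \<le> y' \<Longrightarrow> half_pow r y \<le> half_pow r y'"
  unfolding half_pow_def by (intro mult_mono power_mono) auto

lemma half_pow_pos: "0 < y \<Longrightarrow> 0 < half_pow r y"
  unfolding half_pow_def by simp

lemma sqrt_mult_half_pow: "1 \<le> r \<Longrightarrow> 0 \<le> y \<Longrightarrow> sqrt y * half_pow r y = y ^ r"
  unfolding half_pow_def by (cases r) (auto simp: mult.assoc[symmetric])

lemma half_pow_mult_ge:
  assumes "1 \<le> r" "0 < c" "c \<le> 1" "0 \<le> y"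
  shows "c ^ r * half_pow r y \<le> half_pow r (c * y)"
proof -
  have "c \<le> sqrt c" using assms by (intro real_le_rsqrt) (simp add: power2_eq_square mult_left_le)
  have "c ^ r * half_pow r y = (c * c ^ (r - 1)) * half_pow r y"
    using assms(1) by (simp flip: power_Suc)
  also have "\<dots> \<le> (sqrt c * c ^ (r - 1)) * half_pow r y"
    by (intro mult_right_mono \<open>c \<le> sqrt c\<close>) (use assms in \<open>auto simp: half_pow_def\<close>)
  also have "\<dots> = half_pow r (c * y)"
    by (simp add: half_pow_def real_sqrt_mult power_mult_distrib)
  finally show ?thesis .
qed

text \<open>
  The knots of a signal, reduced to their positions and signs. With \<open>g\<close> the difference of order
  \<open>r - 1\<close> of a vector, the jump of \<open>g\<close> at the knot \<open>i\<close> is \<open>g (e i + 1) - g (e i)\<close>, and \<open>g\<close> lives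
  on the segments \<open>e i + 1, \<dots>, e (i + 1)\<close> for \<open>0 \<le> i \<le> k\<close>. The ends \<open>0\<close> and \<open>k + 1\<close> have sign
  \<open>0\<close>.
\<close>

locale knot_structure =
  fixes n r k :: nat and e :: "nat \<Rightarrow> nat" and s :: "nat \<Rightarrow> real"
  assumes r_ge_2: "2 \<le> r" and r_le_n: "r \<le> n"
    and e_0: "e 0 = 0" and e_last: "e (Suc k) = n - r + 1"
    and e_less: "i \<le> k \<Longrightarrow> e i < e (Suc i)"
    and s_0: "s 0 = 0" and s_last: "s (Suc k) = 0" and s_le_1: "\<bar>s i\<bar> \<le> 1"
begin

text \<open>
  Write the directional derivative of the total variation in direction \<open>x\<close> as the variation of
  \<open>g\<close> off the knots plus the signed jumps at the knots. Each jump joins the values of \<open>g\<close> at the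
  ends of two segments; distributing them over these segments gives one term for each segment.
\<close>

definition seg_term :: "(nat \<Rightarrow> real) \<Rightarrow> nat \<Rightarrow> real" where
  "seg_term x i = (\<Sum>t\<in>{e i<..<e (Suc i)}. \<bar>(fd ^^ r) x t\<bar>)
     + s i * (fd ^^ (r - 1)) x (Suc (e i)) - s (Suc i) * (fd ^^ (r - 1)) x (e (Suc i))"

text \<open>
  The number of coordinates of \<open>x\<close> on which the values of \<open>g\<close> on the segment depend.
\<close>

definition seg_len :: "nat \<Rightarrow> nat" where
  "seg_len i = e (Suc i) + (r - 1) - e i"

definition separators :: "nat set" where
  "separators = e ` {0..k} \<union> {n}"

lemma fd_funpow_pred: "fd ((fd ^^ (r - 1)) x) t = (fd ^^ r) x t"
  using r_ge_2 by (cases r) auto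

text \<open>
  The variation outside \<open>\<alpha>, \<dots>, \<gamma>\<close> pays at least for the change of \<open>s i * g\<close> from the left end to
  \<open>\<alpha>\<close> and of \<open>s (Suc i) * g\<close> from \<open>\<gamma>\<close> to the right end. So the segment term, together with bounds
  on \<open>g\<close> at two points, controls the variation of \<open>g\<close> between them: between two knots \<open>g\<close> is
  nearly monotone when their signs agree and nearly unimodal when they are opposite.
\<close>

lemma seg_variation:
  assumes "e i < \<alpha>" "\<alpha> \<le> \<gamma>" "\<gamma> \<le> e (Suc i)"
  shows "(\<Sum>t\<in>{\<alpha>..<\<gamma>}. \<bar>(fd ^^ r) x t\<bar>)
    \<le> seg_term x i - s i * (fd ^^ (r - 1)) x \<alpha> + s (Suc i) * (fd ^^ (r - 1)) x \<gamma>"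
proof -
  let ?g = "(fd ^^ (r - 1)) x"
  let ?v = "\<lambda>A. \<Sum>t\<in>A. \<bar>(fd ^^ r) x t\<bar>"
  have "{e i<..<e (Suc i)} = {Suc (e i)..<e (Suc i)}" by auto
  then have "?v {e i<..<e (Suc i)} = ?v {Suc (e i)..<\<alpha>} + (?v {\<alpha>..<\<gamma>} + ?v {\<gamma>..<e (Suc i)})"
    using assms by (simp add: sum.atLeastLessThan_concat)
  moreover have "\<bar>?g \<alpha> - ?g (Suc (e i))\<bar> \<le> ?v {Suc (e i)..<\<alpha>}"
    "\<bar>?g (e (Suc i)) - ?g \<gamma>\<bar> \<le> ?v {\<gamma>..<e (Suc i)}"
    using abs_diff_le_sum_fd[of "Suc (e i)" \<alpha> ?g, unfolded fd_funpow_pred]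
      abs_diff_le_sum_fd[of \<gamma> "e (Suc i)" ?g, unfolded fd_funpow_pred] assms by auto
  moreover have "s j * d \<le> \<bar>d\<bar>" for j d
    using mult_left_le_one_le[of "\<bar>d\<bar>" "\<bar>s j\<bar>"] s_le_1[of j] abs_ge_self[of "s j * d"] by (simp add: abs_mult)
  from this[of i "?g \<alpha> - ?g (Suc (e i))"] this[of "Suc i" "?g (e (Suc i)) - ?g \<gamma>"]
  have "s i * ?g \<alpha> - s i * ?g (Suc (e i)) \<le> \<bar>?g \<alpha> - ?g (Suc (e i))\<bar>"
    "s (Suc i) * ?g (e (Suc i)) - s (Suc i) * ?g \<gamma> \<le> \<bar>?g (e (Suc i)) - ?g \<gamma>\<bar>"
    by (auto simp: algebra_simps)
  ultimately show ?thesis unfolding seg_term_def by linarith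
qed

lemma seg_term_ge:
  assumes "e i < p" "p \<le> e (Suc i)"
  shows "(s i - s (Suc i)) * (fd ^^ (r - 1)) x p \<le> seg_term x i"
  using seg_variation[OF assms(1) order_refl assms(2), of x] by (simp add: algebra_simps)

lemma e_mono: "i \<le> j \<Longrightarrow> j \<le> Suc k \<Longrightarrow> e i \<le> e j"
proof (induction j rule: dec_induct)
  case (step m)
  then show ?case using e_less[of m] by simp
qed simp

text \<open>
  Where the sign does not change the term is nonnegative. Where it changes, the window inequality
  provides a point at which \<open>(s i - s (Suc i)) * g\<close> is not too negative.
\<close>

lemma seg_term_lower:
  fixes y :: real
  assumes "i \<le> k" "0 < y" "s i \<noteq> s (Suc i) \<Longrightarrow> y \<le> seg_len i"
  shows "- (2 * window_const (r - 1) / half_pow r y * l2 x {e i<..e (Suc i) + (r - 1)}) \<le> seg_term x i"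
proof (cases "s i = s (Suc i)")
  case True
  have "0 \<le> 2 * window_const (r - 1) / half_pow r y * l2 x {e i<..e (Suc i) + (r - 1)}"
    using window_const_pos[of "r - 1"] half_pow_pos[OF assms(2), of r] l2_nonneg by simp
  moreover have "0 \<le> seg_term x i"
    using seg_term_ge[of i "e (Suc i)" x] e_less[OF assms(1)] True by simp
  ultimately show ?thesis by linarith
next
  case False
  let ?l = "seg_len i" and ?K = "window_const (r - 1)"
  let ?W = "{e i<..e (Suc i) + (r - 1)}"
  have W: "?W = {e i<..e i + ?l}" unfolding seg_len_def using e_less[OF assms(1)] by auto
  \<comment> \<open>The factor \<open>1 / 2\<close> brings a difference of two signs back into \<open>[- 1, 1]\<close>.\<close>
  define c where "c = - (s i - s (Suc i)) / 2"
  have "\<bar>c\<bar> \<le> 1" unfolding c_def using s_le_1[of i] s_le_1[of "Suc i"] by auto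
  have rl: "r - 1 < ?l" unfolding seg_len_def using e_less[OF assms(1)] by auto
  obtain p where p: "p \<in> {e i<..e i + ?l - (r - 1)}"
    and le: "real ?l ^ (r - 1 + 1) * (c * (fd ^^ (r - 1)) x p) \<le> ?K * l1 x (e i) ?l"
    using exists_small_signed_difference[OF rl \<open>\<bar>c\<bar> \<le> 1\<close>] by blast
  have l0: "0 < real ?l" using rl by simp
  have "real ?l ^ r * (c * (fd ^^ (r - 1)) x p) \<le> ?K * l1 x (e i) ?l" using le r_ge_2 by simp
  also have "\<dots> \<le> ?K * (sqrt ?l * l2 x ?W)"
    using window_const_pos[of "r - 1"] l1_le_l2[of ?W "e i" ?l x] W by (intro mult_left_mono) auto
  finally have "sqrt ?l * (half_pow r ?l * (c * (fd ^^ (r - 1)) x p)) \<le> sqrt ?l * (?K * l2 x ?W)"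
    using r_ge_2 sqrt_mult_half_pow[of r "real ?l", symmetric] by (simp add: mult_ac)
  then have "half_pow r ?l * (c * (fd ^^ (r - 1)) x p) \<le> ?K * l2 x ?W"
    using l0 by (simp del: of_nat_mult)
  then have "c * (fd ^^ (r - 1)) x p \<le> ?K * l2 x ?W / half_pow r ?l"
    using half_pow_pos[OF l0, of r] by (simp add: field_simps)
  also have "\<dots> \<le> ?K * l2 x ?W / half_pow r y"
    using window_const_pos[of "r - 1"] half_pow_pos[OF assms(2), of r] l2_nonneg[of x ?W]
      half_pow_mono[of y ?l r] assms(2,3) False
    by (intro divide_left_mono) auto
  finally have "- (2 * ?K / half_pow r y * l2 x ?W) \<le> (s i - s (Suc i)) * (fd ^^ (r - 1)) x p"
    unfolding c_def by (simp add: field_simps)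
  also have "\<dots> \<le> seg_term x i"
    using p e_less[OF assms(1)] unfolding seg_len_def by (intro seg_term_ge) auto
  finally show ?thesis .
qed

lemma sum_segments_aux:
  fixes \<phi> :: "nat \<Rightarrow> real"
  assumes "m \<le> k"
  shows "(\<Sum>t\<in>{0<..<e (Suc m)}. \<phi> t)
    = (\<Sum>i\<le>m. \<Sum>t\<in>{e i<..<e (Suc i)}. \<phi> t) + (\<Sum>i\<in>{1..m}. \<phi> (e i))"
  using assms
proof (induction m)
  case 0
  then show ?case using e_0 by simp
next
  case (Suc m)
  have "0 < e (Suc m)" using e_less[of m] Suc.prems by simp
  then have "{0<..<e (Suc (Suc m))} = {0<..<e (Suc m)} \<union> insert (e (Suc m)) {e (Suc m)<..<e (Suc (Suc m))}"
    using e_less[of "Suc m"] Suc.prems by auto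
  then have "(\<Sum>t\<in>{0<..<e (Suc (Suc m))}. \<phi> t)
      = (\<Sum>t\<in>{0<..<e (Suc m)}. \<phi> t) + (\<phi> (e (Suc m)) + (\<Sum>t\<in>{e (Suc m)<..<e (Suc (Suc m))}. \<phi> t))"
    by (simp only:) (subst sum.union_disjoint, auto)
  then show ?case using Suc by simp
qed

lemma sum_segments:
  fixes \<phi> :: "nat \<Rightarrow> real"
  shows "(\<Sum>t\<in>{1..n - r}. \<phi> t)
    = (\<Sum>i\<le>k. \<Sum>t\<in>{e i<..<e (Suc i)}. \<phi> t) + (\<Sum>i\<in>{1..k}. \<phi> (e i))"
proof -
  have "{1..n - r} = {0<..<e (Suc k)}" using e_last by auto
  then show ?thesis using sum_segments_aux[OF order_refl, of \<phi>] by simp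
qed

lemma sum_seg_term:
  "(\<Sum>i\<le>k. seg_term x i)
    = (\<Sum>i\<le>k. \<Sum>t\<in>{e i<..<e (Suc i)}. \<bar>(fd ^^ r) x t\<bar>) + (\<Sum>i\<in>{1..k}. s i * (fd ^^ r) x (e i))"
proof -
  let ?g = "(fd ^^ (r - 1)) x"
  have "(\<Sum>i\<le>k. s i * ?g (Suc (e i))) = (\<Sum>i\<in>{1..k}. s i * ?g (Suc (e i)))"
    by (rule sum.mono_neutral_right) (auto simp: s_0 not_less_eq_eq Suc_le_eq)
  moreover have "(\<Sum>i\<le>k. s (Suc i) * ?g (e (Suc i))) = (\<Sum>i\<in>{1..Suc k}. s i * ?g (e i))"
    by (rule sum.reindex_bij_witness[where i = "\<lambda>i. i - 1" and j = Suc]) auto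
  moreover have "\<dots> = (\<Sum>i\<in>{1..k}. s i * ?g (e i))" by (simp add: s_last)
  moreover have "(\<Sum>i\<in>{1..k}. s i * (fd ^^ r) x (e i))
      = (\<Sum>i\<in>{1..k}. s i * ?g (Suc (e i))) - (\<Sum>i\<in>{1..k}. s i * ?g (e i))"
    unfolding fd_funpow_pred[symmetric] fd_def by (simp add: right_diff_distrib sum_subtractf)
  ultimately show ?thesis unfolding seg_term_def sum.distrib sum_subtractf by linarith
qed

text \<open>
  Consecutive windows overlap in \<open>r - 1\<close> coordinates, so \<open>r\<close> shifts of the disjoint segments
  cover them.
\<close>

lemma sum_l2_windows:
  "(\<Sum>i\<le>k. (l2 x {e i<..e (Suc i) + (r - 1)})\<^sup>2) \<le> r * (l2 x {1..n})\<^sup>2"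
proof -
  have union: "(\<Sum>i\<le>m. \<Sum>t\<in>{e i<..e (Suc i)}. f t) = (\<Sum>t\<in>{0<..e (Suc m)}. f t)"
    if "m \<le> k" for f :: "nat \<Rightarrow> real" and m
    using that
  proof (induction m)
    case (Suc m)
    have "{0<..e (Suc (Suc m))} = {0<..e (Suc m)} \<union> {e (Suc m)<..e (Suc (Suc m))}"
      using e_less[of "Suc m"] Suc.prems by auto
    then show ?case using Suc by (simp only:) (subst sum.union_disjoint, auto)
  qed (simp add: e_0)
  have "(l2 x {e i<..e (Suc i) + (r - 1)})\<^sup>2 \<le> (\<Sum>d<r. \<Sum>t\<in>{e i<..e (Suc i)}. (x (t + d))\<^sup>2)"
    if "i \<le> k" for i
  proof -
    have "(l2 x {e i<..e (Suc i) + (r - 1)})\<^sup>2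
        \<le> (\<Sum>t\<in>(\<lambda>(d, t). t + d) ` ({..<r} \<times> {e i<..e (Suc i)}). (x t)\<^sup>2)"
      unfolding l2_square
    proof (rule sum_mono2)
      show "{e i<..e (Suc i) + (r - 1)} \<subseteq> (\<lambda>(d, t). t + d) ` ({..<r} \<times> {e i<..e (Suc i)})"
      proof
        fix t assume t: "t \<in> {e i<..e (Suc i) + (r - 1)}"
        define d where "d = t - e (Suc i)"
        have "t = (t - d) + d" "(d, t - d) \<in> {..<r} \<times> {e i<..e (Suc i)}"
          using t e_less[OF that] r_ge_2 unfolding d_def by auto
        then show "t \<in> (\<lambda>(d, t). t + d) ` ({..<r} \<times> {e i<..e (Suc i)})"
          by (metis (mono_tags, lifting) case_prod_conv image_eqI)
      qed
    qed auto
    also have "\<dots> \<le> (\<Sum>(d, t)\<in>{..<r} \<times> {e i<..e (Suc i)}. (x (t + d))\<^sup>2)"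
      using sum_image_le[of "{..<r} \<times> {e i<..e (Suc i)}" "\<lambda>t. (x t)\<^sup>2" "\<lambda>(d, t). t + d"]
      by (simp add: case_prod_unfold)
    finally show ?thesis by (simp add: sum.cartesian_product)
  qed
  then have "(\<Sum>i\<le>k. (l2 x {e i<..e (Suc i) + (r - 1)})\<^sup>2)
      \<le> (\<Sum>i\<le>k. \<Sum>d<r. \<Sum>t\<in>{e i<..e (Suc i)}. (x (t + d))\<^sup>2)"
    by (intro sum_mono) auto
  also have "\<dots> = (\<Sum>d<r. \<Sum>t\<in>{0<..e (Suc k)}. (x (t + d))\<^sup>2)"
    by (subst sum.swap) (simp add: union)
  also have "\<dots> \<le> (\<Sum>d<r. (l2 x {1..n})\<^sup>2)"
  proof (rule sum_mono)
    fix d assume "d \<in> {..<r}"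
    then show "(\<Sum>t\<in>{0<..e (Suc k)}. (x (t + d))\<^sup>2) \<le> (l2 x {1..n})\<^sup>2"
      unfolding sum_shift_Ioc[where f = "\<lambda>i. (x i)\<^sup>2"] l2_square
      by (intro sum_mono2) (use e_last r_le_n r_ge_2 in auto)
  qed
  finally show ?thesis by simp
qed

text \<open>
  The terms have a small sum and none is very negative, hence none is very large. Adding up the
  lower bounds by the Cauchy--Schwarz inequality costs only a factor \<open>sqrt (k + 1)\<close>.
\<close>

lemma seg_term_upper:
  fixes y :: real
  assumes "0 < y" "\<And>i. i \<le> k \<Longrightarrow> s i \<noteq> s (Suc i) \<Longrightarrow> y \<le> seg_len i"
    and "(\<Sum>i\<le>k. seg_term x i) \<le> \<eta>" "i \<le> k"
  shows "seg_term x i \<le> \<eta> + 2 * window_const (r - 1) / half_pow r y * (sqrt (r * real (k + 1)) * l2 x {1..n})"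
proof -
  define c where "c = 2 * window_const (r - 1) / half_pow r y"
  define W where "W i = l2 x {e i<..e (Suc i) + (r - 1)}" for i
  have "c \<ge> 0" unfolding c_def using window_const_pos[of "r - 1"] half_pow_pos[OF assms(1), of r] by simp
  have lower: "- (c * W j) \<le> seg_term x j" if "j \<le> k" for j
    unfolding c_def W_def using assms(1,2) that by (intro seg_term_lower) auto
  have "seg_term x i + c * W i \<le> (\<Sum>j\<le>k. seg_term x j + c * W j)"
    by (rule member_le_sum) (use lower assms(4) in \<open>auto simp: minus_le_iff add.commute\<close>, use lower in fastforce)
  moreover have "0 \<le> c * W i" unfolding W_def using \<open>c \<ge> 0\<close> l2_nonneg by simp
  ultimately have 1: "seg_term x i \<le> \<eta> + c * (\<Sum>j\<le>k. W j)"
    using assms(3) by (simp add: sum.distrib sum_distrib_left)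
  have "(\<Sum>j\<le>k. W j)\<^sup>2 \<le> (\<Sum>j\<le>k. (W j)\<^sup>2) * (\<Sum>j\<le>k. 1\<^sup>2)"
    using Cauchy_Schwarz_ineq_sum[of W "\<lambda>_. 1" "{..k}"] by simp
  also have "\<dots> \<le> (r * (l2 x {1..n})\<^sup>2) * (k + 1)"
    unfolding W_def by (intro mult_mono sum_l2_windows) (auto simp: sum_nonneg)
  also have "\<dots> = (sqrt (r * real (k + 1)) * l2 x {1..n})\<^sup>2"
    by (simp add: power_mult_distrib mult_ac)
  finally have "(\<Sum>j\<le>k. W j) \<le> sqrt (r * real (k + 1)) * l2 x {1..n}"
    by (rule power2_le_imp_le) (simp add: l2_nonneg)
  then have "c * (\<Sum>j\<le>k. W j) \<le> c * (sqrt (r * real (k + 1)) * l2 x {1..n})"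
    using \<open>c \<ge> 0\<close> by (rule mult_left_mono)
  with 1 show ?thesis unfolding c_def by linarith
qed

end

section \<open>Correlation of noise with a direction of descent\<close>

text \<open>
  The block together with its two neighbours of the same length, within \<open>{1..n}\<close>.
\<close>

definition near :: "nat \<Rightarrow> nat \<Rightarrow> nat \<Rightarrow> nat set" where
  "near n a w = {t \<in> {1..n}. a < t + w \<and> t \<le> a + 2 * w}"

lemma l1_append: "l1 x a (v + w) = l1 x a v + l1 x (a + v) w"
proof -
  have "{a<..a + (v + w)} = {a<..a + v} \<union> {a + v<..a + v + w}" by auto
  then show ?thesis unfolding l1_def by (simp only:) (subst sum.union_disjoint, auto)
qed

lemma whitney_subset:
  assumes "(a, w) \<in> whitney S M n" "0 \<in> S" "n \<in> S"
  shows "{a<..a + w} \<subseteq> {1..n}"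
  using whitney_fibre[OF assms] by blast

lemma sum_near_whitney:
  "(\<Sum>(a, w)\<in>whitney S M n. (l2 x (near n a w))\<^sup>2) \<le> 15 * (l2 x {1..n})\<^sup>2"
proof -
  have near: "(l2 x (near n a w))\<^sup>2 = (\<Sum>t\<in>{1..n}. if t \<in> near n a w then (x t)\<^sup>2 else 0)" for a w
  proof -
    have "near n a w = {t \<in> {1..n}. t \<in> near n a w}" by (auto simp: near_def)
    then show ?thesis unfolding l2_square by (metis (no_types) sum.inter_filter finite_atLeastAtMost)
  qed
  have "(\<Sum>(a, w)\<in>whitney S M n. (l2 x (near n a w))\<^sup>2)
      = (\<Sum>B\<in>whitney S M n. \<Sum>t\<in>{1..n}. if t \<in> near n (fst B) (snd B) then (x t)\<^sup>2 else 0)"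
    unfolding near by (simp add: case_prod_unfold)
  also have "\<dots> = (\<Sum>t\<in>{1..n}. \<Sum>B\<in>whitney S M n. if t \<in> near n (fst B) (snd B) then (x t)\<^sup>2 else 0)"
    by (rule sum.swap)
  also have "\<dots> \<le> (\<Sum>t\<in>{1..n}. 15 * (x t)\<^sup>2)"
  proof (rule sum_mono)
    fix t assume t: "t \<in> {1..n}"
    let ?C = "{B \<in> whitney S M n. t \<in> near n (fst B) (snd B)}"
    have "?C = {(a, w) \<in> whitney S M n. a < t + w \<and> t \<le> a + 2 * w}"
      using t by (auto simp: near_def)
    then have "card ?C \<le> 15" using whitney_overlap[of t S M n] t by simp
    then have "real (card ?C) * (x t)\<^sup>2 \<le> 15 * (x t)\<^sup>2" by (intro mult_right_mono) auto
    then show "(\<Sum>B\<in>whitney S M n. if t \<in> near n (fst B) (snd B) then (x t)\<^sup>2 else 0) \<le> 15 * (x t)\<^sup>2"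
      by (simp add: sum.If_cases[OF finite_whitney] Int_def)
  qed
  also have "\<dots> = 15 * (l2 x {1..n})\<^sup>2" by (simp add: l2_square sum_distrib_left)
  finally show ?thesis .
qed

lemma combine_bounds:
  fixes U V p p' :: real
  assumes "0 \<le> U" "0 \<le> V" "0 \<le> p" "0 \<le> p'"
  shows "p * U + (2 * V + p' * U) \<le> (p + p' + 2) * (U + V)"
  using mult_nonneg_nonneg[OF assms(3,2)] mult_nonneg_nonneg[OF assms(4,2)] assms
  by (simp add: algebra_simps)

definition core_const :: "nat \<Rightarrow> real \<Rightarrow> real" where
  "core_const r c = interp_const r * (10 * (1 + window_const (r - 1))
     + 4 * window_const (r - 1) * sqrt r / c ^ r + 2)"

context knot_structure
begin

lemma separators_ends: "0 \<in> separators" "n \<in> separators"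
  unfolding separators_def using e_0 by (auto intro: image_eqI[where x = 0])

lemma finite_separators: "finite separators" unfolding separators_def by simp

lemma card_separators: "card separators \<le> k + 2"
proof -
  have "card separators \<le> card (e ` {0..k}) + card {n}" unfolding separators_def by (rule card_Un_le)
  also have "\<dots> \<le> card {0..k} + 1" using card_image_le[of "{0..k}" e] by simp
  finally show ?thesis by simp
qed

lemma isolated_block_segment:
  assumes "isolated separators a w" "a < n"
  obtains i where "i \<le> k" "e i + 3 * w \<le> a" "a + 4 * w \<le> (if i = k then n else e (Suc i))"
proof -
  have iso: "e i + 3 * w \<le> a \<or> a + 4 * w \<le> e i" if "i \<le> k" for i
    using assms(1) that unfolding isolated_def separators_def by auto
  have "n + 3 * w \<le> a \<or> a + 4 * w \<le> n"
    using assms(1) unfolding isolated_def separators_def by auto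
  then have n: "a + 4 * w \<le> n" using assms(2) by auto
  define I where "I = {i. i \<le> k \<and> e i + 3 * w \<le> a}"
  have "finite I" unfolding I_def by simp
  show ?thesis
  proof (cases "0 \<in> I")
    case True
    then have "Max I \<in> I" using \<open>finite I\<close> by (intro Max_in) auto
    then have m: "Max I \<le> k" "e (Max I) + 3 * w \<le> a" unfolding I_def by auto
    have "a + 4 * w \<le> e (Suc (Max I))" if "Max I \<noteq> k"
    proof -
      have "Suc (Max I) \<notin> I" using Max_ge[OF \<open>finite I\<close>] not_less_eq_eq by blast
      then show ?thesis using m that iso[of "Suc (Max I)"] unfolding I_def by auto
    qed
    then show ?thesis using m n by (intro that[of "Max I"]) auto
  next
    case False
    then have "a = 0" "w = 0" using iso[of 0] e_0 unfolding I_def by auto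
    then have "0 \<in> I" unfolding I_def using e_0 by simp
    then show ?thesis using False by simp
  qed
qed

text \<open>
  For \<open>w < r\<close> there is no variation of order \<open>r\<close> inside the block. Otherwise the block is isolated,
  and the window inequality on its two neighbours gives points \<open>\<alpha>\<close> and \<open>\<gamma>\<close> of the same segment, on
  either side of the block, where \<open>g\<close> is small in the direction that bounds the variation between
  them.
\<close>

lemma whitney_block_roughness:
  assumes B: "(a, w) \<in> whitney separators M n"
    and \<tau>: "0 \<le> \<tau>" "\<And>i. i \<le> k \<Longrightarrow> seg_term x i \<le> \<tau>"
  shows "l1 x a w + real w ^ r * var_on r x a w
    \<le> (1 + window_const (r - 1)) * (sqrt (3 * real w) * l2 x (near n a w)) + real w ^ r * \<tau>"
proof -
  let ?K = "window_const (r - 1)"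
  have K: "?K > 0" by (rule window_const_pos)
  have w1: "1 \<le> w" using whitney_size[OF B] by simp
  have sub: "{a<..a + w} \<subseteq> {1..n}" by (rule whitney_subset[OF B separators_ends])
  have fin: "finite (near n a w)" unfolding near_def by simp
  show ?thesis
  proof (cases "w < r")
    case True
    then have v: "var_on r x a w = 0" unfolding var_on_def by simp
    have "l1 x a w \<le> sqrt w * l2 x (near n a w)"
      by (rule l1_le_l2[OF fin]) (use sub in \<open>auto simp: near_def\<close>)
    also have "\<dots> \<le> sqrt (3 * real w) * l2 x (near n a w)"
      by (intro mult_right_mono l2_nonneg) simp
    also have "\<dots> \<le> (1 + ?K) * (sqrt (3 * real w) * l2 x (near n a w))"
      using K l2_nonneg[of x "near n a w"] by (simp add: algebra_simps)
    finally show ?thesis using v mult_nonneg_nonneg[OF zero_le_power[of "real w" r] \<tau>(1)] by simp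
  next
    case False
    then have "w \<noteq> 1" using r_ge_2 by simp
    then have "isolated separators a w" using whitney_isolated[OF B] by simp
    moreover have "a < n" using sub w1 by force
    ultimately obtain i where i: "i \<le> k" "e i + 3 * w \<le> a"
      "a + 4 * w \<le> (if i = k then n else e (Suc i))" by (rule isolated_block_segment)
    have an: "a + 4 * w \<le> n"
    proof (cases "i = k")
      case False
      have "e (Suc i) \<le> e (Suc k)" using i(1) by (intro e_mono) auto
      then show ?thesis using i(3) False e_last r_le_n r_ge_2 by auto
    qed (use i in simp)
    have rw: "r - 1 < w" using False r_ge_2 by simp
    let ?g = "(fd ^^ (r - 1)) x"
    have rr: "r - 1 + 1 = r" using r_ge_2 by simp
    obtain \<alpha> where \<alpha>: "\<alpha> \<in> {a - w<..a - w + w - (r - 1)}"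
      "real w ^ r * (- s i * ?g \<alpha>) \<le> ?K * l1 x (a - w) w"
      using exists_small_signed_difference[OF rw, of "- s i" "a - w" x] s_le_1[of i] unfolding rr by auto
    obtain \<gamma> where \<gamma>: "\<gamma> \<in> {a + w<..a + w + w - (r - 1)}"
      "real w ^ r * (s (Suc i) * ?g \<gamma>) \<le> ?K * l1 x (a + w) w"
      using exists_small_signed_difference[OF rw, of "s (Suc i)" "a + w" x] s_le_1[of "Suc i"] unfolding rr by auto
    have "\<gamma> \<le> e (Suc i)"
    proof (cases "i = k")
      case True
      then show ?thesis using \<gamma>(1) an e_last rw r_ge_2 by auto
    qed (use \<gamma>(1) i in auto)
    moreover have "e i < \<alpha>" "\<alpha> \<le> a" "\<alpha> \<le> \<gamma>" using \<alpha>(1) \<gamma>(1) i(2) by auto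
    ultimately have "(\<Sum>t\<in>{\<alpha>..<\<gamma>}. \<bar>(fd ^^ r) x t\<bar>) \<le> seg_term x i - s i * ?g \<alpha> + s (Suc i) * ?g \<gamma>"
      by (intro seg_variation)
    moreover have "var_on r x a w \<le> (\<Sum>t\<in>{\<alpha>..<\<gamma>}. \<bar>(fd ^^ r) x t\<bar>)"
      unfolding var_on_def by (rule sum_mono2) (use \<open>\<alpha> \<le> a\<close> \<gamma>(1) in auto)
    ultimately have "var_on r x a w \<le> \<tau> + - s i * ?g \<alpha> + s (Suc i) * ?g \<gamma>" using \<tau>(2)[OF i(1)] by simp
    then have "real w ^ r * var_on r x a w \<le> real w ^ r * (\<tau> + - s i * ?g \<alpha> + s (Suc i) * ?g \<gamma>)"
      by (rule mult_left_mono) simp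
    then have "real w ^ r * var_on r x a w
        \<le> real w ^ r * \<tau> + ?K * l1 x (a - w) w + ?K * l1 x (a + w) w"
      using \<alpha>(2) \<gamma>(2) by (simp only: distrib_left)
    moreover have "l1 x a w + (?K * l1 x (a - w) w + ?K * l1 x (a + w) w)
        \<le> (1 + ?K) * l1 x (a - w) (3 * w)"
    proof -
      have "l1 x (a - w) (w + (w + w)) = l1 x (a - w) w + (l1 x a w + l1 x (a + w) w)"
        unfolding l1_append using i(2) by simp
      then have "l1 x (a - w) (3 * w) = l1 x (a - w) w + (l1 x a w + l1 x (a + w) w)"
        by (simp add: numeral_3_eq_3 add.assoc)
      then show ?thesis
        using K l1_nonneg[of x "a - w" w] l1_nonneg[of x a w] l1_nonneg[of x "a + w" w]
        by (simp add: algebra_simps)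
    qed
    moreover have "l1 x (a - w) (3 * w) \<le> sqrt (real (3 * w)) * l2 x (near n a w)"
      by (rule l1_le_l2[OF fin]) (use an i(2) in \<open>auto simp: near_def\<close>)
    then have "(1 + ?K) * l1 x (a - w) (3 * w) \<le> (1 + ?K) * (sqrt (3 * real w) * l2 x (near n a w))"
      using K by (intro mult_left_mono) auto
    ultimately show ?thesis by linarith
  qed
qed

text \<open>
  Two applications of the Cauchy--Schwarz inequality over the blocks: bounded overlap handles the
  norms on the enlarged blocks, and the disjointness of blocks of length at most \<open>2 ^ M\<close> handles the
  contribution of \<open>\<tau>\<close>.
\<close>

lemma correlation_bound_aux:
  fixes z :: "nat \<Rightarrow> real" and M :: nat
  assumes \<tau>: "0 \<le> \<tau>" "\<And>i. i \<le> k \<Longrightarrow> seg_term x i \<le> \<tau>"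
  defines "E \<equiv> (\<Sum>(a, w)\<in>whitney separators M n. energy z a w)"
  shows "(\<Sum>t\<in>{1..n}. z t * x t)
    \<le> interp_const r * sqrt E *
      (10 * (1 + window_const (r - 1)) * l2 x {1..n} + 2 * \<tau> * (2 ^ M) ^ (r - 1) * sqrt n)"
proof -
  let ?W = "whitney separators M n" and ?K = "window_const (r - 1)"
  define P where "P B = (case B of (a, w) \<Rightarrow> sqrt w * roughness z a w)" for B :: "nat \<times> nat"
  define Q where "Q B = (case B of (a, w) \<Rightarrow> (1 + ?K) * (sqrt 3 * l2 x (near n a w)) + half_pow r w * \<tau>)"
    for B :: "nat \<times> nat"
  have K: "?K > 0" by (rule window_const_pos)
  have I: "interp_const r \<ge> 0" using interp_const_ge_1[of r] by linarith
  have "(\<Sum>t\<in>{1..n}. z t * x t) = (\<Sum>(a, w)\<in>?W. \<Sum>t\<in>{a<..a + w}. z t * x t)"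
    by (rule sum_whitney) (rule separators_ends)+
  also have "\<dots> \<le> (\<Sum>B\<in>?W. interp_const r * (P B * Q B))"
  proof (rule sum_mono, clarify)
    fix a w assume B: "(a, w) \<in> ?W"
    have w: "1 \<le> w" using whitney_size[OF B] by simp
    have "(\<Sum>t\<in>{a<..a + w}. z t * x t) \<le> interp_const r * roughness z a w * (l1 x a w + real w ^ r * var_on r x a w)"
      using block_correlation[OF r_ge_2 w, where z = z and x = x and a = a] by linarith
    also have "\<dots> \<le> interp_const r * roughness z a w *
        ((1 + ?K) * (sqrt (3 * real w) * l2 x (near n a w)) + real w ^ r * \<tau>)"
      by (intro mult_left_mono whitney_block_roughness[OF B \<tau>] mult_nonneg_nonneg I roughness_nonneg)
    also have "(1 + ?K) * (sqrt (3 * real w) * l2 x (near n a w)) + real w ^ r * \<tau> = sqrt w * Q (a, w)"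
      unfolding Q_def using r_ge_2 sqrt_mult_half_pow[of r "real w", symmetric]
      by (simp add: real_sqrt_mult algebra_simps)
    finally show "(\<Sum>t\<in>{a<..a + w}. z t * x t) \<le> interp_const r * (P (a, w) * Q (a, w))"
      unfolding P_def by (simp add: mult_ac)
  qed
  also have "\<dots> = interp_const r * (\<Sum>B\<in>?W. P B * Q B)" by (simp add: sum_distrib_left)
  finally have corr: "(\<Sum>t\<in>{1..n}. z t * x t) \<le> interp_const r * (\<Sum>B\<in>?W. P B * Q B)" .
  have "(\<Sum>B\<in>?W. P B * Q B)
      \<le> sqrt E * (10 * (1 + ?K) * l2 x {1..n} + 2 * \<tau> * (2 ^ M) ^ (r - 1) * sqrt n)"
  proof -
    have PE: "(\<Sum>B\<in>?W. (P B)\<^sup>2) \<le> E"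
      unfolding E_def
    proof (rule sum_mono, clarify)
      fix a w assume B: "(a, w) \<in> ?W"
      show "(P (a, w))\<^sup>2 \<le> energy z a w"
        using roughness_square_le_energy[of w z a] whitney_size[OF B]
        by (simp add: P_def power_mult_distrib)
    qed
    define A where "A = (1 + ?K) * l2 x {1..n}"
    define D where "D = \<tau> * (2 ^ M) ^ (r - 1) * sqrt n"
    have AD: "A \<ge> 0" "D \<ge> 0" unfolding A_def D_def using K \<tau>(1) l2_nonneg by auto
    have "(\<Sum>B\<in>?W. (Q B)\<^sup>2)
      \<le> (\<Sum>(a, w)\<in>?W. 6 * (1 + ?K)\<^sup>2 * (l2 x (near n a w))\<^sup>2 + 2 * \<tau>\<^sup>2 * ((2 ^ M) ^ (2 * (r - 1)) * (\<Sum>t\<in>{a<..a + w}. 1)))"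
    proof (rule sum_mono, clarify)
      fix a w assume B: "(a, w) \<in> ?W"
      have "real w \<le> real (2 ^ M)" using whitney_size[OF B] by (simp only: of_nat_le_iff)
      then have "real w ^ (2 * (r - 1)) \<le> (2 ^ M) ^ (2 * (r - 1))" by (intro power_mono) auto
      then have "(half_pow r w)\<^sup>2 \<le> (2 ^ M) ^ (2 * (r - 1)) * real w"
        unfolding half_pow_def by (simp add: power_mult_distrib power_mult[symmetric] mult.commute mult_left_mono)
      then have h: "(half_pow r w * \<tau>)\<^sup>2 \<le> \<tau>\<^sup>2 * ((2 ^ M) ^ (2 * (r - 1)) * real w)"
        by (simp add: power_mult_distrib mult.commute mult_left_mono)
      have "(Q (a, w))\<^sup>2 \<le> 2 * (((1 + ?K) * (sqrt 3 * l2 x (near n a w)))\<^sup>2 + (half_pow r w * \<tau>)\<^sup>2)"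
        unfolding Q_def prod.case
        using sum_squares_bound[of "(1 + ?K) * (sqrt 3 * l2 x (near n a w))" "half_pow r w * \<tau>"]
        by (simp add: power2_sum)
      also have "((1 + ?K) * (sqrt 3 * l2 x (near n a w)))\<^sup>2 = 3 * (1 + ?K)\<^sup>2 * (l2 x (near n a w))\<^sup>2"
        by (simp add: power_mult_distrib)
      finally show "(Q (a, w))\<^sup>2 \<le> 6 * (1 + ?K)\<^sup>2 * (l2 x (near n a w))\<^sup>2
          + 2 * \<tau>\<^sup>2 * ((2 ^ M) ^ (2 * (r - 1)) * (\<Sum>t\<in>{a<..a + w}. 1))"
        using h by simp
    qed
    also have "\<dots> = 6 * (1 + ?K)\<^sup>2 * (\<Sum>(a, w)\<in>?W. (l2 x (near n a w))\<^sup>2)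
        + 2 * \<tau>\<^sup>2 * ((2 ^ M) ^ (2 * (r - 1)) * (\<Sum>(a, w)\<in>?W. \<Sum>t\<in>{a<..a + w}. 1))"
      by (simp add: case_prod_unfold sum.distrib sum_distrib_left)
    also have "(\<Sum>(a, w)\<in>?W. \<Sum>t\<in>{a<..a + w}. 1) = real n"
      using sum_whitney[OF separators_ends, of "\<lambda>_. 1" M] by simp
    also have "6 * (1 + ?K)\<^sup>2 * (\<Sum>(a, w)\<in>?W. (l2 x (near n a w))\<^sup>2)
        \<le> 6 * (1 + ?K)\<^sup>2 * (15 * (l2 x {1..n})\<^sup>2)"
      by (intro mult_left_mono sum_near_whitney) auto
    also have "6 * (1 + ?K)\<^sup>2 * (15 * (l2 x {1..n})\<^sup>2) + 2 * \<tau>\<^sup>2 * ((2 ^ M) ^ (2 * (r - 1)) * real n)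
        = 90 * A\<^sup>2 + 2 * D\<^sup>2"
      unfolding A_def D_def by (simp add: power_mult_distrib power_mult[symmetric] mult.commute)
    also have "\<dots> \<le> (10 * A + 2 * D)\<^sup>2"
      using AD by (simp add: power2_sum power_mult_distrib)
    finally have QQ: "(\<Sum>B\<in>?W. (Q B)\<^sup>2) \<le> (10 * A + 2 * D)\<^sup>2" by simp
    have "(\<Sum>B\<in>?W. P B * Q B)\<^sup>2 \<le> (\<Sum>B\<in>?W. (P B)\<^sup>2) * (\<Sum>B\<in>?W. (Q B)\<^sup>2)"
      by (rule Cauchy_Schwarz_ineq_sum)
    also have "\<dots> \<le> E * (10 * A + 2 * D)\<^sup>2"
      by (intro mult_mono PE QQ) (auto simp: E_def energy_nonneg case_prod_unfold sum_nonneg)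
    finally have "(\<Sum>B\<in>?W. P B * Q B) \<le> sqrt (E * (10 * A + 2 * D)\<^sup>2)" by (rule real_le_rsqrt)
    also have "\<dots> = sqrt E * (10 * A + 2 * D)" using AD by (simp add: real_sqrt_mult)
    finally show ?thesis unfolding A_def D_def by (simp only: mult.assoc)
  qed
  from order_trans[OF corr mult_left_mono[OF this I]] show ?thesis by (simp only: mult.assoc)
qed

text \<open>
  Inserting the bound on the segment terms for \<open>\<tau>\<close>, at block size at most \<open>n / (k + 1)\<close> the powers
  of \<open>n / (k + 1)\<close> cancel and a factor \<open>k + 1\<close> remains.
\<close>

lemma correlation_bound:
  fixes c :: real
  assumes c: "0 < c" "c \<le> 1"
    and M: "2 ^ M \<le> real n / real (k + 1)"
    and len: "\<And>i. i \<le> k \<Longrightarrow> s i \<noteq> s (Suc i) \<Longrightarrow> c * (real n / real (k + 1)) \<le> seg_len i"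
    and \<eta>: "0 \<le> \<eta>" "(\<Sum>i\<le>k. seg_term x i) \<le> \<eta>"
  shows "(\<Sum>t\<in>{1..n}. z t * x t)
    \<le> core_const r c * sqrt (\<Sum>(a, w)\<in>whitney separators M n. energy z a w)
      * (real (k + 1) * l2 x {1..n} + \<eta> * (half_pow r (real n / real (k + 1)) * sqrt (k + 1)))"
proof -
  define L where "L = real n / real (k + 1)"
  define E where "E = (\<Sum>(a, w)\<in>whitney separators M n. energy z a w)"
  define X where "X = l2 x {1..n}"
  define q where "q = sqrt (real (k + 1))"
  let ?K = "window_const (r - 1)"
  have K: "?K > 0" by (rule window_const_pos)
  have n0: "n > 0" using r_ge_2 r_le_n by simp
  then have L: "L > 0" unfolding L_def by simp
  have X: "X \<ge> 0" unfolding X_def by (rule l2_nonneg)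
  have q: "q \<ge> 1" "q * q = real (k + 1)" unfolding q_def by auto
  have I: "interp_const r \<ge> 0" using interp_const_ge_1[of r] by linarith
  define \<tau> where "\<tau> = \<eta> + 2 * ?K / half_pow r (c * L) * (sqrt (r * real (k + 1)) * X)"
  have "c * L > 0" using c L by simp
  have upper: "seg_term x i \<le> \<tau>" if "i \<le> k" for i
    unfolding \<tau>_def X_def using seg_term_upper[OF \<open>c * L > 0\<close> _ \<eta>(2) that] len unfolding L_def by blast
  have "\<tau> \<ge> 0" unfolding \<tau>_def using \<eta>(1) K half_pow_pos[OF \<open>c * L > 0\<close>, of r] X by simp
  have "(2 ^ M) ^ (r - 1) * sqrt n \<le> L ^ (r - 1) * sqrt n"
    using M unfolding L_def by (intro mult_right_mono power_mono) auto
  also have "\<dots> = half_pow r L * q"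
    unfolding half_pow_def q_def L_def by (simp add: real_sqrt_divide)
  finally have "\<tau> * ((2 ^ M) ^ (r - 1) * sqrt n) \<le> \<tau> * (half_pow r L * q)"
    using \<open>\<tau> \<ge> 0\<close> by (rule mult_left_mono)
  also have "\<dots> = \<eta> * (half_pow r L * q) + 2 * ?K * sqrt r * X * (q * q) * (half_pow r L / half_pow r (c * L))"
  proof -
    have "sqrt (r * real (k + 1)) = sqrt r * q" unfolding q_def by (rule real_sqrt_mult)
    then show ?thesis unfolding \<tau>_def distrib_right by simp
  qed
  finally have D: "\<tau> * ((2 ^ M) ^ (r - 1) * sqrt n)
      \<le> \<eta> * (half_pow r L * q) + 2 * ?K * sqrt r * X * (q * q) * (half_pow r L / half_pow r (c * L))" .
  have "half_pow r L * c ^ r \<le> half_pow r (c * L)"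
    using half_pow_mult_ge[of r c L] c L r_ge_2 by (simp add: mult.commute)
  then have "half_pow r L \<le> half_pow r (c * L) / c ^ r" using c by (simp only: pos_le_divide_eq zero_less_power)
  then have "half_pow r L / half_pow r (c * L) \<le> 1 / c ^ r"
    using half_pow_pos[OF \<open>c * L > 0\<close>, of r] by (simp add: pos_divide_le_eq)
  moreover have "0 \<le> 2 * ?K * sqrt r * X * (q * q)" using K X q(1) by (intro mult_nonneg_nonneg) auto
  ultimately have "2 * ?K * sqrt r * X * (q * q) * (half_pow r L / half_pow r (c * L))
      \<le> 2 * ?K * sqrt r * X * (q * q) * (1 / c ^ r)"
    by (rule mult_left_mono)
  with D have D: "\<tau> * ((2 ^ M) ^ (r - 1) * sqrt n)
      \<le> \<eta> * (half_pow r L * q) + 2 * ?K * sqrt r * X * (q * q) * (1 / c ^ r)"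
    by linarith
  define p' where "p' = 4 * ?K * sqrt r / c ^ r"
  define Y where "Y = \<eta> * (half_pow r L * q)"
  have p': "p' \<ge> 0" unfolding p'_def using K c by simp
  have Y: "Y \<ge> 0"
    unfolding Y_def using \<eta>(1) q(1) half_pow_pos[OF L, of r] by (intro mult_nonneg_nonneg) auto
  have U: "(q * q) * X \<ge> 0" using X q(1) by (intro mult_nonneg_nonneg) auto
  have "2 * ?K * sqrt r * X * (q * q) * (1 / c ^ r) = p' / 2 * ((q * q) * X)"
    unfolding p'_def by simp
  with D have D': "2 * (\<tau> * ((2 ^ M) ^ (r - 1) * sqrt n)) \<le> 2 * Y + p' * ((q * q) * X)"
    unfolding Y_def by linarith
  have "1 * X \<le> (q * q) * X" using X q by (intro mult_right_mono) auto
  then have X': "10 * (1 + ?K) * X \<le> 10 * (1 + ?K) * ((q * q) * X)"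
    using K by (intro mult_left_mono) auto
  have "10 * (1 + ?K) * X + 2 * \<tau> * (2 ^ M) ^ (r - 1) * sqrt n
      \<le> 10 * (1 + ?K) * ((q * q) * X) + (2 * Y + p' * ((q * q) * X))"
    using add_mono[OF X' D'] by (simp only: mult.assoc)
  also have "\<dots> \<le> (10 * (1 + ?K) + p' + 2) * ((q * q) * X + Y)"
    using K by (intro combine_bounds U Y p') auto
  finally have main: "10 * (1 + ?K) * X + 2 * \<tau> * (2 ^ M) ^ (r - 1) * sqrt n
      \<le> (10 * (1 + ?K) + p' + 2) * ((q * q) * X + Y)" .
  have E: "0 \<le> interp_const r * sqrt E"
    using I by (simp add: E_def energy_nonneg case_prod_unfold sum_nonneg)
  have "(\<Sum>t\<in>{1..n}. z t * x t)
    \<le> interp_const r * sqrt E * (10 * (1 + ?K) * X + 2 * \<tau> * (2 ^ M) ^ (r - 1) * sqrt n)"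
    unfolding E_def X_def by (rule correlation_bound_aux[OF \<open>\<tau> \<ge> 0\<close> upper])
  also note mult_left_mono[OF main E]
  also have "interp_const r * sqrt E * ((10 * (1 + ?K) + p' + 2) * ((q * q) * X + Y))
      = core_const r c * sqrt E * ((q * q) * X + Y)"
    unfolding core_const_def p'_def by (simp only: mult_ac)
  finally have "(\<Sum>t\<in>{1..n}. z t * x t) \<le> core_const r c * sqrt E * ((q * q) * X + Y)" .
  then show ?thesis unfolding E_def X_def L_def q(2) Y_def q_def by simp
qed

end

section \<open>Second moments of Gaussian linear forms\<close>

abbreviation std_normal :: "real measure" where
  "std_normal \<equiv> density lborel (\<lambda>x. ennreal (std_normal_density x))"

lemma std_normal_moments:
  assumes "p \<le> 2"
  shows "integrable std_normal (\<lambda>x. x ^ p)"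
    "(\<integral>x. x ^ p \<partial>std_normal) = (if p = 1 then 0 else 1)"
proof -
  show "integrable std_normal (\<lambda>x. x ^ p)"
    by (rule integrable_std_normal_distribution_moment)
  have "(\<integral>x. x ^ p \<partial>std_normal) = (\<integral>x. std_normal_density x * x ^ p \<partial>lborel)"
    by (subst integral_density) (auto simp: normal_density_nonneg)
  also have "\<dots> = (if p = 1 then 0 else 1)"
  proof -
    consider "p = 0" | "p = 1" | "p = 2" using assms by linarith
    then show ?thesis
      using integral_std_normal_moment_even[of 0] integral_std_normal_moment_even[of 1]
        integral_std_normal_moment_odd[of 0]
      by cases (simp_all add: numeral_2_eq_2)
  qed
  finally show "(\<integral>x. x ^ p \<partial>std_normal) = (if p = 1 then 0 else 1)" .
qed

text \<open>
  Both moments are integrals of a product over the coordinates, the exponent of the coordinate \<open>l\<close>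
  being the number of times that \<open>l\<close> occurs among \<open>i\<close> and \<open>j\<close>.
\<close>

lemma gaussian_product_moment:
  assumes "i \<in> {1..n}" "j \<in> {1..n}"
  shows "integrable (std_gaussian n) (\<lambda>z. z i * z j)"
    "(\<integral>z. z i * z j \<partial>std_gaussian n) = (if i = j then 1 else 0)"
proof -
  interpret product_prob_space "\<lambda>_::nat. std_normal" "{1..n}"
    by (intro product_prob_spaceI prob_space_normal_density) simp
  define p :: "nat \<Rightarrow> nat" where "p l = (if l = i then 1 else 0) + (if l = j then 1 else 0)" for l
  have p: "p l \<le> 2" for l by (simp add: p_def)
  have eq: "z i * z j = (\<Prod>l\<in>{1..n}. z l ^ p l)" for z :: "nat \<Rightarrow> real"
  proof -
    have "(\<Prod>l\<in>{1..n}. z l ^ p l) = (\<Prod>l\<in>{1..n}. (if l = i then z l else 1) * (if l = j then z l else 1))"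
      by (intro prod.cong) (auto simp: p_def)
    also have "\<dots> = z i * z j" using assms by (simp add: prod.distrib prod.delta)
    finally show ?thesis ..
  qed
  show "integrable (std_gaussian n) (\<lambda>z. z i * z j)"
    unfolding std_gaussian_def eq
    by (rule product_integrable_prod) (use std_normal_moments(1) p in auto)
  have "(\<integral>z. z i * z j \<partial>std_gaussian n) = (\<Prod>l\<in>{1..n}. if p l = 1 then 0 else 1)"
    unfolding std_gaussian_def eq
    using product_integral_prod[of "{1..n}" "\<lambda>l x. x ^ p l"] std_normal_moments p by simp
  also have "\<dots> = (if i = j then 1 else 0)"
  proof (cases "i = j")
    case False
    then have "p i = 1" by (simp add: p_def)
    then show ?thesis using False assms(1) by (intro trans[OF prod_zero]) auto
  next
    case True
    then have "p l \<noteq> 1" for l by (simp add: p_def)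
    then show ?thesis using True by simp
  qed
  finally show "(\<integral>z. z i * z j \<partial>std_gaussian n) = (if i = j then 1 else 0)" .
qed

lemma gaussian_linear_form:
  assumes "A \<subseteq> {1..n}"
  shows "integrable (std_gaussian n) (\<lambda>z. (\<Sum>t\<in>A. c t * z t)\<^sup>2)"
    "(\<integral>z. (\<Sum>t\<in>A. c t * z t)\<^sup>2 \<partial>std_gaussian n) = (\<Sum>t\<in>A. (c t)\<^sup>2)"
proof -
  have fin: "finite A" using assms finite_subset by blast
  have eq: "(\<Sum>t\<in>A. c t * z t)\<^sup>2 = (\<Sum>i\<in>A. \<Sum>j\<in>A. (c i * c j) * (z i * z j))" for z :: "nat \<Rightarrow> real"
    by (simp add: power2_eq_square sum_product mult_ac)
  have int: "integrable (std_gaussian n) (\<lambda>z. (c i * c j) * (z i * z j))" if "i \<in> A" "j \<in> A" for i j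
    by (intro integrable_mult_right gaussian_product_moment(1)) (use that assms in blast)+
  show "integrable (std_gaussian n) (\<lambda>z. (\<Sum>t\<in>A. c t * z t)\<^sup>2)"
    unfolding eq by (intro Bochner_Integration.integrable_sum int)
  have "(\<integral>z. (\<Sum>t\<in>A. c t * z t)\<^sup>2 \<partial>std_gaussian n)
      = (\<Sum>i\<in>A. \<Sum>j\<in>A. \<integral>z. (c i * c j) * (z i * z j) \<partial>std_gaussian n)"
    unfolding eq
    by (subst Bochner_Integration.integral_sum, intro Bochner_Integration.integrable_sum int, assumption+,
        intro sum.cong refl Bochner_Integration.integral_sum int)
  also have "\<dots> = (\<Sum>i\<in>A. \<Sum>j\<in>A. if i = j then c i * c j else 0)"
  proof (intro sum.cong refl)
    fix i j assume "i \<in> A" "j \<in> A"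
    then show "(\<integral>z. (c i * c j) * (z i * z j) \<partial>std_gaussian n) = (if i = j then c i * c j else 0)"
      using gaussian_product_moment(2)[of i n j] subsetD[OF assms] by simp
  qed
  also have "\<dots> = (\<Sum>t\<in>A. (c t)\<^sup>2)" using fin by (simp add: power2_eq_square)
  finally show "(\<integral>z. (\<Sum>t\<in>A. c t * z t)\<^sup>2 \<partial>std_gaussian n) = (\<Sum>t\<in>A. (c t)\<^sup>2)" .
qed

lemma gaussian_prob_space: "prob_space (std_gaussian n)"
  unfolding std_gaussian_def by (intro prob_space_PiM prob_space_normal_density) simp

lemma psum_second_moment:
  assumes "{a<..a + w} \<subseteq> {1..n}" "t \<le> w"
  shows "integrable (std_gaussian n) (\<lambda>z. (psum z a t)\<^sup>2)"
    "(\<integral>z. (psum z a t)\<^sup>2 \<partial>std_gaussian n) = t"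
proof -
  have "{a<..a + t} \<subseteq> {1..n}" using assms by auto
  from gaussian_linear_form[OF this, of "\<lambda>_. 1"]
  show "integrable (std_gaussian n) (\<lambda>z. (psum z a t)\<^sup>2)"
    "(\<integral>z. (psum z a t)\<^sup>2 \<partial>std_gaussian n) = t"
    unfolding psum_def by simp_all
qed

lemma energy_expectation:
  assumes "{a<..a + w} \<subseteq> {1..n}" "1 \<le> w"
  shows "integrable (std_gaussian n) (\<lambda>z. energy z a w)"
    "(\<integral>z. energy z a w \<partial>std_gaussian n) \<le> 4"
proof -
  note m = psum_second_moment[OF assms(1)]
  show "integrable (std_gaussian n) (\<lambda>z. energy z a w)"
    unfolding energy_def
    by (intro integrable_mult_right Bochner_Integration.integrable_add integrable_divide
        Bochner_Integration.integrable_sum m) auto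
  have i1: "integrable (std_gaussian n) (\<lambda>z. (psum z a w)\<^sup>2 / w)"
    by (intro integrable_divide m) auto
  have i2: "integrable (std_gaussian n) (\<lambda>z. (\<Sum>t\<in>{1..w}. (psum z a t)\<^sup>2) / w\<^sup>2)"
    by (intro integrable_divide Bochner_Integration.integrable_sum m) auto
  have "(\<integral>z. energy z a w \<partial>std_gaussian n)
      = 2 * ((\<integral>z. (psum z a w)\<^sup>2 \<partial>std_gaussian n) / w
         + (\<integral>z. (\<Sum>t\<in>{1..w}. (psum z a t)\<^sup>2) \<partial>std_gaussian n) / w\<^sup>2)"
    unfolding energy_def
    by (simp only: integral_mult_right_zero Bochner_Integration.integral_add[OF i1 i2] integral_divide_zero)
  also have "(\<integral>z. (\<Sum>t\<in>{1..w}. (psum z a t)\<^sup>2) \<partial>std_gaussian n)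
      = (\<Sum>t\<in>{1..w}. \<integral>z. (psum z a t)\<^sup>2 \<partial>std_gaussian n)"
    by (rule Bochner_Integration.integral_sum) (use m in auto)
  also have "2 * ((\<integral>z. (psum z a w)\<^sup>2 \<partial>std_gaussian n) / w
      + (\<Sum>t\<in>{1..w}. \<integral>z. (psum z a t)\<^sup>2 \<partial>std_gaussian n) / w\<^sup>2)
    = 2 * (1 + (\<Sum>t\<in>{1..w}. real t) / w\<^sup>2)"
    using m assms(2) by simp
  also have "\<dots> \<le> 4"
  proof -
    have "(\<Sum>t\<in>{1..w}. real t) \<le> (\<Sum>t\<in>{1..w}. real w)" by (rule sum_mono) simp
    also have "\<dots> = (real w)\<^sup>2" by (simp add: power2_eq_square)
    finally have "(\<Sum>t\<in>{1..w}. real t) / w\<^sup>2 \<le> 1" using assms(2) by (simp add: divide_le_eq)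
    moreover have "2 * (1 + q) \<le> 4" if "q \<le> 1" for q :: real using that by simp
    ultimately show ?thesis by blast
  qed
  finally show "(\<integral>z. energy z a w \<partial>std_gaussian n) \<le> 4" .
qed

section \<open>Least norm on the affine hull and the optimal scale\<close>

text \<open>
  Like \<open>enorm\<close>, this sees only the coordinates in \<open>{1..n}\<close>, so on the type of all functions it is
  positive semidefinite and not definite.
\<close>

definition ip :: "nat \<Rightarrow> (nat \<Rightarrow> real) \<Rightarrow> (nat \<Rightarrow> real) \<Rightarrow> real" where
  "ip n x y = (\<Sum>i\<in>{1..n}. x i * y i)"

lemma ip_add_left: "ip n (x + y) w = ip n x w + ip n y w"
  and ip_diff_left: "ip n (x - y) w = ip n x w - ip n y w"
  and ip_scaleR_left: "ip n (c *\<^sub>R x) w = c * ip n x w"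
  by (simp_all add: ip_def scaleR_fun_def algebra_simps sum.distrib sum_subtractf sum_distrib_left)

lemma ip_commute: "ip n x y = ip n y x"
  by (simp add: ip_def mult.commute)

lemma ip_add_right: "ip n w (x + y) = ip n w x + ip n w y"
  and ip_diff_right: "ip n w (x - y) = ip n w x - ip n w y"
  and ip_scaleR_right: "ip n w (c *\<^sub>R x) = c * ip n w x"
  using ip_add_left ip_diff_left ip_scaleR_left by (simp_all add: ip_commute[of n w])

lemmas ip_simps = ip_add_left ip_diff_left ip_scaleR_left ip_add_right ip_diff_right ip_scaleR_right

lemma enorm_eq_l2: "enorm n x = l2 x {1..n}"
  by (simp add: enorm_def L2_set_def l2_def)

lemma enorm_square: "(enorm n x)\<^sup>2 = ip n x x"
  unfolding enorm_eq_l2 l2_square ip_def by (simp add: power2_eq_square)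

lemma enorm_nonneg: "0 \<le> enorm n x"
  by (simp add: enorm_eq_l2 l2_nonneg)

lemma enorm_add: "enorm n (x + y) \<le> enorm n x + enorm n y"
  using L2_set_triangle_ineq[of x y "{1..n}"] by (simp add: enorm_def plus_fun_def)

lemma enorm_scaleR: "enorm n (c *\<^sub>R x) = \<bar>c\<bar> * enorm n x"
  by (simp add: enorm_def scaleR_fun_def L2_set_def power_mult_distrib real_sqrt_mult
      flip: sum_distrib_left)

lemma abs_ip_le: "\<bar>ip n x y\<bar> \<le> enorm n x * enorm n y"
proof -
  have "\<bar>ip n x y\<bar> \<le> (\<Sum>i\<in>{1..n}. \<bar>x i\<bar> * \<bar>y i\<bar>)"
    unfolding ip_def by (rule order_trans[OF sum_abs]) (simp add: abs_mult)
  also have "\<dots> \<le> enorm n x * enorm n y"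
    unfolding enorm_def by (rule L2_set_mult_ineq)
  finally show ?thesis .
qed

text \<open>
  One step of the Gram--Schmidt process for each spanning vector. If the new direction \<open>d\<close> has norm
  zero, then it is orthogonal to everything and the coefficient \<open>c\<close> is zero, because division by
  zero yields zero.
\<close>

lemma exists_orthogonal_projection:
  assumes "finite B"
  shows "\<exists>v\<in>span B. \<forall>w\<in>span B. ip n (p - v) w = 0"
  using assms
proof (induction B arbitrary: p rule: finite_induct)
  case empty
  show ?case by (intro bexI[of _ 0]) (auto simp: ip_def)
next
  case (insert b B)
  obtain b1 where b1: "b1 \<in> span B" "\<And>w. w \<in> span B \<Longrightarrow> ip n (b - b1) w = 0"
    using insert.IH by blast
  obtain p1 where p1: "p1 \<in> span B" "\<And>w. w \<in> span B \<Longrightarrow> ip n (p - p1) w = 0"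
    using insert.IH by blast
  define d where "d = b - b1"
  define c where "c = ip n p d / ip n d d"
  have c: "ip n p d = c * ip n d d"
  proof (cases "ip n d d = 0")
    case True
    then have "enorm n d = 0" using enorm_square[of n d] by simp
    then have "ip n p d = 0" using abs_ip_le[of n p d] by simp
    then show ?thesis using True by simp
  qed (simp add: c_def)
  have sub: "span B \<subseteq> span (insert b B)" by (rule span_mono) auto
  have "d \<in> span (insert b B)"
    unfolding d_def by (rule span_diff[OF span_base subsetD[OF sub b1(1)]]) simp
  then have "p1 + c *\<^sub>R d \<in> span (insert b B)"
    using p1(1) sub by (intro span_add span_scale) auto
  moreover have "ip n (p - (p1 + c *\<^sub>R d)) w = 0" if "w \<in> span (insert b B)" for w
  proof -
    obtain k where "w - k *\<^sub>R b \<in> span B" using \<open>w \<in> span (insert b B)\<close> unfolding span_insert by blast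
    then have w': "w - k *\<^sub>R b + k *\<^sub>R b1 \<in> span B" (is "?w \<in> _")
      using b1(1) by (intro span_add span_scale)
    have w: "w = k *\<^sub>R d + ?w" unfolding d_def by (simp add: algebra_simps)
    have o: "ip n p ?w = ip n p1 ?w" "ip n d ?w = 0" "ip n d p1 = 0"
      using p1(2)[OF w'] b1(2)[OF w'] b1(2)[OF p1(1)] unfolding d_def by (simp_all add: ip_diff_left)
    have "ip n (p - (p1 + c *\<^sub>R d)) (k *\<^sub>R d + u)
        = k * (ip n p d - ip n d p1 - c * ip n d d) + (ip n p u - ip n p1 u) - c * ip n d u" for u
      by (simp add: ip_simps ip_commute[of n p1 d] algebra_simps)
    from this[of ?w] show ?thesis unfolding w[symmetric] o c by simp
  qed
  ultimately show ?case by blast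
qed

lemma sum_apply:
  fixes f :: "'a \<Rightarrow> 'b \<Rightarrow> real"
  shows "(\<Sum>j\<in>A. f j) i = (\<Sum>j\<in>A. f j i)"
  by (induction A rule: infinite_finite_induct) auto

lemma Rn_subset_finite_span:
  "\<exists>T. finite T \<and> Rn n \<subseteq> span T"
proof (intro exI conjI)
  define \<delta> where "\<delta> j = (\<lambda>i. if i = j then 1 else 0 :: real)" for j :: nat
  show "finite (\<delta> ` {1..n})" by simp
  show "Rn n \<subseteq> span (\<delta> ` {1..n})"
  proof
    fix x assume x: "x \<in> Rn n"
    have "x = (\<Sum>j\<in>{1..n}. x j *\<^sub>R \<delta> j)"
    proof
      fix i
      have "(\<Sum>j\<in>{1..n}. x j *\<^sub>R \<delta> j) i = (\<Sum>j\<in>{1..n}. if i = j then x j else 0)"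
        by (simp add: sum_apply scaleR_fun_def \<delta>_def if_distrib cong: if_cong)
      also have "\<dots> = x i" using x by (auto simp: Rn_def)
      finally show "x i = (\<Sum>j\<in>{1..n}. x j *\<^sub>R \<delta> j) i" ..
    qed
    also have "\<dots> \<in> span (\<delta> ` {1..n})"
      by (intro span_sum span_scale span_base) auto
    finally show "x \<in> span (\<delta> ` {1..n})" .
  qed
qed

lemma affine_has_min_norm:
  assumes "affine A" "A \<subseteq> Rn n" "a \<in> A"
  shows "\<exists>u\<in>A. \<forall>y\<in>A. enorm n u \<le> enorm n y"
proof -
  define V where "V = (\<lambda>x. - a + x) ` A"
  have V: "subspace V" unfolding V_def by (rule affine_diffs_subspace) fact+
  have "V \<subseteq> Rn n"
  proof
    fix v assume "v \<in> V"
    then obtain x where x: "x \<in> A" "v = - a + x" unfolding V_def by blast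
    then have "x \<in> Rn n" "a \<in> Rn n" using assms by blast+
    then show "v \<in> Rn n" unfolding x Rn_def by auto
  qed
  obtain T where T: "finite T" "Rn n \<subseteq> span T" using Rn_subset_finite_span by blast
  obtain B where B: "B \<subseteq> V" "independent B" "V \<subseteq> span B"
    by (rule maximal_independent_subset)
  have "finite B"
    using independent_span_bound[OF T(1) B(2)] B(1) \<open>V \<subseteq> Rn n\<close> T(2) by blast
  have "span B = V" using B V by (meson span_minimal subset_antisym)
  then obtain v where v: "v \<in> V" "\<And>w. w \<in> V \<Longrightarrow> ip n (a - v) w = 0"
    using exists_orthogonal_projection[OF \<open>finite B\<close>] by metis
  have "- v \<in> V" using V v(1) by (simp add: subspace_neg)
  then have uA: "a - v \<in> A" unfolding V_def by (auto simp: algebra_simps)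
  have "enorm n (a - v) \<le> enorm n y" if "y \<in> A" for y
  proof -
    have "- a + y \<in> V" using \<open>y \<in> A\<close> by (simp add: V_def)
    then have "- a + y + v \<in> V" using V v(1) by (simp add: subspace_add)
    then have o: "ip n (a - v) (- a + y + v) = 0" by (rule v(2))
    have "y = (a - v) + (- a + y + v)" by simp
    then have "ip n y y = ip n ((a - v) + (- a + y + v)) ((a - v) + (- a + y + v))" by simp
    also have "\<dots> = ip n (a - v) (a - v) + ip n (- a + y + v) (- a + y + v)"
      using o ip_commute[of n "- a + y + v" "a - v"]
      by (simp only: ip_add_left[of n "a - v"] ip_add_right[of n _ "a - v"])
    finally have "(enorm n (a - v))\<^sup>2 \<le> (enorm n y)\<^sup>2"
      unfolding enorm_square using enorm_square[of n "- a + y + v"] by (metis add_increasing2 order_refl zero_le_power2)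
    then show ?thesis by (rule power2_le_imp_le) (rule enorm_nonneg)
  qed
  then show ?thesis using uA by blast
qed

text \<open>
  The choice operator in \<open>arg_min_on\<close> is meaningful only once a minimiser is known to exist.
\<close>

lemma arg_min_on_attained:
  fixes f :: "'a \<Rightarrow> real"
  assumes "u \<in> A" "\<And>y. y \<in> A \<Longrightarrow> f u \<le> f y"
  shows "arg_min_on f A \<in> A" "\<And>y. y \<in> A \<Longrightarrow> f (arg_min_on f A) \<le> f y"
proof -
  have "is_arg_min f (\<lambda>x. x \<in> A) u" using assms by (auto simp: is_arg_min_linorder)
  then have "is_arg_min f (\<lambda>x. x \<in> A) (arg_min_on f A)"
    unfolding arg_min_on_def arg_min_def by (rule someI)
  then show "arg_min_on f A \<in> A" "\<And>y. y \<in> A \<Longrightarrow> f (arg_min_on f A) \<le> f y"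
    by (auto simp: is_arg_min_linorder)
qed

text \<open>
  The properties of the subdifferential on which the optimal scale depends: a bounded convex set
  on which a linear form \<open>\<psi>\<close> has the constant value one.
\<close>

locale normalised_convex_set =
  fixes n :: nat and S :: "(nat \<Rightarrow> real) set" and R :: real and \<psi> :: "nat \<Rightarrow> real"
  assumes S_convex: "convex S" and S_nonempty: "S \<noteq> {}" and S_subset: "S \<subseteq> Rn n"
    and S_bounded: "v \<in> S \<Longrightarrow> enorm n v \<le> R"
    and S_normalised: "v \<in> S \<Longrightarrow> ip n v \<psi> = 1"
begin

lemma R_nonneg: "0 \<le> R"
  using S_nonempty S_bounded enorm_nonneg order_trans by blast

lemma psi_pos: "0 < enorm n \<psi>"
proof -
  obtain v where "v \<in> S" using S_nonempty by blast
  then have "1 \<le> enorm n v * enorm n \<psi>" using S_normalised[of v] abs_ip_le[of n v \<psi>] by simp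
  then show ?thesis using enorm_nonneg[of n \<psi>] by (cases "enorm n \<psi> = 0") auto
qed

text \<open>
  The form \<open>\<psi>\<close> is still equal to one on the affine hull, so no element there is shorter than the
  inverse of the norm of \<open>\<psi>\<close>.
\<close>

lemma min_norm_affine_hull:
  "1 / enorm n (arg_min_on (enorm n) (affine hull S)) \<le> enorm n \<psi>"
proof -
  have "affine (Rn n)" unfolding affine_def Rn_def by (auto simp: scaleR_fun_def)
  then have sub: "affine hull S \<subseteq> Rn n" using S_subset by (rule hull_minimal[rotated])
  have "affine {v. ip n v \<psi> = 1}" unfolding affine_def by (auto simp: ip_simps)
  then have norm: "affine hull S \<subseteq> {v. ip n v \<psi> = 1}"
    using S_normalised by (intro hull_minimal) auto
  obtain a where "a \<in> affine hull S" using S_nonempty hull_inc by (metis ex_in_conv)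
  then obtain u where u: "u \<in> affine hull S" "\<And>y. y \<in> affine hull S \<Longrightarrow> enorm n u \<le> enorm n y"
    using affine_has_min_norm[OF affine_affine_hull sub] by blast
  have "arg_min_on (enorm n) (affine hull S) \<in> affine hull S" by (rule arg_min_on_attained(1)[of u _ "enorm n", OF u])
  then have "ip n (arg_min_on (enorm n) (affine hull S)) \<psi> = 1" using norm by blast
  then have *: "1 \<le> enorm n (arg_min_on (enorm n) (affine hull S)) * enorm n \<psi>"
    using abs_ip_le by (metis abs_one)
  then have "0 < enorm n (arg_min_on (enorm n) (affine hull S))"
    using enorm_nonneg[of n "arg_min_on (enorm n) (affine hull S)"]
    by (cases "enorm n (arg_min_on (enorm n) (affine hull S)) = 0") auto
  with * show ?thesis by (simp add: divide_le_eq mult.commute)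
qed

definition ray_dist :: "(nat \<Rightarrow> real) \<Rightarrow> real \<Rightarrow> real" where
  "ray_dist z l = (INF v\<in>S. enorm n (z - l *\<^sub>R v))"

lemma ray_dist_le: "v \<in> S \<Longrightarrow> ray_dist z l \<le> enorm n (z - l *\<^sub>R v)"
  unfolding ray_dist_def by (rule cINF_lower) (auto intro!: bdd_belowI2[where m = 0] enorm_nonneg)

lemma ray_dist_ge: "(\<And>v. v \<in> S \<Longrightarrow> m \<le> enorm n (z - l *\<^sub>R v)) \<Longrightarrow> m \<le> ray_dist z l"
  unfolding ray_dist_def by (rule cINF_greatest[OF S_nonempty])

lemma ray_dist_lipschitz: "R-lipschitz_on UNIV (ray_dist z)"
proof -
  have *: "ray_dist z l - R * \<bar>l - l'\<bar> \<le> ray_dist z l'" for l l'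
  proof (rule ray_dist_ge)
    fix v assume v: "v \<in> S"
    define y where "y = z - l' *\<^sub>R v"
    have "z - l *\<^sub>R v = y + (l' - l) *\<^sub>R v"
      by (simp add: y_def fun_eq_iff scaleR_fun_def algebra_simps)
    then have "enorm n (z - l *\<^sub>R v) \<le> enorm n y + \<bar>l' - l\<bar> * enorm n v"
      using enorm_add[of n y "(l' - l) *\<^sub>R v"] by (simp only: enorm_scaleR)
    moreover have "\<bar>l' - l\<bar> * enorm n v \<le> R * \<bar>l - l'\<bar>"
      using mult_left_mono[OF S_bounded[OF v], of "\<bar>l' - l\<bar>"]
      by (simp add: abs_minus_commute mult.commute)
    ultimately show "ray_dist z l - R * \<bar>l - l'\<bar> \<le> enorm n (z - l' *\<^sub>R v)"
      using ray_dist_le[OF v, of z l] unfolding y_def by linarith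
  qed
  show ?thesis
  proof (rule lipschitz_onI)
    fix l l' :: real
    show "dist (ray_dist z l) (ray_dist z l') \<le> R * dist l l'"
      using *[of l l'] *[of l' l] unfolding dist_real_def abs_minus_commute[of l' l] by linarith
  qed (rule R_nonneg)
qed

lemma ray_dist_coercive: "(l - \<bar>ip n z \<psi>\<bar>) / enorm n \<psi> \<le> ray_dist z l"
proof (rule ray_dist_ge)
  fix v assume "v \<in> S"
  then have "ip n (z - l *\<^sub>R v) \<psi> = ip n z \<psi> - l" by (simp add: ip_simps S_normalised)
  then have "l - \<bar>ip n z \<psi>\<bar> \<le> enorm n (z - l *\<^sub>R v) * enorm n \<psi>"
    using abs_ip_le[of n "z - l *\<^sub>R v" \<psi>] by linarith
  then show "(l - \<bar>ip n z \<psi>\<bar>) / enorm n \<psi> \<le> enorm n (z - l *\<^sub>R v)"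
    using psi_pos by (simp add: pos_divide_le_eq)
qed

definition opt_scale :: "(nat \<Rightarrow> real) \<Rightarrow> real" where
  "opt_scale z = arg_min_on (ray_dist z) {0..}"

text \<open>
  The distance is Lipschitz continuous in the scale, and testing with \<open>\<psi>\<close> shows that it tends to
  infinity. Hence the minimum over the half-line is the minimum over a compact interval.
\<close>

lemma opt_scale:
  shows "0 \<le> opt_scale z" "0 \<le> l \<Longrightarrow> ray_dist z (opt_scale z) \<le> ray_dist z l"
proof -
  define b where "b = \<bar>ray_dist z 0\<bar> * enorm n \<psi> + \<bar>ip n z \<psi>\<bar>"
  have "0 \<le> b" unfolding b_def using enorm_nonneg[of n \<psi>] by simp
  have "continuous_on {0..b} (ray_dist z)"
    using lipschitz_on_continuous_on[OF ray_dist_lipschitz] continuous_on_subset by blast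
  then obtain u where u: "u \<in> {0..b}" "\<And>y. y \<in> {0..b} \<Longrightarrow> ray_dist z u \<le> ray_dist z y"
    using continuous_attains_inf[of "{0..b}" "ray_dist z"] \<open>0 \<le> b\<close> by auto
  have min: "ray_dist z u \<le> ray_dist z y" if "y \<in> {0..}" for y
  proof (cases "y \<le> b")
    case False
    have "ray_dist z u \<le> ray_dist z 0" using u(2) \<open>0 \<le> b\<close> by simp
    also have "\<dots> \<le> (b - \<bar>ip n z \<psi>\<bar>) / enorm n \<psi>" using psi_pos by (simp add: b_def)
    also have "\<dots> \<le> (y - \<bar>ip n z \<psi>\<bar>) / enorm n \<psi>"
      using False psi_pos by (intro divide_right_mono) auto
    also have "\<dots> \<le> ray_dist z y" by (rule ray_dist_coercive)
    finally show ?thesis .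
  qed (use that u in auto)
  have "u \<in> {0..}" using u by simp
  note * = arg_min_on_attained[of u "{0..}" "ray_dist z", OF this min]
  show "0 \<le> opt_scale z" "0 \<le> l \<Longrightarrow> ray_dist z (opt_scale z) \<le> ray_dist z l"
    using * unfolding opt_scale_def by auto
qed

text \<open>
  At a closest point of the cone over \<open>S\<close> the residual has nonpositive inner product with \<open>S\<close> and
  is orthogonal to the closest point. The infimum over \<open>S\<close> always has nearly optimal \<open>v\<close>, and
  these satisfy both relations up to \<open>\<eta>\<close>.
\<close>

lemma approximate_optimality:
  assumes "0 < \<eta>"
  obtains v where "v \<in> S" "\<And>w. w \<in> S \<Longrightarrow> ip n (z - opt_scale z *\<^sub>R v) w \<le> \<eta>"
    "(enorm n (z - opt_scale z *\<^sub>R v))\<^sup>2 \<le> ip n z (z - opt_scale z *\<^sub>R v) + \<eta>"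
proof -
  define l where "l = opt_scale z"
  define F where "F = ray_dist z l"
  have l: "0 \<le> l" unfolding l_def by (rule opt_scale)
  have F: "0 \<le> F" unfolding F_def by (rule ray_dist_ge) (rule enorm_nonneg)
  \<comment> \<open>Perturbations of size \<open>t\<close> change the squared distance to first order in \<open>t\<close>; allowing a defect of \<open>t\<^sup>2\<close> leaves an error of order \<open>t\<close> in the derivative.\<close>
  define D where "D = R\<^sup>2 + l\<^sup>2 * R\<^sup>2 + 1"
  define t where "t = min 1 (\<eta> / D)"
  have D: "0 < D" unfolding D_def by (intro add_nonneg_pos) auto
  have "t \<le> \<eta> / D" unfolding t_def by simp
  then have "t * D \<le> \<eta>" using D by (simp add: pos_le_divide_eq)
  then have t: "0 < t" "t \<le> 1" "t * (R\<^sup>2 + l\<^sup>2 * R\<^sup>2 + 1) \<le> \<eta>"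
    using assms D unfolding D_def[symmetric] by (auto simp: t_def)
  define d where "d = t\<^sup>2 / (2 * F + 1)"
  have d: "0 < d" "d \<le> 1" "d * (2 * F + 1) = t\<^sup>2"
  proof -
    show "0 < d" "d * (2 * F + 1) = t\<^sup>2" unfolding d_def using F t by auto
    have "t\<^sup>2 \<le> 1" using t by (intro power_le_one) auto
    then show "d \<le> 1" unfolding d_def using F by (simp add: divide_le_eq)
  qed
  obtain v where v: "v \<in> S" "enorm n (z - l *\<^sub>R v) < F + d"
  proof -
    have "Inf ((\<lambda>v. enorm n (z - l *\<^sub>R v)) ` S) < F + d"
      using d(1) unfolding F_def ray_dist_def by simp
    from cInf_lessD[OF _ this] show ?thesis using S_nonempty that by auto
  qed
  define x where "x = z - l *\<^sub>R v"
  have min: "ip n x x \<le> ip n (z - l' *\<^sub>R w) (z - l' *\<^sub>R w) + t\<^sup>2" if "0 \<le> l'" "w \<in> S" for l' w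
  proof -
    have "F \<le> enorm n (z - l' *\<^sub>R w)"
      unfolding F_def l_def using opt_scale(2)[OF that(1)] ray_dist_le[OF that(2)] by (rule order_trans)
    then have "F\<^sup>2 \<le> ip n (z - l' *\<^sub>R w) (z - l' *\<^sub>R w)"
      unfolding enorm_square[symmetric] using F by (rule power_mono)
    moreover have "ip n x x \<le> (F + d)\<^sup>2"
      unfolding enorm_square[symmetric] x_def using v(2) by (intro power_mono enorm_nonneg) auto
    moreover have "(F + d)\<^sup>2 \<le> F\<^sup>2 + t\<^sup>2"
    proof -
      have "d * d \<le> d * 1" using d by (intro mult_left_mono) auto
      then show ?thesis unfolding d(3)[symmetric] by (simp add: power2_eq_square algebra_simps)
    qed
    ultimately show ?thesis by linarith
  qed
  have sq: "ip n w w \<le> R\<^sup>2" if "w \<in> S" for w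
    unfolding enorm_square[symmetric] by (intro power_mono S_bounded that enorm_nonneg)
  have first: "ip n x w \<le> \<eta>" if w: "w \<in> S" for w
  proof -
    \<comment> \<open>The cone over \<open>S\<close> contains \<open>l *\<^sub>R v + t *\<^sub>R w\<close>.\<close>
    define w' where "w' = (l / (l + t)) *\<^sub>R v + (t / (l + t)) *\<^sub>R w"
    have "w' \<in> S"
      unfolding w'_def using S_convex v(1) w l t by (intro convexD) (auto simp: add_divide_distrib[symmetric])
    have "z - (l + t) *\<^sub>R w' = x - t *\<^sub>R w"
    proof -
      have "(l + t) * (l / (l + t)) = l" "(l + t) * (t / (l + t)) = t" using l t by auto
      then show ?thesis unfolding w'_def x_def scaleR_add_right scaleR_scaleR by (simp add: algebra_simps)
    qed
    then have "ip n x x \<le> ip n (x - t *\<^sub>R w) (x - t *\<^sub>R w) + t\<^sup>2"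
      using min[of "l + t" w'] \<open>w' \<in> S\<close> l t by simp
    then have "2 * t * ip n x w \<le> t\<^sup>2 * ip n w w + t\<^sup>2"
      by (simp add: ip_simps ip_commute[of n w x] power2_eq_square algebra_simps)
    also have "\<dots> \<le> t\<^sup>2 * R\<^sup>2 + t\<^sup>2" using sq[OF w] by (simp add: mult_left_mono)
    finally have "t * (2 * ip n x w) \<le> t * (t * (R\<^sup>2 + 1))" by (simp add: power2_eq_square algebra_simps)
    then have "2 * ip n x w \<le> t * (R\<^sup>2 + 1)" using t by simp
    also have "\<dots> \<le> t * (R\<^sup>2 + l\<^sup>2 * R\<^sup>2 + 1)" using t by (intro mult_left_mono) auto
    finally show ?thesis using t(3) assms by linarith
  qed
  have second: "ip n x x \<le> ip n z x + \<eta>"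
  proof -
    have "z - ((1 - t) * l) *\<^sub>R v = x + (t * l) *\<^sub>R v"
      unfolding x_def by (simp add: fun_eq_iff scaleR_fun_def algebra_simps)
    then have "ip n x x \<le> ip n (x + (t * l) *\<^sub>R v) (x + (t * l) *\<^sub>R v) + t\<^sup>2"
      using min[of "(1 - t) * l" v] v(1) l t by simp
    then have "t * (- (2 * l * ip n x v)) \<le> t * (t * (l\<^sup>2 * ip n v v) + t)"
      by (simp add: ip_simps ip_commute[of n v x] power2_eq_square algebra_simps)
    then have "- (2 * l * ip n x v) \<le> t * (l\<^sup>2 * ip n v v) + t"
      by (rule mult_left_le_imp_le) (rule t(1))
    also have "\<dots> \<le> t * (l\<^sup>2 * R\<^sup>2) + t" using sq[OF v(1)] t by (simp add: mult_left_mono)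
    also have "\<dots> \<le> t * (R\<^sup>2 + l\<^sup>2 * R\<^sup>2 + 1)" using t by (simp add: algebra_simps)
    finally have "- (l * ip n x v) \<le> \<eta>" using t(3) assms by linarith
    moreover have "ip n x x = ip n z x - l * ip n x v"
      using ip_commute[of n v x] by (subst (1) x_def) (simp add: ip_simps)
    ultimately show ?thesis by linarith
  qed
  show ?thesis
    by (rule that[of v]) (use v(1) first second in \<open>auto simp: x_def l_def enorm_square\<close>)
qed

end

section \<open>Subgradients of the total variation\<close>

lemma fd_funpow_cong:
  "(\<And>j. j \<in> {t..t + q} \<Longrightarrow> x j = y j) \<Longrightarrow> (fd ^^ q) x t = (fd ^^ q) y t"
  by (induction q arbitrary: t) (auto simp: fd_def)

lemma fd_funpow_sum:
  "(fd ^^ q) (\<lambda>j. \<Sum>i\<in>A. c i * f i j) t = (\<Sum>i\<in>A. c i * (fd ^^ q) (f i) t)"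
  by (induction q arbitrary: t) (simp_all add: fd_def sum_subtractf right_diff_distrib)

lemma fd_funpow_add: "(fd ^^ q) (\<lambda>j. x j + y j) t = (fd ^^ q) x t + (fd ^^ q) y t"
  by (induction q arbitrary: t) (simp_all add: fd_def)

text \<open>
  The transpose of the difference operator of order \<open>r\<close> from \<open>n\<close> to \<open>n - r\<close> coordinates, applied
  to \<open>u\<close>.
\<close>

definition adj :: "nat \<Rightarrow> nat \<Rightarrow> (nat \<Rightarrow> real) \<Rightarrow> nat \<Rightarrow> real" where
  "adj n r u i = (if i \<in> {1..n}
     then \<Sum>t\<in>{1..n - r}. u t * (fd ^^ r) (\<lambda>j. if j = i then 1 else 0) t else 0)"

lemma ip_adj:
  assumes "r \<le> n"
  shows "ip n (adj n r u) x = (\<Sum>t\<in>{1..n - r}. u t * (fd ^^ r) x t)"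
proof -
  have "ip n (adj n r u) x
      = (\<Sum>i\<in>{1..n}. \<Sum>t\<in>{1..n - r}. u t * (x i * (fd ^^ r) (\<lambda>j. if j = i then 1 else 0) t))"
    unfolding ip_def adj_def by (intro sum.cong refl) (simp add: sum_distrib_left mult_ac)
  also have "\<dots> = (\<Sum>t\<in>{1..n - r}. u t * (\<Sum>i\<in>{1..n}. x i * (fd ^^ r) (\<lambda>j. if j = i then 1 else 0) t))"
    by (subst sum.swap) (simp add: sum_distrib_left)
  also have "\<dots> = (\<Sum>t\<in>{1..n - r}. u t * (fd ^^ r) x t)"
  proof (intro sum.cong refl arg_cong2[where f = "(*)"])
    fix t assume t: "t \<in> {1..n - r}"
    show "(\<Sum>i\<in>{1..n}. x i * (fd ^^ r) (\<lambda>j. if j = i then 1 else 0) t) = (fd ^^ r) x t"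
      unfolding fd_funpow_sum[symmetric]
      by (rule fd_funpow_cong) (use t assms in \<open>auto simp: if_distrib cong: if_cong\<close>)
  qed
  finally show ?thesis .
qed

lemma tv_eq: "tv n r x = (\<Sum>t\<in>{1..n - r}. \<bar>(fd ^^ r) x t\<bar>)"
  unfolding tv_def by (intro sum.cong refl) (simp add: Diff_eq_fd)

lemma subdifferential_ip:
  "subdifferential n f \<theta> = {v \<in> Rn n. \<forall>x\<in>Rn n. f \<theta> + ip n v (x - \<theta>) \<le> f x}"
  by (simp add: subdifferential_def ip_def)

lemma adj_in_subdifferential:
  assumes "r \<le> n"
    and u: "\<And>t. t \<in> {1..n - r} \<Longrightarrow> \<bar>u t\<bar> \<le> 1"
      "\<And>t. t \<in> {1..n - r} \<Longrightarrow> u t * (fd ^^ r) \<theta> t = \<bar>(fd ^^ r) \<theta> t\<bar>"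
  shows "adj n r u \<in> subdifferential n (tv n r) \<theta>"
proof -
  have "tv n r \<theta> + ip n (adj n r u) (x - \<theta>) \<le> tv n r x" for x
  proof -
    have "ip n (adj n r u) \<theta> = tv n r \<theta>"
      unfolding ip_adj[OF assms(1)] tv_eq by (intro sum.cong refl u)
    moreover have "ip n (adj n r u) x \<le> tv n r x"
      unfolding ip_adj[OF assms(1)] tv_eq
    proof (rule sum_mono)
      fix t assume "t \<in> {1..n - r}"
      then have "\<bar>u t * (fd ^^ r) x t\<bar> \<le> \<bar>(fd ^^ r) x t\<bar>"
        unfolding abs_mult using u(1) by (intro mult_left_le_one_le) auto
      then show "u t * (fd ^^ r) x t \<le> \<bar>(fd ^^ r) x t\<bar>" by linarith
    qed
    ultimately show ?thesis by (simp only: ip_diff_right)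
  qed
  moreover have "adj n r u \<in> Rn n" by (simp add: Rn_def adj_def)
  ultimately show ?thesis unfolding subdifferential_ip by blast
qed

lemma subdifferential_convex: "convex (subdifferential n f \<theta>)"
proof (rule convexI)
  fix v w a b assume vw: "v \<in> subdifferential n f \<theta>" "w \<in> subdifferential n f \<theta>"
    and ab: "0 \<le> a" "0 \<le> b" "a + b = (1 :: real)"
  have "f \<theta> + ip n (a *\<^sub>R v + b *\<^sub>R w) (x - \<theta>) \<le> f x" if "x \<in> Rn n" for x
  proof -
    have "f \<theta> + ip n v (x - \<theta>) \<le> f x" "f \<theta> + ip n w (x - \<theta>) \<le> f x"
      using vw that unfolding subdifferential_ip by auto
    then have "a * (f \<theta> + ip n v (x - \<theta>)) + b * (f \<theta> + ip n w (x - \<theta>)) \<le> a * f x + b * f x"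
      using ab by (intro add_mono mult_left_mono) auto
    moreover have "a * (f \<theta> + ip n v (x - \<theta>)) + b * (f \<theta> + ip n w (x - \<theta>))
        = (a + b) * f \<theta> + ip n (a *\<^sub>R v + b *\<^sub>R w) (x - \<theta>)"
      by (simp add: ip_add_left ip_scaleR_left algebra_simps)
    moreover have "a * f x + b * f x = (a + b) * f x" by (simp add: algebra_simps)
    ultimately show ?thesis unfolding ab(3) by simp
  qed
  moreover have "a *\<^sub>R v + b *\<^sub>R w \<in> Rn n"
    using vw unfolding subdifferential_ip Rn_def by (auto simp: scaleR_fun_def)
  ultimately show "a *\<^sub>R v + b *\<^sub>R w \<in> subdifferential n f \<theta>" unfolding subdifferential_ip by blast
qed

lemma fd_eq_gap_diff: "fd = gap_diff 1"
  by (simp add: fun_eq_iff fd_def gap_diff_def)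

lemma tv_le_enorm:
  assumes "r \<le> n"
  shows "tv n r x \<le> 2 ^ r * sqrt n * enorm n x"
proof -
  have I: "{1..m} = {0<..0 + m}" for m :: nat by auto
  have "tv n r x \<le> 2 ^ r * (\<Sum>i\<in>{0<..0 + (n - r) + r * 1}. \<bar>x i\<bar>)"
    unfolding tv_eq fd_eq_gap_diff I by (rule sum_gap_diff_funpow_le)
  also have "(\<Sum>i\<in>{0<..0 + (n - r) + r * 1}. \<bar>x i\<bar>) = l1 x 0 n"
    using assms by (simp add: l1_def)
  also have "l1 x 0 n \<le> sqrt n * enorm n x"
    unfolding enorm_eq_l2 by (rule l1_le_l2) auto
  finally show ?thesis by simp
qed

lemma tv_add: "tv n r (x + y) \<le> tv n r x + tv n r y"
  unfolding tv_eq sum.distrib[symmetric] plus_fun_def fd_funpow_add by (intro sum_mono) (rule abs_triangle_ineq)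

text \<open>
  Testing the subgradient inequality at \<open>\<theta> + v\<close> bounds the squared norm of \<open>v\<close> by the total
  variation of \<open>v\<close>, which is linear in the norm.
\<close>

lemma subgradient_bounded:
  assumes "v \<in> subdifferential n (tv n r) \<theta>" "\<theta> \<in> Rn n" "r \<le> n"
  shows "enorm n v \<le> 2 ^ r * sqrt n"
proof -
  have v: "v \<in> Rn n" using assms(1) by (simp add: subdifferential_ip)
  then have "\<theta> + v \<in> Rn n" using assms(2) by (simp add: Rn_def)
  then have "tv n r \<theta> + ip n v (\<theta> + v - \<theta>) \<le> tv n r (\<theta> + v)"
    using assms(1) unfolding subdifferential_ip by blast
  then have "(enorm n v)\<^sup>2 \<le> tv n r v" using tv_add[of n r \<theta> v] by (simp add: enorm_square)
  also have "\<dots> \<le> 2 ^ r * sqrt n * enorm n v" by (rule tv_le_enorm[OF assms(3)])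
  finally have "enorm n v * enorm n v \<le> (2 ^ r * sqrt n) * enorm n v" by (simp add: power2_eq_square)
  then show ?thesis using enorm_nonneg[of n v]
    by (cases "enorm n v = 0") (auto dest: mult_right_le_imp_le)
qed

text \<open>
  Along \<open>\<psi>\<close> the total variation is affine near \<open>\<theta>\<close> with slope one, in both directions, so every
  subgradient has this slope.
\<close>

lemma subgradient_spike:
  assumes v: "v \<in> subdifferential n (tv n r) \<theta>" and \<theta>: "\<theta> \<in> Rn n" and \<psi>: "\<psi> \<in> Rn n"
    and J: "J \<in> {1..n - r}" "(fd ^^ r) \<theta> J \<noteq> 0"
    and D: "\<And>t. t \<in> {1..n - r} \<Longrightarrow> (fd ^^ r) \<psi> t = (if t = J then sgn ((fd ^^ r) \<theta> J) else 0)"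
  shows "ip n v \<psi> = 1"
proof -
  define d where "d = (fd ^^ r) \<theta> J"
  have le: "c * ip n v \<psi> \<le> c" if c: "\<bar>c\<bar> \<le> \<bar>d\<bar>" for c
  proof -
    have "\<theta> + c *\<^sub>R \<psi> \<in> Rn n" using \<theta> \<psi> by (simp add: Rn_def scaleR_fun_def)
    then have "tv n r \<theta> + ip n v (\<theta> + c *\<^sub>R \<psi> - \<theta>) \<le> tv n r (\<theta> + c *\<^sub>R \<psi>)"
      using v unfolding subdifferential_ip by blast
    then have "tv n r \<theta> + c * ip n v \<psi> \<le> tv n r (\<theta> + c *\<^sub>R \<psi>)" by (simp add: ip_simps)
    also have "tv n r (\<theta> + c *\<^sub>R \<psi>) = (\<Sum>t\<in>{1..n - r}. \<bar>(fd ^^ r) \<theta> t\<bar> + (if t = J then c else 0))"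
      unfolding tv_eq
    proof (rule sum.cong[OF refl])
      fix t assume t: "t \<in> {1..n - r}"
      have "(fd ^^ r) (\<theta> + c *\<^sub>R \<psi>) t = (fd ^^ r) \<theta> t + c * (fd ^^ r) \<psi> t"
        by (simp add: plus_fun_def scaleR_fun_def fd_funpow_add fd_funpow_cmult)
      moreover have "\<bar>d + c * sgn d\<bar> = \<bar>d\<bar> + c"
        using c J(2) unfolding d_def[symmetric] by (cases "d > 0") (auto simp: abs_if)
      ultimately show "\<bar>(fd ^^ r) (\<theta> + c *\<^sub>R \<psi>) t\<bar> = \<bar>(fd ^^ r) \<theta> t\<bar> + (if t = J then c else 0)"
        using D[OF t] unfolding d_def by auto
    qed
    also have "\<dots> = tv n r \<theta> + c" unfolding tv_eq using J(1) by (simp add: sum.distrib)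
    finally show ?thesis by simp
  qed
  have "\<bar>d\<bar> > 0" using J(2) by (simp add: d_def)
  moreover have "\<bar>d\<bar> * ip n v \<psi> \<le> \<bar>d\<bar> * 1" "- \<bar>d\<bar> * ip n v \<psi> \<le> - \<bar>d\<bar>"
    using le[of "\<bar>d\<bar>"] le[of "- \<bar>d\<bar>"] by auto
  ultimately have "ip n v \<psi> \<le> 1" "1 \<le> ip n v \<psi>" by (auto simp: mult_le_cancel_left)
  then show ?thesis by simp
qed

text \<open>
  Repeated summation from the right of a unit mass at \<open>J\<close>: a reversed truncated power function,
  of degree \<open>p - 1\<close>, that vanishes beyond \<open>J\<close>. Each summation adds at most \<open>J\<close> terms.
\<close>

lemma exists_spike:
  assumes "1 \<le> p"
  shows "\<exists>\<phi>. (\<forall>t\<ge>1. (fd ^^ p) \<phi> t = (if t = J then 1 else 0)) \<and>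
    (\<forall>t. t \<notin> {1..J} \<longrightarrow> \<phi> t = 0) \<and> (\<forall>t. \<bar>\<phi> t\<bar> \<le> real J ^ (p - 1))"
  using assms
proof (induction p rule: dec_induct)
  case base
  show ?case
    by (intro exI[of _ "\<lambda>t. if t \<in> {1..J} then - 1 else 0"]) (auto simp: fd_def)
next
  case (step p)
  then obtain \<phi> where \<phi>: "\<And>t. t \<ge> 1 \<Longrightarrow> (fd ^^ p) \<phi> t = (if t = J then 1 else 0)"
    "\<And>t. t \<notin> {1..J} \<Longrightarrow> \<phi> t = 0" "\<And>t. \<bar>\<phi> t\<bar> \<le> real J ^ (p - 1)"
    by blast
  define \<zeta> where "\<zeta> t = (if t = 0 then 0 else - (\<Sum>i\<in>{t..J}. \<phi> i))" for t
  have fd: "fd \<zeta> t = \<phi> t" if "t \<ge> 1" for t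
  proof (cases "t \<le> J")
    case True
    then have "{t..J} = insert t {Suc t..J}" by auto
    then show ?thesis using that by (simp add: fd_def \<zeta>_def)
  qed (use that \<phi>(2) in \<open>auto simp: fd_def \<zeta>_def\<close>)
  have "(fd ^^ Suc p) \<zeta> t = (if t = J then 1 else 0)" if "t \<ge> 1" for t
  proof -
    have "(fd ^^ Suc p) \<zeta> t = (fd ^^ p) (fd \<zeta>) t" by (simp add: funpow_swap1)
    also have "\<dots> = (fd ^^ p) \<phi> t" by (rule fd_funpow_cong) (use fd that in auto)
    finally show ?thesis using \<phi>(1)[OF that] by simp
  qed
  moreover have "\<zeta> t = 0" if "t \<notin> {1..J}" for t
    using that by (auto simp: \<zeta>_def)
  moreover have "\<bar>\<zeta> t\<bar> \<le> real J ^ (Suc p - 1)" for t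
  proof (cases "t = 0")
    case False
    then have "\<bar>\<zeta> t\<bar> \<le> (\<Sum>i\<in>{t..J}. \<bar>\<phi> i\<bar>)" by (simp add: \<zeta>_def)
    also have "\<dots> \<le> (\<Sum>i\<in>{t..J}. real J ^ (p - 1))" by (intro sum_mono \<phi>(3))
    also have "\<dots> \<le> (\<Sum>i\<in>{1..J}. real J ^ (p - 1))"
      by (intro sum_mono2) (use False in auto)
    also have "\<dots> = real J ^ (Suc p - 1)" using step.hyps by (simp flip: power_Suc)
    finally show ?thesis .
  qed (simp add: \<zeta>_def)
  ultimately show ?case by blast
qed

lemma enorm_spike_le:
  assumes "\<And>t. t \<notin> {1..J} \<Longrightarrow> \<psi> t = 0" "\<And>t. \<bar>\<psi> t\<bar> \<le> real J ^ (r - 1)" "J \<le> n"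
  shows "enorm n \<psi> \<le> half_pow r J"
proof -
  have "ip n \<psi> \<psi> = (\<Sum>t\<in>{1..J}. (\<psi> t)\<^sup>2)"
    unfolding ip_def power2_eq_square by (rule sum.mono_neutral_right) (use assms in auto)
  also have "\<dots> \<le> (\<Sum>t\<in>{1..J}. (real J ^ (r - 1))\<^sup>2)"
    by (intro sum_mono abs_le_square_iff[THEN iffD1]) (use assms(2) in auto)
  also have "\<dots> = (half_pow r J)\<^sup>2" by (simp add: half_pow_def power_mult_distrib)
  finally have "(enorm n \<psi>)\<^sup>2 \<le> (half_pow r J)\<^sup>2" by (simp add: enorm_square)
  then show ?thesis by (rule power2_le_imp_le) (simp add: half_pow_def)
qed

section \<open>The bound for a fixed signal\<close>

lemma le_of_square_le:
  fixes x a b :: real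
  assumes "0 \<le> a" "0 \<le> b" "x\<^sup>2 \<le> a * x + b"
  shows "x \<le> a + sqrt b"
proof (rule ccontr)
  assume "\<not> x \<le> a + sqrt b"
  then have x: "a + sqrt b < x" by simp
  have "0 \<le> sqrt b" using assms by simp
  then have "sqrt b \<le> x" using x assms(1) by linarith
  with \<open>0 \<le> sqrt b\<close> have "sqrt b * sqrt b \<le> sqrt b * x" by (rule mult_left_mono[rotated])
  moreover have "0 < x" using x \<open>0 \<le> sqrt b\<close> assms(1) by linarith
  moreover from this have "sqrt b * x < (x - a) * x"
    using x by (intro mult_strict_right_mono) auto
  ultimately have "sqrt b * sqrt b < (x - a) * x" by linarith
  then show False using assms(2,3) by (simp add: power2_eq_square algebra_simps)
qed

lemma sqrt_le_linear:
  fixes x q :: real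
  assumes "0 \<le> x" "0 < q"
  shows "sqrt x \<le> (x / q + q) / 2"
proof -
  have "2 * sqrt x * q \<le> x + q\<^sup>2"
    using sum_squares_bound[of "sqrt x" q] assms by simp
  then show ?thesis using assms by (simp add: field_simps power2_eq_square)
qed

text \<open>
  With \<open>2 ^ M \<approx> n / (k + 1)\<close> there are about \<open>M\<close> blocks for each separator and \<open>k + 1\<close> blocks
  of full size.
\<close>

lemma whitney_count_log:
  fixes n k M :: nat
  assumes "k + 1 \<le> n" "2 ^ M \<le> real n / real (k + 1)" "real n / real (k + 1) < 2 ^ Suc M"
  shows "real (15 * (k + 2) * M + n div 2 ^ M + 1)
    \<le> 64 * real (k + 1) * ln (exp 1 * real n / real (k + 1))"
proof -
  define y where "y = real n / real (k + 1)"
  have y: "1 \<le> y" unfolding y_def using assms(1) by (simp add: le_divide_eq)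
  have n: "real n = y * real (k + 1)" unfolding y_def by simp
  have "exp 1 * real n / real (k + 1) = exp 1 * y" by (simp add: y_def)
  then have ln: "ln (exp 1 * real n / real (k + 1)) = 1 + ln y" using y by (simp add: ln_mult)
  have ly: "0 \<le> ln y" using y by simp
  have "real M * ln 2 = ln (2 ^ M)" by (simp add: ln_realpow)
  also have "\<dots> \<le> ln y" using assms(2) y unfolding y_def[symmetric] by (intro ln_mono) auto
  finally have "real M * ln 2 \<le> ln y" .
  moreover have "real M * (1 / 2) \<le> real M * ln 2"
    using ln2_ge_two_thirds by (intro mult_left_mono) auto
  ultimately have M: "real M \<le> 2 * ln y" by linarith
  have "real (n div 2 ^ M) \<le> real n / 2 ^ M"
  proof -
    have "real (n div 2 ^ M * 2 ^ M) \<le> real n" by (simp only: of_nat_le_iff div_times_less_eq_dividend)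
    then show ?thesis by (simp add: le_divide_eq)
  qed
  also have "\<dots> \<le> 2 * real (k + 1)"
  proof -
    have "real n \<le> (2 * 2 ^ M) * real (k + 1)"
      unfolding n using assms(3) unfolding y_def[symmetric] by (intro mult_right_mono) auto
    then show ?thesis by (simp add: divide_le_eq algebra_simps)
  qed
  finally have d: "real (n div 2 ^ M) \<le> 2 * real (k + 1)" .
  have "15 * real (k + 2) * real M \<le> 15 * (2 * real (k + 1)) * (2 * ln y)"
    by (intro mult_mono M) (use ly in auto)
  also have "\<dots> = 60 * (real (k + 1) * ln y)" by simp
  finally have "15 * real (k + 2) * real M \<le> 60 * (real (k + 1) * ln y)" .
  moreover have "real (15 * (k + 2) * M + n div 2 ^ M + 1) = 15 * real (k + 2) * real M + real (n div 2 ^ M) + 1"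
    by simp
  ultimately have "real (15 * (k + 2) * M + n div 2 ^ M + 1)
      \<le> 60 * (real (k + 1) * ln y) + 2 * real (k + 1) + 1"
    using d by linarith
  also have "\<dots> \<le> 64 * real (k + 1) * (1 + ln y)"
  proof -
    have "0 \<le> real (k + 1) * ln y" using ly by simp
    then show ?thesis by (simp add: algebra_simps)
  qed
  finally show ?thesis unfolding ln .
qed

text \<open>
  A signal that satisfies the hypotheses of the theorem. Its knots \<open>j\<close> are shifted by one, so that
  \<open>e i\<close> is the index of the nonzero difference of order \<open>r\<close> at the knot \<open>i\<close>.
\<close>

locale trend_signal =
  fixes n r :: nat and \<theta> :: "nat \<Rightarrow> real" and c1 c2 :: real
  assumes r2: "2 \<le> r" and n_ge: "2 * r \<le> n" and \<theta>_in: "\<theta> \<in> Rn n"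
    and Diff_nz: "Diff n r \<theta> \<noteq> 0"
    and c1: "0 < c1" "c1 \<le> 1" and c2: "1 \<le> c2"
    and len: "length_condition n r c1 c2 \<theta>"
begin

abbreviation "k \<equiv> num_knots n r \<theta>"

definition e :: "nat \<Rightarrow> nat" where
  "e i = (if i = 0 then 0 else if i \<le> k then knot n r \<theta> i - 1 else n - r + 1)"

definition s :: "nat \<Rightarrow> real" where
  "s i = real_of_int (knot_sign n r \<theta> i)"

abbreviation "S \<equiv> subdifferential n (tv n r) \<theta>"

lemma finite_knots: "finite (knots n r \<theta>)" by (simp add: knots_def)

lemma fd_funpow_eq_Diff:
  assumes "t \<in> {1..n - r}"
  shows "(fd ^^ r) \<theta> t = Diff n (r - 1) \<theta> (Suc t) - Diff n (r - 1) \<theta> t"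
proof -
  obtain q where q: "r = Suc q" using r2 by (cases r) auto
  have "Diff n q \<theta> t = (fd ^^ q) \<theta> t" "Diff n q \<theta> (Suc t) = (fd ^^ q) \<theta> (Suc t)"
    by (rule Diff_eq_fd, use assms q in auto)+
  then show ?thesis by (simp add: q fd_def)
qed

lemma knots_iff:
  assumes "t \<in> {1..n - r}"
  shows "Suc t \<in> knots n r \<theta> \<longleftrightarrow> (fd ^^ r) \<theta> t \<noteq> 0"
proof -
  have "Suc t \<in> {2..n - r + 1}" using assms by auto
  then show ?thesis unfolding fd_funpow_eq_Diff[OF assms] knots_def by auto
qed

lemma sorted_knots:
  defines "L \<equiv> sorted_list_of_set (knots n r \<theta>)"
  shows "length L = k" "set L = knots n r \<theta>" "sorted_wrt (<) L"
  unfolding L_def num_knots_def using finite_knots by auto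

lemma knot_in:
  assumes "i \<in> {1..k}"
  shows "knot n r \<theta> i \<in> knots n r \<theta>"
proof -
  have "i - 1 < length (sorted_list_of_set (knots n r \<theta>))" unfolding sorted_knots(1) using assms by auto
  from nth_mem[OF this] show ?thesis unfolding knot_def sorted_knots(2) .
qed

lemma knot_less:
  assumes "i \<in> {1..k}" "j \<in> {1..k}" "i < j"
  shows "knot n r \<theta> i < knot n r \<theta> j"
proof -
  have "j - 1 < length (sorted_list_of_set (knots n r \<theta>))" "i - 1 < j - 1"
    unfolding sorted_knots(1) using assms by auto
  then show ?thesis
    unfolding knot_def by (intro sorted_wrt_nth_less[OF sorted_knots(3)])
qed

lemma knot_bounds: "i \<in> {1..k} \<Longrightarrow> 2 \<le> knot n r \<theta> i \<and> knot n r \<theta> i \<le> n - r + 1"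
  using knot_in[of i] by (auto simp: knots_def)

lemma knot_surj:
  assumes "j \<in> knots n r \<theta>"
  obtains i where "i \<in> {1..k}" "knot n r \<theta> i = j"
proof -
  have "j \<in> set (sorted_list_of_set (knots n r \<theta>))" unfolding sorted_knots(2) by fact
  then obtain m where m: "m < k" "sorted_list_of_set (knots n r \<theta>) ! m = j"
    unfolding in_set_conv_nth sorted_knots(1) by blast
  show ?thesis by (rule that[of "Suc m"]) (use m in \<open>auto simp: knot_def\<close>)
qed

lemma k_pos: "1 \<le> k"
proof -
  obtain t where t: "Diff n r \<theta> t \<noteq> 0" using Diff_nz by (auto simp: fun_eq_iff)
  have "t \<in> {1..n - r}"
  proof (rule ccontr)
    assume "t \<notin> {1..n - r}"
    then have "t \<notin> {1..<n - (r - 1)}" using r2 by auto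
    then have "Diff n r \<theta> t = 0" using r2 by (cases r) (auto simp: diff1_def)
    then show False using t by simp
  qed
  then have "Suc t \<in> knots n r \<theta>" using t knots_iff Diff_eq_fd by simp
  then have "knots n r \<theta> \<noteq> {}" by blast
  then show ?thesis using finite_knots by (simp add: num_knots_def Suc_le_eq card_gt_0_iff)
qed

lemma e_knot: "i \<in> {1..k} \<Longrightarrow> e i \<in> {1..n - r} \<and> Suc (e i) = knot n r \<theta> i"
  using knot_bounds[of i] by (auto simp: e_def)

lemma knot_nonzero: "i \<in> {1..k} \<Longrightarrow> (fd ^^ r) \<theta> (e i) \<noteq> 0"
  using knot_in[of i] knots_iff[of "e i"] e_knot[of i] by metis

lemma s_eq_sgn: "i \<in> {1..k} \<Longrightarrow> s i = sgn ((fd ^^ r) \<theta> (e i))"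
proof -
  assume i: "i \<in> {1..k}"
  note ei = e_knot[OF i]
  have nz: "(fd ^^ r) \<theta> (e i) \<noteq> 0" by (rule knot_nonzero[OF i])
  have "(fd ^^ r) \<theta> (e i) = Diff n (r - 1) \<theta> (Suc (e i)) - Diff n (r - 1) \<theta> (e i)"
    using ei by (intro fd_funpow_eq_Diff) auto
  moreover have "knot n r \<theta> i - 1 = e i" "knot n r \<theta> i = Suc (e i)" using ei by auto
  ultimately show ?thesis
    using nz i unfolding s_def knot_sign_def by (auto simp: Let_def sgn_if)
qed

lemma segment_cases:
  assumes "i \<le> k"
  obtains "i = 0" | "i \<in> {1..<k}" | "i \<in> {1..k}" "i = k"
  using assms k_pos by (cases "i = 0"; cases "i = k") auto

sublocale knot_structure n r k e s
proof
  show "2 \<le> r" "r \<le> n" using r2 n_ge by auto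
  show "e 0 = 0" "e (Suc k) = n - r + 1" by (auto simp: e_def)
  show "s 0 = 0" "s (Suc k) = 0" by (auto simp: s_def knot_sign_def)
  show "\<bar>s i\<bar> \<le> 1" for i by (auto simp: s_def knot_sign_def Let_def)
  show "e i < e (Suc i)" if "i \<le> k" for i
  proof -
    from that show ?thesis
    proof (cases rule: segment_cases)
      case 1
      then show ?thesis using e_knot[of 1] k_pos by (auto simp: e_def[of 0])
    next
      case 2
      then show ?thesis using knot_less[of i "Suc i"] e_knot[of i] e_knot[of "Suc i"] by auto
    next
      case 3
      moreover have "e (Suc k) = n - r + 1" by (simp add: e_def)
      ultimately show ?thesis using e_knot[of k] by auto
    qed
  qed
qed

lemma piece_length_le_seg_len:
  assumes "i \<le> k"
  shows "piece_length n r \<theta> i \<le> seg_len i"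
  using assms
proof (cases rule: segment_cases)
    case 1
    then show ?thesis using e_knot[of 1] k_pos r2 by (auto simp: piece_length_def seg_len_def e_0)
  next
    case 2
    then show ?thesis using knot_less[of i "Suc i"] e_knot[of i] e_knot[of "Suc i"] r2
      by (auto simp: piece_length_def seg_len_def)
  next
    case 3
    then show ?thesis using e_knot[of i] r2 n_ge by (auto simp: piece_length_def seg_len_def e_last)
qed

lemma sign_change_length:
  assumes "i \<le> k" "s i \<noteq> s (Suc i)"
  shows "c1 * (real n / real (k + 1)) \<le> seg_len i"
proof -
  have "i \<in> sign_change_pieces n r \<theta>" using assms by (auto simp: sign_change_pieces_def s_def)
  then have "Min (piece_length n r \<theta> ` sign_change_pieces n r \<theta>) \<le> piece_length n r \<theta> i"
    by (intro Min_le) (auto simp: sign_change_pieces_def)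
  also have "\<dots> \<le> seg_len i" using assms(1) by (rule piece_length_le_seg_len)
  finally have "real (Min (piece_length n r \<theta> ` sign_change_pieces n r \<theta>)) \<le> seg_len i" by simp
  then show ?thesis using len unfolding length_condition_def by (simp add: add.commute)
qed

lemma first_knot_le: "real (e 1) \<le> c2 * (real n / real (k + 1))"
proof -
  have "s 1 \<noteq> 0"
  proof -
    have "(fd ^^ r) \<theta> (e 1) \<noteq> 0" using knot_nonzero[of 1] k_pos by simp
    then show ?thesis using s_eq_sgn[of 1] k_pos by (simp add: sgn_if)
  qed
  then have "0 \<in> sign_change_pieces n r \<theta>"
    using s_0 by (auto simp: sign_change_pieces_def s_def)
  then have "piece_length n r \<theta> 0 \<le> Max (piece_length n r \<theta> ` sign_change_pieces n r \<theta>)"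
    by (intro Max_ge) (auto simp: sign_change_pieces_def)
  moreover have "e 1 \<le> piece_length n r \<theta> 0" using e_knot[of 1] k_pos r2 by (auto simp: piece_length_def)
  ultimately have "real (e 1) \<le> real (Max (piece_length n r \<theta> ` sign_change_pieces n r \<theta>))" by linarith
  then show ?thesis using len unfolding length_condition_def by (simp add: add.commute)
qed

text \<open>
  The subgradient that attains the directional derivative in direction \<open>x\<close>: the sign is prescribed
  at the knots and free elsewhere.
\<close>

definition best_sign :: "(nat \<Rightarrow> real) \<Rightarrow> nat \<Rightarrow> real" where
  "best_sign x t = (if (fd ^^ r) \<theta> t \<noteq> 0 then sgn ((fd ^^ r) \<theta> t) else sgn ((fd ^^ r) x t))"

lemma best_sign_adj: "adj n r (best_sign x) \<in> S"
  by (rule adj_in_subdifferential) (use r_le_n in \<open>auto simp: best_sign_def sgn_if\<close>)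

lemma ip_best_sign: "ip n x (adj n r (best_sign x)) = (\<Sum>i\<le>k. seg_term x i)"
proof -
  have "ip n x (adj n r (best_sign x)) = (\<Sum>t\<in>{1..n - r}. best_sign x t * (fd ^^ r) x t)"
    using ip_adj[OF r_le_n] by (simp add: ip_commute)
  also have "\<dots> = (\<Sum>i\<le>k. \<Sum>t\<in>{e i<..<e (Suc i)}. best_sign x t * (fd ^^ r) x t)
      + (\<Sum>i\<in>{1..k}. best_sign x (e i) * (fd ^^ r) x (e i))"
    by (rule sum_segments)
  also have "(\<Sum>i\<in>{1..k}. best_sign x (e i) * (fd ^^ r) x (e i)) = (\<Sum>i\<in>{1..k}. s i * (fd ^^ r) x (e i))"
  proof (rule sum.cong[OF refl])
    fix i assume i: "i \<in> {1..k}"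
    then have "(fd ^^ r) \<theta> (e i) \<noteq> 0" by (rule knot_nonzero)
    then show "best_sign x (e i) * (fd ^^ r) x (e i) = s i * (fd ^^ r) x (e i)"
      using s_eq_sgn[OF i] by (simp add: best_sign_def)
  qed
  also have "(\<Sum>i\<le>k. \<Sum>t\<in>{e i<..<e (Suc i)}. best_sign x t * (fd ^^ r) x t)
      = (\<Sum>i\<le>k. \<Sum>t\<in>{e i<..<e (Suc i)}. \<bar>(fd ^^ r) x t\<bar>)"
  proof (intro sum.cong refl)
    fix i t assume i: "i \<in> {..k}" and t: "t \<in> {e i<..<e (Suc i)}"
    have "e (Suc i) \<le> e (Suc k)" using i by (intro e_mono) auto
    then have tr: "t \<in> {1..n - r}" using t e_last by auto
    have "(fd ^^ r) \<theta> t = 0"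
    proof (rule ccontr)
      assume "(fd ^^ r) \<theta> t \<noteq> 0"
      then obtain j where j: "j \<in> {1..k}" "knot n r \<theta> j = Suc t"
        using knots_iff[OF tr] knot_surj[of "Suc t"] by blast
      then have ej: "e j = t" using e_knot[OF j(1)] by simp
      show False
      proof (cases "j \<le> i")
        case True
        then show False using e_mono[of j i] i t ej by auto
      next
        case False
        then show False using e_mono[of "Suc i" j] j(1) t ej by auto
      qed
    qed
    then show "best_sign x t * (fd ^^ r) x t = \<bar>(fd ^^ r) x t\<bar>"
      by (simp add: best_sign_def abs_sgn mult.commute)
  qed
  finally show ?thesis unfolding sum_seg_term .
qed

text \<open>
  The spike is placed at the first knot, since there its support is a single piece of the signal,
  whose length the upper length condition bounds.
\<close>

lemma exists_test_vector:
  "\<exists>\<psi>\<in>Rn n. enorm n \<psi> \<le> half_pow r (e 1) \<and> (\<forall>v\<in>S. ip n v \<psi> = 1)"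
proof -
  have e1: "e 1 \<in> {1..n - r}" "(fd ^^ r) \<theta> (e 1) \<noteq> 0"
    using knot_nonzero[of 1] e_knot[of 1] k_pos by auto
  obtain \<phi> where \<phi>: "\<And>t. t \<ge> 1 \<Longrightarrow> (fd ^^ r) \<phi> t = (if t = e 1 then 1 else 0)"
    "\<And>t. t \<notin> {1..e 1} \<Longrightarrow> \<phi> t = 0" "\<And>t. \<bar>\<phi> t\<bar> \<le> real (e 1) ^ (r - 1)"
    using exists_spike[of r "e 1"] r2 by auto
  define \<psi> where "\<psi> t = sgn ((fd ^^ r) \<theta> (e 1)) * \<phi> t" for t
  have "\<psi> \<in> Rn n" unfolding Rn_def \<psi>_def using \<phi>(2) e1(1) by auto
  moreover have "enorm n \<psi> \<le> half_pow r (e 1)"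
    by (rule enorm_spike_le) (use \<phi>(2,3) e1 in \<open>auto simp: \<psi>_def abs_mult sgn_if\<close>)
  moreover have "ip n v \<psi> = 1" if "v \<in> S" for v
  proof (rule subgradient_spike[OF that \<theta>_in \<open>\<psi> \<in> Rn n\<close> e1])
    fix t assume "t \<in> {1..n - r}"
    then show "(fd ^^ r) \<psi> t = (if t = e 1 then sgn ((fd ^^ r) \<theta> (e 1)) else 0)"
      using \<phi>(1)[of t] unfolding \<psi>_def by (simp add: fd_funpow_cmult)
  qed
  ultimately show ?thesis by blast
qed

definition \<psi> :: "nat \<Rightarrow> real" where
  "\<psi> = (SOME \<psi>. \<psi> \<in> Rn n \<and> enorm n \<psi> \<le> half_pow r (e 1) \<and> (\<forall>v\<in>S. ip n v \<psi> = 1))"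

lemma \<psi>: "\<psi> \<in> Rn n" "enorm n \<psi> \<le> half_pow r (e 1)" "v \<in> S \<Longrightarrow> ip n v \<psi> = 1"
  using someI_ex[of "\<lambda>\<psi>. \<psi> \<in> Rn n \<and> enorm n \<psi> \<le> half_pow r (e 1) \<and> (\<forall>v\<in>S. ip n v \<psi> = 1)"]
    exists_test_vector unfolding \<psi>_def[symmetric] by blast+

sublocale normalised_convex_set n S "2 ^ r * sqrt n" \<psi>
proof
  show "convex S" by (rule subdifferential_convex)
  show "S \<noteq> {}" using best_sign_adj by blast
  show "S \<subseteq> Rn n" by (auto simp: subdifferential_def)
  show "enorm n v \<le> 2 ^ r * sqrt n" if "v \<in> S" for v
    using subgradient_bounded[OF that \<theta>_in r_le_n] .
  show "ip n v \<psi> = 1" if "v \<in> S" for v using \<psi>(3)[OF that] .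
qed

lemma lambda_at_eq: "lambda_at n r \<theta> z = opt_scale z"
  unfolding lambda_at_def opt_scale_def ray_dist_def ..

lemma core_const_nonneg: "0 \<le> core_const r c1"
  unfolding core_const_def using interp_const_ge_1[of r] window_const_pos[of "r - 1"] c1
  by (intro mult_nonneg_nonneg add_nonneg_nonneg) auto

text \<open>
  Let \<open>x = z - \<lambda> v\<close> be the residual. Pairing with \<open>\<psi>\<close> gives \<open>\<lambda> = \<langle>z, \<psi>\<rangle> - \<langle>x, \<psi>\<rangle>\<close>, so it suffices
  to bound the norm of \<open>x\<close>. Optimality says that \<open>x\<close> is a direction in which the total variation does
  not increase and that its squared norm is \<open>\<langle>z, x\<rangle>\<close>, and the correlation bound makes this a
  quadratic inequality for the norm of \<open>x\<close>. All this holds up to an error that tends to zero.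
\<close>

lemma lambda_at_le:
  assumes M: "2 ^ M \<le> real n / real (k + 1)"
  shows "lambda_at n r \<theta> z \<le> ip n z \<psi> + enorm n \<psi> * (core_const r c1 * real (k + 1)
    * sqrt (\<Sum>(a, w)\<in>whitney separators M n. energy z a w))"
proof (rule field_le_epsilon)
  fix \<epsilon> :: real assume "0 < \<epsilon>"
  define A where "A = core_const r c1 * sqrt (\<Sum>(a, w)\<in>whitney separators M n. energy z a w)"
  define B where "B = half_pow r (real n / real (k + 1)) * sqrt (k + 1)"
  have A: "A \<ge> 0" unfolding A_def using core_const_nonneg
    by (simp add: energy_nonneg case_prod_unfold sum_nonneg)
  have "real n / real (k + 1) > 0" using n_ge r2 by simp
  then have B: "B \<ge> 0" unfolding B_def using half_pow_pos[of "real n / real (k + 1)" r] by simp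
  define C where "C = A * B + 1"
  have C: "C > 0" unfolding C_def using A B by (simp add: add_nonneg_pos)
  \<comment> \<open>Chosen so that \<open>enorm n \<psi> * sqrt (\<eta> * C) = \<epsilon>\<close>.\<close>
  define \<eta> where "\<eta> = (\<epsilon> / enorm n \<psi>)\<^sup>2 / C"
  have \<eta>: "\<eta> > 0" unfolding \<eta>_def using C psi_pos \<open>0 < \<epsilon>\<close> by simp
  obtain v where v: "v \<in> S" and opt: "\<And>w. w \<in> S \<Longrightarrow> ip n (z - opt_scale z *\<^sub>R v) w \<le> \<eta>"
    and sq: "(enorm n (z - opt_scale z *\<^sub>R v))\<^sup>2 \<le> ip n z (z - opt_scale z *\<^sub>R v) + \<eta>"
    using approximate_optimality[OF \<eta>] by metis
  define x where "x = z - opt_scale z *\<^sub>R v"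
  define X where "X = enorm n x"
  have "(\<Sum>i\<le>k. seg_term x i) \<le> \<eta>"
    using opt[OF best_sign_adj[of x]] unfolding x_def[symmetric] ip_best_sign .
  then have "ip n z x \<le> A * (real (k + 1) * X + \<eta> * B)"
    unfolding ip_def A_def B_def X_def enorm_eq_l2
    using c1 M sign_change_length \<eta> by (intro correlation_bound) auto
  then have "X\<^sup>2 \<le> (A * real (k + 1)) * X + \<eta> * C"
    using sq unfolding x_def[symmetric] X_def[symmetric] C_def by (simp add: algebra_simps)
  then have "X \<le> A * real (k + 1) + sqrt (\<eta> * C)"
    using A \<eta> C by (intro le_of_square_le) auto
  also have "sqrt (\<eta> * C) = \<epsilon> / enorm n \<psi>" unfolding \<eta>_def using C psi_pos \<open>0 < \<epsilon>\<close> by simp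
  finally have "X * enorm n \<psi> \<le> (A * real (k + 1) + \<epsilon> / enorm n \<psi>) * enorm n \<psi>"
    using psi_pos by (intro mult_right_mono) auto
  also have "\<dots> = enorm n \<psi> * (A * real (k + 1)) + \<epsilon>"
  proof -
    have "\<epsilon> / enorm n \<psi> * enorm n \<psi> = \<epsilon>" using psi_pos by simp
    then show ?thesis unfolding distrib_right by (simp only: mult.commute)
  qed
  finally have "X * enorm n \<psi> \<le> enorm n \<psi> * (A * real (k + 1)) + \<epsilon>" .
  moreover have "ip n x \<psi> = ip n z \<psi> - opt_scale z"
    unfolding x_def by (simp add: ip_simps S_normalised[OF v])
  moreover have "- (X * enorm n \<psi>) \<le> ip n x \<psi>"
    using abs_ip_le[of n x \<psi>] unfolding X_def by linarith
  ultimately have "opt_scale z \<le> ip n z \<psi> + enorm n \<psi> * (A * real (k + 1)) + \<epsilon>" by linarith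
  then show "lambda_at n r \<theta> z \<le> ip n z \<psi> + enorm n \<psi> * (core_const r c1 * real (k + 1)
    * sqrt (\<Sum>(a, w)\<in>whitney separators M n. energy z a w)) + \<epsilon>"
    unfolding lambda_at_eq A_def by (simp add: mult_ac)
qed

text \<open>
  The pointwise bound contains a linear form and the square root of the total energy. Replacing both
  by quadratic majorants leaves an integrable bound whose expectation follows from second moments.
  A nonnegative integrable majorant bounds the Bochner integral of any function below it, because the integral
  of a function that is not integrable is zero.
\<close>

lemma expected_lambda_le:
  assumes M: "2 ^ M \<le> real n / real (k + 1)"
    and N: "real (15 * (k + 2) * M + n div 2 ^ M + 1) \<le> N"
  shows "(\<integral>z. lambda_at n r \<theta> z \<partial>std_gaussian n)
    \<le> enorm n \<psi> * (1 + core_const r c1 * real (k + 1) * (2 * sqrt N))"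
proof -
  interpret P: prob_space "std_gaussian n" by (rule gaussian_prob_space)
  define W where "W = whitney separators M n"
  define E where "E z = (\<Sum>(a, w)\<in>W. energy z a w)" for z
  \<comment> \<open>The total energy has expectation at most \<open>4 * N\<close>; linearising the square root at this value gives the same bound as Jensen's inequality.\<close>
  define q where "q = 2 * sqrt N"
  define c where "c = core_const r c1 * real (k + 1)"
  have c: "c \<ge> 0" unfolding c_def using core_const_nonneg by simp
  have "real 1 \<le> real (15 * (k + 2) * M + n div 2 ^ M + 1)" by (rule of_nat_mono) simp
  with N have N1: "1 \<le> N" by linarith
  have q: "q > 0" "q * q = 4 * N" unfolding q_def using N1 by auto
  have en: "enorm n \<psi> > 0" by (rule psi_pos)
  define bnd where "bnd z = ((\<Sum>t\<in>{1..n}. \<psi> t * z t)\<^sup>2 / enorm n \<psi> + enorm n \<psi>) / 2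
      + enorm n \<psi> * (c * ((E z / q + q) / 2))" for z
  have E_nonneg: "E z \<ge> 0" for z unfolding E_def by (simp add: energy_nonneg case_prod_unfold sum_nonneg)
  have ener: "integrable (std_gaussian n) (\<lambda>z. energy z a w)"
    "(\<integral>z. energy z a w \<partial>std_gaussian n) \<le> 4" if "(a, w) \<in> W" for a w
    using energy_expectation[OF whitney_subset[OF that[unfolded W_def] separators_ends]]
      whitney_size[OF that[unfolded W_def]] by auto
  have Eint: "integrable (std_gaussian n) E"
    unfolding E_def case_prod_unfold by (intro Bochner_Integration.integrable_sum) (use ener(1) in auto)
  have card: "card W \<le> N"
  proof -
    have "card W \<le> 15 * card separators * M + n div 2 ^ M + 1"
      unfolding W_def by (rule card_whitney_le[OF finite_separators])
    also have "\<dots> \<le> 15 * (k + 2) * M + n div 2 ^ M + 1"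
      using card_separators by (intro add_mono mult_mono) auto
    finally have "real (card W) \<le> real (15 * (k + 2) * M + n div 2 ^ M + 1)" by (simp only: of_nat_le_iff)
    then show ?thesis using N by linarith
  qed
  have "(\<integral>z. E z \<partial>std_gaussian n) = (\<Sum>B\<in>W. \<integral>z. energy z (fst B) (snd B) \<partial>std_gaussian n)"
    unfolding E_def case_prod_unfold by (rule Bochner_Integration.integral_sum) (use ener(1) in auto)
  also have "\<dots> \<le> (\<Sum>B\<in>W. 4)" by (rule sum_mono) (use ener(2) in auto)
  also have "\<dots> \<le> 4 * N" using card by simp
  finally have Eexp: "(\<integral>z. E z \<partial>std_gaussian n) \<le> 4 * N" .
  note lin = gaussian_linear_form[of "{1..n}" n \<psi>, OF order_refl]
  have linexp: "(\<integral>z. (\<Sum>t\<in>{1..n}. \<psi> t * z t)\<^sup>2 \<partial>std_gaussian n) = (enorm n \<psi>)\<^sup>2"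
    unfolding lin(2) enorm_square ip_def by (simp add: power2_eq_square)
  have int1: "integrable (std_gaussian n) (\<lambda>z. ((\<Sum>t\<in>{1..n}. \<psi> t * z t)\<^sup>2 / enorm n \<psi> + enorm n \<psi>) / 2)"
    by (intro integrable_divide Bochner_Integration.integrable_add lin P.integrable_const)
  have int2: "integrable (std_gaussian n) (\<lambda>z. enorm n \<psi> * (c * ((E z / q + q) / 2)))"
    by (intro integrable_mult_right integrable_divide Bochner_Integration.integrable_add Eint P.integrable_const)
  have "(\<integral>z. lambda_at n r \<theta> z \<partial>std_gaussian n) \<le> (\<integral>z. bnd z \<partial>std_gaussian n)"
  proof (rule integral_mono')
    show "integrable (std_gaussian n) bnd"
      unfolding bnd_def by (rule Bochner_Integration.integrable_add[OF int1 int2])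
    fix z
    show "lambda_at n r \<theta> z \<le> bnd z"
    proof -
      have i: "ip n z \<psi> = (\<Sum>t\<in>{1..n}. \<psi> t * z t)" by (simp add: ip_def mult.commute)
      have lin_part: "ip n z \<psi> \<le> ((ip n z \<psi>)\<^sup>2 / enorm n \<psi> + enorm n \<psi>) / 2"
        using sqrt_le_linear[of "(ip n z \<psi>)\<^sup>2" "enorm n \<psi>"] en abs_ge_self[of "ip n z \<psi>"] by simp
      have energy_part: "enorm n \<psi> * (c * sqrt (E z)) \<le> enorm n \<psi> * (c * ((E z / q + q) / 2))"
        using sqrt_le_linear[OF E_nonneg q(1)] c en by (intro mult_left_mono) auto
      have "lambda_at n r \<theta> z \<le> ip n z \<psi> + enorm n \<psi> * (c * sqrt (E z))"
        using lambda_at_le[OF M, of z] unfolding c_def E_def W_def by (simp add: mult.assoc)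
      from order_trans[OF this add_mono[OF lin_part energy_part]] show ?thesis unfolding bnd_def i .
    qed
    show "0 \<le> bnd z"
      unfolding bnd_def using en c E_nonneg q(1)
      by (intro add_nonneg_nonneg divide_nonneg_nonneg mult_nonneg_nonneg) auto
  qed
  also have "(\<integral>z. bnd z \<partial>std_gaussian n) = enorm n \<psi>
      + enorm n \<psi> * (c * (((\<integral>z. E z \<partial>std_gaussian n) / q + q) / 2))"
  proof -
    have i1: "integrable (std_gaussian n) (\<lambda>z. (\<Sum>t\<in>{1..n}. \<psi> t * z t)\<^sup>2 / enorm n \<psi>)"
      by (intro integrable_divide lin)
    have i2: "integrable (std_gaussian n) (\<lambda>z. E z / q)" by (intro integrable_divide Eint)
    have i3: "integrable (std_gaussian n) (\<lambda>z. a :: real)" for a by (rule P.integrable_const)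
    have one: "(\<integral>z. a \<partial>std_gaussian n) = a" for a :: real by (simp add: P.prob_space)
    have "(\<integral>z. bnd z \<partial>std_gaussian n)
        = ((\<integral>z. (\<Sum>t\<in>{1..n}. \<psi> t * z t)\<^sup>2 \<partial>std_gaussian n) / enorm n \<psi> + enorm n \<psi>) / 2
          + enorm n \<psi> * (c * (((\<integral>z. E z \<partial>std_gaussian n) / q + q) / 2))"
      unfolding bnd_def
      by (simp only: Bochner_Integration.integral_add[OF int1 int2] integral_mult_right_zero integral_divide_zero
          Bochner_Integration.integral_add[OF i1 i3] Bochner_Integration.integral_add[OF i2 i3] one)
    then show ?thesis unfolding linexp using en by (simp add: power2_eq_square)
  qed
  also have "\<dots> \<le> enorm n \<psi> + enorm n \<psi> * (c * q)"
  proof -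
    have "(\<integral>z. E z \<partial>std_gaussian n) / q \<le> q" using Eexp q by (simp add: pos_divide_le_eq)
    then show ?thesis using c en by (intro add_left_mono mult_left_mono) auto
  qed
  finally show ?thesis unfolding c_def q_def by (simp add: distrib_left)
qed

text \<open>
  The norm of \<open>\<psi>\<close> contributes \<open>n / (k + 1)\<close> to the power \<open>r - 1 / 2\<close>, the residual contributes
  \<open>k + 1\<close> to the power \<open>3 / 2\<close>. The product is at most \<open>n\<close> to the power \<open>r - 1 / 2\<close> because \<open>r \<ge> 2\<close>.
\<close>

lemma lambda_star_le:
  "lambda_star n r \<theta> \<le> (3 + 16 * core_const r c1) * c2 ^ r
    * sqrt (real n * ln (exp 1 * real n / (real k + 1)))"
proof -
  define y where "y = real n / real (k + 1)"
  define K where "K = real (k + 1)"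
  define l where "l = ln (exp 1 * real n / real (k + 1))"
  have n0: "0 < real n" using n_ge r2 by simp
  have kn: "k + 1 \<le> n"
  proof -
    have "knots n r \<theta> \<subseteq> {2..n - r + 1}" by (auto simp: knots_def)
    then have "k \<le> n - r" unfolding num_knots_def using card_mono[of "{2..n - r + 1}" "knots n r \<theta>"] by simp
    then show ?thesis using r2 n_ge by simp
  qed
  have y: "1 \<le> y" unfolding y_def using kn by (simp add: le_divide_eq)
  have K: "1 \<le> K" "real n = y * K" unfolding K_def y_def by auto
  have "exp 1 * real n / real (k + 1) = exp 1 * y" by (simp add: y_def)
  then have l: "1 \<le> l" unfolding l_def using y by (simp add: ln_mult)
  obtain M :: nat where M: "2 ^ M \<le> y" "y < 2 ^ Suc M"
  proof -
    \<comment> \<open>The largest dyadic length that is at most \<open>n / (k + 1)\<close>.\<close>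
    define M where "M = nat \<lfloor>log 2 y\<rfloor>"
    have "0 \<le> log 2 y" using y by simp
    then have "real M \<le> log 2 y" "log 2 y < real (Suc M)" unfolding M_def by linarith+
    then have "2 powr real M \<le> y" "y < 2 powr real (Suc M)"
      using y by (simp_all add: le_log_iff log_less_iff)
    then show ?thesis by (intro that[of M]) (simp_all only: powr_realpow zero_less_numeral)
  qed
  have count: "real (15 * (k + 2) * M + n div 2 ^ M + 1) \<le> 64 * K * l"
    unfolding K_def l_def by (rule whitney_count_log) (use kn M in \<open>simp_all only: y_def\<close>)
  have "sqrt (64 * K * l) = 8 * (sqrt K * sqrt l)" by (simp add: real_sqrt_mult)
  then have int: "(\<integral>z. lambda_at n r \<theta> z \<partial>std_gaussian n)
      \<le> enorm n \<psi> * (1 + 16 * core_const r c1 * (K * sqrt K * sqrt l))"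
    using expected_lambda_le[OF _ count] M(1) unfolding y_def K_def[symmetric] by (simp add: mult_ac)
  have "2 / enorm n (v_zero n r \<theta>) \<le> 2 * enorm n \<psi>"
    using min_norm_affine_hull unfolding v_zero_def by simp
  with int have "(\<integral>z. lambda_at n r \<theta> z \<partial>std_gaussian n) + 2 / enorm n (v_zero n r \<theta>)
      \<le> enorm n \<psi> * (3 + 16 * core_const r c1 * (K * sqrt K * sqrt l))"
    by (simp add: algebra_simps)
  also have "\<dots> \<le> enorm n \<psi> * ((3 + 16 * core_const r c1) * (K * sqrt K * sqrt l))"
  proof (intro mult_left_mono enorm_nonneg)
    have "1 * 1 * 1 \<le> K * sqrt K * sqrt l" using K(1) l by (intro mult_mono) auto
    then show "3 + 16 * core_const r c1 * (K * sqrt K * sqrt l)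
        \<le> (3 + 16 * core_const r c1) * (K * sqrt K * sqrt l)"
      by (simp add: distrib_right)
  qed
  also have "\<dots> \<le> (c2 ^ r * half_pow r y) * ((3 + 16 * core_const r c1) * (K * sqrt K * sqrt l))"
  proof (rule mult_right_mono)
    have "enorm n \<psi> \<le> half_pow r (c2 * y)"
      using \<psi>(2) half_pow_mono[of "real (e 1)" "c2 * y" r] first_knot_le unfolding y_def by linarith
    also have "\<dots> = (sqrt c2 * c2 ^ (r - 1)) * half_pow r y"
      by (simp add: half_pow_def real_sqrt_mult power_mult_distrib)
    also have "\<dots> \<le> (c2 * c2 ^ (r - 1)) * half_pow r y"
    proof -
      have "sqrt c2 \<le> c2" using c2 by (intro real_le_lsqrt) (auto simp: power2_eq_square)
      then show ?thesis using c2 y half_pow_pos[of y r] by (intro mult_right_mono) auto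
    qed
    also have "c2 * c2 ^ (r - 1) = c2 ^ r" using r2 by (simp flip: power_Suc)
    finally show "enorm n \<psi> \<le> c2 ^ r * half_pow r y" .
    show "0 \<le> (3 + 16 * core_const r c1) * (K * sqrt K * sqrt l)"
      using core_const_nonneg K l by (intro mult_nonneg_nonneg add_nonneg_nonneg) auto
  qed
  also have "\<dots> \<le> real n ^ (r - 1) * ((3 + 16 * core_const r c1) * c2 ^ r * sqrt (real n * l))"
  proof -
    have "half_pow r y * (K * sqrt K) = sqrt (real n) * (y ^ (r - 1) * K)"
      unfolding half_pow_def K(2) by (simp add: real_sqrt_mult mult_ac)
    also have "\<dots> \<le> sqrt (real n) * (y ^ (r - 1) * K ^ (r - 1))"
      using K(1) y r2 by (intro mult_left_mono self_le_power) auto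
    also have "y ^ (r - 1) * K ^ (r - 1) = real n ^ (r - 1)" by (simp add: K(2) power_mult_distrib)
    finally have "half_pow r y * (K * sqrt K) \<le> sqrt (real n) * real n ^ (r - 1)" .
    moreover have "0 \<le> (3 + 16 * core_const r c1) * c2 ^ r * sqrt l"
      using core_const_nonneg c2 l by (intro mult_nonneg_nonneg add_nonneg_nonneg) auto
    ultimately have "((3 + 16 * core_const r c1) * c2 ^ r * sqrt l) * (half_pow r y * (K * sqrt K))
        \<le> ((3 + 16 * core_const r c1) * c2 ^ r * sqrt l) * (sqrt (real n) * real n ^ (r - 1))"
      by (rule mult_left_mono)
    then show ?thesis by (simp only: real_sqrt_mult mult_ac)
  qed
  finally have main: "(\<integral>z. lambda_at n r \<theta> z \<partial>std_gaussian n) + 2 / enorm n (v_zero n r \<theta>)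
      \<le> real n ^ (r - 1) * ((3 + 16 * core_const r c1) * c2 ^ r * sqrt (real n * l))" .
  have pw: "real n powi (1 - int r) = inverse (real n ^ (r - 1))"
    using r2 by (simp add: power_int_def nat_diff_distrib power_inverse)
  have "lambda_star n r \<theta> \<le> inverse (real n ^ (r - 1))
      * (real n ^ (r - 1) * ((3 + 16 * core_const r c1) * c2 ^ r * sqrt (real n * l)))"
    unfolding lambda_star_def pw using main n0 by (intro mult_left_mono) auto
  also have "\<dots> = (3 + 16 * core_const r c1) * c2 ^ r * sqrt (real n * l)" using n0 by simp
  finally show ?thesis unfolding l_def by (simp add: add.commute)
qed

end

theorem lemma2p12:
  fixes r :: nat and c1 c2 :: real
  assumes "r \<ge> 2" and "0 < c1" and "c1 \<le> 1" and "c2 \<ge> 1"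
  shows "\<exists>C > 0. \<forall>n \<ge> 2 * r. \<forall>\<theta> \<in> Rn n.
           Diff n r \<theta> \<noteq> 0 \<longrightarrow> length_condition n r c1 c2 \<theta> \<longrightarrow>
           lambda_star n r \<theta>
             \<le> C * sqrt (real n * ln (exp 1 * real n / (real (num_knots n r \<theta>) + 1)))"
proof (intro exI[of _ "(3 + 16 * core_const r c1) * c2 ^ r"] conjI allI ballI impI)
  have "0 \<le> core_const r c1"
    unfolding core_const_def using interp_const_ge_1[of r] window_const_pos[of "r - 1"] assms(2)
    by (intro mult_nonneg_nonneg add_nonneg_nonneg) auto
  then show "0 < (3 + 16 * core_const r c1) * c2 ^ r" using assms(4) by (intro mult_pos_pos) auto
next
  fix n \<theta> assume "2 * r \<le> n" "\<theta> \<in> Rn n" "Diff n r \<theta> \<noteq> 0" "length_condition n r c1 c2 \<theta>"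
  then interpret trend_signal n r \<theta> c1 c2 by unfold_locales (use assms in auto)
  show "lambda_star n r \<theta> \<le> (3 + 16 * core_const r c1) * c2 ^ r *
      sqrt (real n * ln (exp 1 * real n / (real (num_knots n r \<theta>) + 1)))"
    by (rule lambda_star_le)
qed

end
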